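(* Let $X$ be a P-complex in $V$ with compact cells and $S=\bigwedge^*V$. For every convenient point $v\in\mathcal{U}(X)\subset V^*$ and all $p,q\ge0$, $$\mathrm{vol}^X_p\smile_v\mathrm{vol}^X_q=\mathrm{vol}^X_{p+q}.$$
   Context: $V$ is a real vector space of finite dimension $n$, $V^*$ its dual. P-complex: a finite set $X$ of closed convex polyhedra in $V$ (its cells) such that every face of a cell is a cell and every non-empty intersection of two cells is a common face of both. All cells are assumed compact. Cochains: $S$ is a supercommutative ring ($\mathbb{Z}/2$-graded, $ab=(-1)^{|a||b|}ba$ for homogeneous $a,b$); here $S=\bigwedge^*V$. $C^p(X,S)$ is the module of functions from oriented $p$-dimensional cells to $S$ that change sign when the orientation of the cell is reversed. For a cell $\delta$, $V_\delta\subset V$ is the linear subspace generated by differences of points of $\delta$. For a cell $\gamma$, let $X_\gamma$ be the P-complex in $V_\gamma$ of faces of $\gamma$ ($\gamma$ translated into $V_\gamma$; the choice is immaterial). For a face $\delta$ of $\gamma$ the dual cone $\delta^*\subset (V_\gamma)^*$ consists of all $w\in(V_\gamma)^*$ for which the maximum of $w$ on $\gamma$ is attained at every point of $\delta$; $\dim\delta^*=\dim\gamma-\dim\delta$. These cones form the dual fan $X_\gamma^*$, with $j$-dimensional skeleton $(X_\gamma^* )^j$. Let $\pi_\gamma\colon V^*\to(V_\gamma)^*$ be the restriction map. Two P-complexes in a space are transversal if for any cells $\delta_1,\delta_2$ of them with $\delta_1\cap\delta_2\ne\emptyset$ one has $\operatorname{codim}(V_{\delta_1}\cap V_{\delta_2})=\operatorname{codim}V_{\delta_1}+\operatorname{codim}V_{\delta_2}$.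 A point $v\in V^*$ is $(p,q)$-convenient if $\pi_\gamma(v)+(X_\gamma^* )^q$ and $(X_\gamma^* )^p$ are transversal for every $\gamma\in X$ with $\dim\gamma=p+q$; $\mathcal{U}_{p,q}(X)$ is the set of such points, and $\mathcal{U}(X)=\bigcap_{p,q}\mathcal{U}_{p,q}(X)$ is the set of convenient points. Product: for $v\in\mathcal{U}_{p,q}(X)$ and an oriented cell $\gamma$ of dimension $p+q$, $(r_p\smile_v r_q)(\gamma)=\sum_{(\delta,\lambda)\in\mathcal{P}(p,q,\gamma,v)}r_p(\delta)r_q(\lambda)$, where $\mathcal{P}(p,q,\gamma,v)$ is the set of pairs $(\delta,\lambda)$ of faces of $\gamma$ of dimensions $p,q$ with $(\pi_\gamma(v)+\delta^* )\cap\lambda^*\neq\emptyset$, oriented so that $V_\gamma=V_\delta\oplus V_\lambda$ as oriented spaces. Volume cochain: for a bounded (relatively open) set $U$ in a $q$-dimensional oriented affine subspace of $V$, $\beta_U\in\bigwedge^qV$ is the multivector with $\int_U\omega=\omega(\beta_U)$ for every constant exterior form $\omega\in\bigwedge^qV^*$. The cochain $\mathrm{vol}^X_q\in C^q(X,S)$ is defined by $\mathrm{vol}^X_q(\delta)=q!\,\beta_\delta$ (for an oriented $q$-cell $\delta$; on a positively oriented vertex $\mathrm{vol}^X_0$ equals $1$). *)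

theory Defs
  imports
    "HOL-Analysis.Analysis"
    "HOL-Library.Poly_Mapping"
    "HOL-Library.Function_Algebras"
    "HOL-Combinatorics.Permutations"
begin

section \<open>The exterior algebra of a real vector space\<close>

text \<open>
  The exterior algebra of a vector space \<open>V\<close> is the free associative unital real algebra on the
  set \<open>V\<close> modulo the two-sided ideal generated by the linearity relations and the squares of
  vectors. The free algebra is the monoid algebra of the monoid of words in \<open>V\<close>; words get a type
  of their own so that no arithmetic is put on lists.
\<close>

datatype 'a word = Word (letters: "'a list")

instantiation word :: (type) monoid_add
begin

definition zero_word :: "'a word" where "0 = Word []"

definition plus_word :: "'a word \<Rightarrow> 'a word \<Rightarrow> 'a word"
  where "u + w = Word (letters u @ letters w)"

instance
  by standard (simp_all add: zero_word_def plus_word_def)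

end

type_synonym 'a free_alg = "'a word \<Rightarrow>\<^sub>0 real"

definition gen :: "'a \<Rightarrow> 'a free_alg"
  where "gen x = Poly_Mapping.single (Word [x]) 1"

inductive_set ext_ideal :: "'a::real_vector free_alg set"
  where
    ext_ideal_add: "gen (x + y) - gen x - gen y \<in> ext_ideal"
  | ext_ideal_scale: "gen (c *\<^sub>R x) - Poly_Mapping.single 0 c * gen x \<in> ext_ideal"
  | ext_ideal_square: "gen x * gen x \<in> ext_ideal"
  | ext_ideal_plus: "f \<in> ext_ideal \<Longrightarrow> g \<in> ext_ideal \<Longrightarrow> f + g \<in> ext_ideal"
  | ext_ideal_left: "f \<in> ext_ideal \<Longrightarrow> h * f \<in> ext_ideal"
  | ext_ideal_right: "f \<in> ext_ideal \<Longrightarrow> f * h \<in> ext_ideal"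

lemma ext_ideal_zero: "0 \<in> ext_ideal"
  using ext_ideal_left[OF ext_ideal_square, of 0] by simp

lemma ext_ideal_uminus: "f \<in> ext_ideal \<Longrightarrow> - f \<in> ext_ideal"
  using ext_ideal_left[of f "- 1"] by simp

lemma ext_ideal_minus: "f \<in> ext_ideal \<Longrightarrow> g \<in> ext_ideal \<Longrightarrow> f - g \<in> ext_ideal"
  using ext_ideal_plus[OF _ ext_ideal_uminus, of f g] by simp

definition ext_eq :: "'a::real_vector free_alg \<Rightarrow> 'a free_alg \<Rightarrow> bool"
  where "ext_eq f g \<longleftrightarrow> f - g \<in> ext_ideal"

quotient_type (overloaded) 'a ext = "'a::real_vector free_alg" / ext_eq
proof (rule equivpI)
  show "reflp ext_eq"
    by (simp add: reflp_def ext_eq_def ext_ideal_zero)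
  show "symp ext_eq"
    unfolding symp_def ext_eq_def using ext_ideal_uminus by fastforce
  show "transp ext_eq"
    unfolding transp_def ext_eq_def using ext_ideal_plus by fastforce
qed

text \<open>
  A \<open>q\<close>-linear form on \<open>V\<close> is a function on lists that is only looked at on lists of length \<open>q\<close>.
\<close>

definition alternating_form :: "nat \<Rightarrow> ('a::real_vector list \<Rightarrow> real) \<Rightarrow> bool"
  where "alternating_form q \<omega> \<longleftrightarrow>
    (\<forall>xs i. length xs = q \<and> i < q \<longrightarrow> linear (\<lambda>x. \<omega> (xs[i := x]))) \<and>
    (\<forall>xs i j. length xs = q \<and> i < j \<and> j < q \<and> xs ! i = xs ! j \<longrightarrow> \<omega> xs = 0)"

definition free_pair :: "nat \<Rightarrow> ('a list \<Rightarrow> real) \<Rightarrow> 'a free_alg \<Rightarrow> real"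
  where "free_pair q \<omega> f =
    (\<Sum>w\<in>Poly_Mapping.keys f.
      Poly_Mapping.lookup f w * (if length (letters w) = q then \<omega> (letters w) else 0))"

lemma free_pair_plus: "free_pair q \<omega> (f + g) = free_pair q \<omega> f + free_pair q \<omega> g"
  unfolding free_pair_def
  by (rule setsum_keys_plus_distrib) (simp_all add: distrib_right)

lemma free_pair_zero [simp]: "free_pair q \<omega> 0 = 0"
  by (simp add: free_pair_def)

lemma free_pair_uminus: "free_pair q \<omega> (- f) = - free_pair q \<omega> f"
  using free_pair_plus[of q \<omega> f "- f"] by simp

lemma free_pair_minus: "free_pair q \<omega> (f - g) = free_pair q \<omega> f - free_pair q \<omega> g"
  using free_pair_plus[of q \<omega> f "- g"] by (simp add: free_pair_uminus)

lemma free_pair_single: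
  "free_pair q \<omega> (Poly_Mapping.single w c) =
    c * (if length (letters w) = q then \<omega> (letters w) else 0)"
  by (cases "c = 0") (simp_all add: free_pair_def)

lemma free_alg_induct [case_names zero plus single]:
  fixes f :: "'b \<Rightarrow>\<^sub>0 'c::comm_monoid_add"
  assumes "P 0" and "\<And>f g. P f \<Longrightarrow> P g \<Longrightarrow> P (f + g)"
    and "\<And>w c. P (Poly_Mapping.single w c)"
  shows "P f"
proof (induction f rule: update_induct)
  case const
  show ?case by (rule assms(1))
next
  case (update f a b)
  have "Poly_Mapping.update a b f = f + Poly_Mapping.single a b"
    using update by (intro poly_mapping_eqI) (auto simp: lookup_update lookup_add lookup_single
        when_def in_keys_iff)
  then show ?case using update assms by simp
qed

lemma alternating_form_slot:
  assumes "alternating_form q \<omega>" and "length us + length ws + 1 = q"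
  shows "linear (\<lambda>x. \<omega> (us @ x # ws))"
proof -
  have "length (us @ 0 # ws) = q" "length us < q"
    using assms(2) by simp_all
  then have "linear (\<lambda>x. \<omega> ((us @ 0 # ws)[length us := x]))"
    using assms(1) unfolding alternating_form_def by blast
  then show ?thesis by simp
qed

lemma free_pair_ideal_single:
  assumes alt: "alternating_form q \<omega>" and "f \<in> ext_ideal"
  shows "free_pair q \<omega> (g * f * h) = 0"
  using assms(2)
proof (induction arbitrary: g h)
  case (ext_ideal_add x y)
  show ?case
  proof (induction g rule: free_alg_induct)
    case (single w c)
    show ?case
    proof (induction h rule: free_alg_induct)
      case s: (single u d)
      show ?case
        using linear_add[OF alternating_form_slot[OF alt, of "letters w" "letters u"], of x y]
        by (auto simp: gen_def ring_distribs mult_single free_pair_minus free_pair_single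
            plus_word_def)
    qed (simp_all add: distrib_left free_pair_plus)
  qed (simp_all add: distrib_right free_pair_plus)
next
  case (ext_ideal_scale c x)
  show ?case
  proof (induction g rule: free_alg_induct)
    case (single w b)
    show ?case
    proof (induction h rule: free_alg_induct)
      case s: (single u d)
      show ?case
        using linear_scale[OF alternating_form_slot[OF alt, of "letters w" "letters u"], of c x]
        by (auto simp: gen_def ring_distribs mult_single free_pair_minus free_pair_single
            plus_word_def zero_word_def)
    qed (simp_all add: distrib_left free_pair_plus)
  qed (simp_all add: distrib_right free_pair_plus)
next
  case (ext_ideal_square x)
  show ?case
  proof (induction g rule: free_alg_induct)
    case (single w b)
    show ?case
    proof (induction h rule: free_alg_induct)
      case s: (single u d)
      have "\<omega> (letters w @ x # x # letters u) = 0" if "length (letters w) + length (letters u) + 2 = q"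
      proof -
        let ?xs = "letters w @ x # x # letters u"
        have "length ?xs = q" "length (letters w) < Suc (length (letters w))"
          "Suc (length (letters w)) < q"
          "?xs ! length (letters w) = ?xs ! Suc (length (letters w))"
          using that by (auto simp: nth_append)
        then show ?thesis using alt unfolding alternating_form_def by blast
      qed
      then show ?case
        by (auto simp: gen_def mult_single free_pair_single plus_word_def)
    qed (simp_all add: distrib_left free_pair_plus)
  qed (simp_all add: distrib_right free_pair_plus)
next
  case (ext_ideal_plus f1 f2)
  then show ?case by (simp add: ring_distribs free_pair_plus)
next
  case (ext_ideal_left f k)
  show ?case using ext_ideal_left.IH[of "g * k" h] by (simp add: mult.assoc)
next
  case (ext_ideal_right f k)
  show ?case using ext_ideal_right.IH[of g "k * h"] by (simp add: mult.assoc)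
qed

lemma free_pair_ideal:
  assumes "alternating_form q \<omega>" and "f \<in> ext_ideal"
  shows "free_pair q \<omega> f = 0"
  using free_pair_ideal_single[OF assms, of 1 1] by simp

lemma one_notin_ext_ideal: "1 \<notin> ext_ideal"
proof
  assume "1 \<in> (ext_ideal :: 'a free_alg set)"
  moreover have "alternating_form 0 (\<lambda>_ :: 'a list. 1)"
    by (simp add: alternating_form_def)
  ultimately have "free_pair 0 (\<lambda>_. 1) (1 :: 'a free_alg) = 0"
    by (rule free_pair_ideal[rotated])
  moreover have "free_pair 0 (\<lambda>_. 1) (1 :: 'a free_alg) = 1"
    unfolding single_one[symmetric] free_pair_single by (simp add: zero_word_def)
  ultimately show False by simp
qed

lemma single_zero_commute:
  fixes f :: "'a free_alg"
  shows "Poly_Mapping.single 0 c * f = f * Poly_Mapping.single 0 c"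
  by (induction f rule: free_alg_induct) (simp_all add: distrib_left distrib_right mult_single mult.commute)

instantiation ext :: (real_vector) real_algebra_1
begin

lift_definition zero_ext :: "'a ext" is 0 .

lift_definition one_ext :: "'a ext" is 1 .

lift_definition plus_ext :: "'a ext \<Rightarrow> 'a ext \<Rightarrow> 'a ext" is "(+)"
  unfolding ext_eq_def by (simp add: add_diff_add ext_ideal_plus)

lift_definition uminus_ext :: "'a ext \<Rightarrow> 'a ext" is uminus
  unfolding ext_eq_def minus_diff_minus by (rule ext_ideal_uminus)

lift_definition minus_ext :: "'a ext \<Rightarrow> 'a ext \<Rightarrow> 'a ext" is "(-)"
  unfolding ext_eq_def
proof -
  fix f f' g g' :: "'a free_alg"
  assume "f - f' \<in> ext_ideal" "g - g' \<in> ext_ideal"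
  then show "f - g - (f' - g') \<in> ext_ideal"
    using ext_ideal_minus[of "f - f'" "g - g'"] by (simp add: algebra_simps)
qed

lift_definition times_ext :: "'a ext \<Rightarrow> 'a ext \<Rightarrow> 'a ext" is "(*)"
  unfolding ext_eq_def
proof -
  fix f f' g g' :: "'a free_alg"
  assume "f - f' \<in> ext_ideal" "g - g' \<in> ext_ideal"
  then have "(f - f') * g + f' * (g - g') \<in> ext_ideal"
    by (intro ext_ideal_plus ext_ideal_left ext_ideal_right)
  then show "f * g - f' * g' \<in> ext_ideal" by (simp add: ring_distribs)
qed

lift_definition scaleR_ext :: "real \<Rightarrow> 'a ext \<Rightarrow> 'a ext" is "\<lambda>c f. Poly_Mapping.single 0 c * f"
  unfolding ext_eq_def by (simp add: ext_ideal_left flip: right_diff_distrib)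

instance
proof
  fix a b c :: "'a ext" and r s :: real
  show "a + b + c = a + (b + c)"
    by transfer (simp add: ext_eq_def add.assoc ext_ideal_zero)
  show "a + b = b + a"
    by transfer (simp add: ext_eq_def add.commute ext_ideal_zero)
  show "0 + a = a"
    by transfer (simp add: ext_eq_def ext_ideal_zero)
  show "- a + a = 0"
    by transfer (simp add: ext_eq_def ext_ideal_zero)
  show "a - b = a + - b"
    by transfer (simp add: ext_eq_def ext_ideal_zero)
  show "a * b * c = a * (b * c)"
    by transfer (simp add: ext_eq_def mult.assoc ext_ideal_zero)
  show "1 * a = a" "a * 1 = a"
    by (transfer, simp add: ext_eq_def ext_ideal_zero)+
  show "(a + b) * c = a * c + b * c" "a * (b + c) = a * b + a * c"
    by (transfer, simp add: ext_eq_def ring_distribs ext_ideal_zero)+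
  show "(0 :: 'a ext) \<noteq> 1"
  proof transfer
    show "\<not> ext_eq (0 :: 'a free_alg) 1"
      using one_notin_ext_ideal ext_ideal_uminus[of "- (1 :: 'a free_alg)"]
      by (auto simp: ext_eq_def)
  qed
  show "r *\<^sub>R (a + b) = r *\<^sub>R a + r *\<^sub>R b"
    by transfer (simp add: ext_eq_def ring_distribs ext_ideal_zero)
  show "(r + s) *\<^sub>R a = r *\<^sub>R a + s *\<^sub>R a"
    by transfer (simp add: ext_eq_def ring_distribs single_add ext_ideal_zero)
  show "r *\<^sub>R s *\<^sub>R a = (r * s) *\<^sub>R a"
    by transfer (simp add: ext_eq_def mult.assoc[symmetric] mult_single ext_ideal_zero)
  show "1 *\<^sub>R a = a"
    by transfer (simp add: ext_eq_def ext_ideal_zero)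
  show "r *\<^sub>R a * b = r *\<^sub>R (a * b)"
    by transfer (simp add: ext_eq_def mult.assoc ext_ideal_zero)
  show "a * r *\<^sub>R b = r *\<^sub>R (a * b)"
  proof transfer
    fix f g :: "'a free_alg" and r :: real
    have "f * (Poly_Mapping.single 0 r * g) = Poly_Mapping.single 0 r * (f * g)"
      by (simp only: mult.assoc[symmetric] single_zero_commute[of r f])
    then show "ext_eq (f * (Poly_Mapping.single 0 r * g)) (Poly_Mapping.single 0 r * (f * g))"
      by (simp add: ext_eq_def ext_ideal_zero)
  qed
qed

end

lift_definition ext_vec :: "'a::real_vector \<Rightarrow> 'a ext" is gen .

definition wedge :: "'a::real_vector list \<Rightarrow> 'a ext"
  where "wedge xs = prod_list (map ext_vec xs)"

definition ext_grade :: "nat \<Rightarrow> 'a::real_vector ext set"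
  where "ext_grade q = span {wedge xs |xs. length xs = q}"

lemma ext_vec_linear: "linear ext_vec"
proof (rule linearI)
  fix x y :: 'a and c :: real
  show "ext_vec (x + y) = ext_vec x + ext_vec y"
    by transfer (simp add: ext_eq_def ext_ideal_add[unfolded diff_diff_eq])
  show "ext_vec (c *\<^sub>R x) = c *\<^sub>R ext_vec x"
    by transfer (simp add: ext_eq_def ext_ideal_scale)
qed

lemma ext_vec_square: "ext_vec x * ext_vec x = 0"
  by transfer (simp add: ext_eq_def ext_ideal_square)

lemma ext_vec_anticommute: "ext_vec x * ext_vec y = - (ext_vec y * ext_vec x)"
proof -
  have "ext_vec (x + y) * ext_vec (x + y) = ext_vec x * ext_vec y + ext_vec y * ext_vec x"
    unfolding linear_add[OF ext_vec_linear] by (simp add: ring_distribs ext_vec_square)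
  then show ?thesis by (simp add: ext_vec_square eq_neg_iff_add_eq_0)
qed

text \<open>
  The value on \<open>b \<in> \<And>V\<close> of an alternating \<open>q\<close>-form \<open>\<omega>\<close>. For alternating \<open>\<omega>\<close> this does not depend on
  the representative of \<open>b\<close> and is the linear map with
  \<open>x\<^sub>1 \<and> \<dots> \<and> x\<^sub>q \<mapsto> \<omega>(x\<^sub>1, \<dots>, x\<^sub>q)\<close> that vanishes in all degrees other than \<open>q\<close>.
\<close>

definition form_pair :: "nat \<Rightarrow> ('a::real_vector list \<Rightarrow> real) \<Rightarrow> 'a ext \<Rightarrow> real"
  where "form_pair q \<omega> b = free_pair q \<omega> (rep_ext b)"

lemma form_pair_abs:
  assumes "alternating_form q \<omega>"
  shows "form_pair q \<omega> (abs_ext f) = free_pair q \<omega> f"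
proof -
  have "ext_eq (rep_ext (abs_ext f)) f"
    using Quotient3_rel[OF Quotient3_ext, of "rep_ext (abs_ext f)" f]
    by (simp add: Quotient3_abs_rep[OF Quotient3_ext] ext_eq_def ext_ideal_zero)
  then have "free_pair q \<omega> (rep_ext (abs_ext f) - f) = 0"
    using assms by (intro free_pair_ideal) (simp_all add: ext_eq_def)
  then show ?thesis by (simp add: form_pair_def free_pair_minus)
qed

lemma form_pair_linear:
  fixes \<omega> :: "'a::real_vector list \<Rightarrow> real"
  assumes "alternating_form q \<omega>"
  shows "linear (form_pair q \<omega>)"
proof (rule linearI)
  fix a b :: "'a ext" and c :: real
  obtain f g where fg: "a = abs_ext f" "b = abs_ext g"
    by (metis Quotient3_abs_rep Quotient3_ext)
  show "form_pair q \<omega> (a + b) = form_pair q \<omega> a + form_pair q \<omega> b"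
    by (simp add: fg plus_ext.abs_eq form_pair_abs[OF assms] free_pair_plus)
  have "free_pair q \<omega> (Poly_Mapping.single 0 c * f) = c * free_pair q \<omega> f"
    by (induction f rule: free_alg_induct)
      (simp_all add: distrib_left free_pair_plus mult_single free_pair_single)
  then show "form_pair q \<omega> (c *\<^sub>R a) = c *\<^sub>R form_pair q \<omega> a"
    by (simp add: fg scaleR_ext.abs_eq form_pair_abs[OF assms])
qed

lemma wedge_abs: "wedge xs = abs_ext (Poly_Mapping.single (Word xs) 1)"
proof (induction xs)
  case Nil
  show ?case by (simp add: wedge_def one_ext.abs_eq flip: zero_word_def)
next
  case (Cons x xs)
  then show ?case
    by (simp add: wedge_def ext_vec.abs_eq times_ext.abs_eq gen_def mult_single plus_word_def)
qed

lemma form_pair_wedge: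
  assumes "alternating_form q \<omega>"
  shows "form_pair q \<omega> (wedge xs) = (if length xs = q then \<omega> xs else 0)"
  by (simp add: wedge_abs form_pair_abs[OF assms] free_pair_single)

lemma wedge_append: "wedge (xs @ ys) = wedge xs * wedge ys"
  by (simp add: wedge_def)

lemma wedge_Cons: "wedge (x # xs) = ext_vec x * wedge xs"
  by (simp add: wedge_def)

lemma wedge_commute: "wedge ys * ext_vec x = (- 1) ^ length ys * (ext_vec x * wedge ys)"
proof (induction ys)
  case Nil
  show ?case by (simp add: wedge_def)
next
  case (Cons y ys)
  have "wedge (y # ys) * ext_vec x = ext_vec y * (wedge ys * ext_vec x)"
    by (simp add: wedge_Cons mult.assoc)
  also have "\<dots> = (- 1) ^ length ys * (ext_vec y * ext_vec x * wedge ys)"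
    unfolding Cons.IH by (cases "even (length ys)") (simp_all add: mult.assoc)
  also have "\<dots> = (- 1) ^ length (y # ys) * (ext_vec x * wedge (y # ys))"
    unfolding ext_vec_anticommute[of y x] by (simp add: wedge_Cons mult.assoc)
  finally show ?case .
qed

lemma wedge_repeated:
  assumes "i < j" "j < length xs" "xs ! i = xs ! j"
  shows "wedge xs = 0"
proof -
  define ys where "ys = take (j - Suc i) (drop (Suc i) xs)"
  have "drop (Suc i) xs = ys @ xs ! j # drop (Suc j) xs"
    using assms id_take_nth_drop[of "j - Suc i" "drop (Suc i) xs"] by (simp add: ys_def)
  then have xs: "xs = take i xs @ xs ! i # ys @ xs ! i # drop (Suc j) xs"
    using assms id_take_nth_drop[of i xs] by simp
  have "ext_vec (xs ! i) * (wedge ys * ext_vec (xs ! i)) = 0"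
    unfolding wedge_commute
    by (cases "even (length ys)") (simp_all add: mult.assoc[symmetric] ext_vec_square)
  then have "ext_vec (xs ! i) * (wedge ys * (ext_vec (xs ! i) * z)) = 0" for z
    by (metis mult.assoc mult_zero_left)
  then show ?thesis
    by (subst xs) (simp add: wedge_append wedge_Cons)
qed

lemma alternating_form_wedge:
  assumes "linear L"
  shows "alternating_form q (\<lambda>xs. L (wedge xs))"
  unfolding alternating_form_def
proof (intro conjI allI impI)
  fix xs :: "'a list" and i
  assume "length xs = q \<and> i < q"
  then have "wedge (xs[i := x]) = wedge (take i xs) * ext_vec x * wedge (drop (Suc i) xs)" for x
    by (simp add: upd_conv_take_nth_drop wedge_append wedge_Cons mult.assoc)
  then show "linear (\<lambda>x. L (wedge (xs[i := x])))"
    by (intro linearI)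
      (simp_all add: linear_add[OF ext_vec_linear] linear_scale[OF ext_vec_linear]
        linear_add[OF assms] linear_scale[OF assms] distrib_left distrib_right)
next
  fix xs :: "'a list" and i j
  assume "length xs = q \<and> i < j \<and> j < q \<and> xs ! i = xs ! j"
  then show "L (wedge xs) = 0"
    using wedge_repeated[of i j xs] linear_0[OF assms] by simp
qed

lemma form_pair_nondegenerate:
  fixes b :: "'a::real_vector ext"
  assumes "b \<in> ext_grade q" and "\<And>\<omega>. alternating_form q \<omega> \<Longrightarrow> form_pair q \<omega> b = 0"
  shows "b = 0"
proof (rule ccontr)
  assume "b \<noteq> 0"
  then have "independent {b}" by simp
  from linear_independent_extend[OF this, of "\<lambda>_. 1 :: real"]
  obtain L :: "'a ext \<Rightarrow> real" where L: "linear L" "L b = 1" by blast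
  define \<omega> where "\<omega> = (\<lambda>xs. L (wedge xs))"
  have alt: "alternating_form q \<omega>"
    unfolding \<omega>_def by (rule alternating_form_wedge[OF L(1)])
  have "form_pair q \<omega> b = L b"
    by (rule linear_eq_on[OF form_pair_linear[OF alt] L(1) assms(1)[unfolded ext_grade_def]])
      (use form_pair_wedge[OF alt] in \<open>auto simp: \<omega>_def\<close>)
  then show False using assms(2)[OF alt] L(2) by simp
qed

section \<open>Linear functionals on subspaces\<close>

instantiation "fun" :: (type, real_vector) real_vector
begin

definition scaleR_fun :: "real \<Rightarrow> ('a \<Rightarrow> 'b) \<Rightarrow> 'a \<Rightarrow> 'b"
  where "c *\<^sub>R f = (\<lambda>x. c *\<^sub>R f x)"

instance
  by standard (simp_all add: scaleR_fun_def fun_eq_iff scaleR_add_right scaleR_add_left)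

end

text \<open>
  The dual of a subspace \<open>W\<close>; a functional on \<open>W\<close> is extended by \<open>0\<close> outside \<open>W\<close> (this
  extension is in general not linear on the whole space), so that it is determined by its values
  on \<open>W\<close>.
\<close>

definition dual_space :: "'a::real_vector set \<Rightarrow> ('a \<Rightarrow> real) set"
  where "dual_space W =
    {w. (\<forall>x\<in>W. \<forall>y\<in>W. w (x + y) = w x + w y) \<and>
        (\<forall>c. \<forall>x\<in>W. w (c *\<^sub>R x) = c * w x) \<and>
        (\<forall>x. x \<notin> W \<longrightarrow> w x = 0)}"

definition dual_restrict :: "'a set \<Rightarrow> ('a \<Rightarrow> real) \<Rightarrow> 'a \<Rightarrow> real"
  where "dual_restrict W w = (\<lambda>x. if x \<in> W then w x else 0)"

section \<open>Polyhedral complexes and dual fans\<close>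

definition direction :: "'v::real_vector set \<Rightarrow> 'v set"
  where "direction C = span {x - y |x y. x \<in> C \<and> y \<in> C}"

definition cell_dim :: "'v::real_vector set \<Rightarrow> nat"
  where "cell_dim C = dim (direction C)"

text \<open>The library's \<^const>\<open>face_of\<close> admits the empty face, which is not a cell.\<close>

definition cell_face :: "'v::real_vector set \<Rightarrow> 'v set \<Rightarrow> bool"
  where "cell_face F C \<longleftrightarrow> F face_of C \<and> F \<noteq> {}"

definition P_complex :: "'a::euclidean_space set set \<Rightarrow> bool"
  where "P_complex X \<longleftrightarrow>
    finite X \<and>
    (\<forall>C\<in>X. polyhedron C \<and> C \<noteq> {}) \<and>
    (\<forall>C\<in>X. \<forall>F. cell_face F C \<longrightarrow> F \<in> X) \<and>
    (\<forall>C\<in>X. \<forall>D\<in>X. C \<inter> D \<noteq> {} \<longrightarrow> cell_face (C \<inter> D) C \<and> cell_face (C \<inter> D) D)"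

text \<open>
  Functionals on \<^term>\<open>direction \<gamma>\<close> are evaluated on the translates of \<open>\<gamma>\<close> by \<open>- z\<close> for
  \<open>z \<in> \<gamma>\<close>, which lie in that subspace.
\<close>

definition dual_cone :: "'a::real_vector set \<Rightarrow> 'a set \<Rightarrow> ('a \<Rightarrow> real) set"
  where "dual_cone \<gamma> \<delta> =
    {w \<in> dual_space (direction \<gamma>). \<forall>z\<in>\<gamma>. \<forall>x\<in>\<delta>. \<forall>y\<in>\<gamma>. w (y - z) \<le> w (x - z)}"

definition dual_fan :: "'a::real_vector set \<Rightarrow> ('a \<Rightarrow> real) set set"
  where "dual_fan \<gamma> = {dual_cone \<gamma> \<delta> |\<delta>. cell_face \<delta> \<gamma>}"

definition dual_skeleton :: "'a::real_vector set \<Rightarrow> nat \<Rightarrow> ('a \<Rightarrow> real) set set"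
  where "dual_skeleton \<gamma> j = {C \<in> dual_fan \<gamma>. cell_dim C \<le> j}"

definition codim_in :: "'v::real_vector set \<Rightarrow> 'v set \<Rightarrow> nat"
  where "codim_in E W = dim E - dim W"

definition transversal :: "'v::real_vector set \<Rightarrow> 'v set set \<Rightarrow> 'v set set \<Rightarrow> bool"
  where "transversal E A B \<longleftrightarrow>
    (\<forall>C\<in>A. \<forall>D\<in>B. C \<inter> D \<noteq> {} \<longrightarrow>
      codim_in E (direction C \<inter> direction D) =
      codim_in E (direction C) + codim_in E (direction D))"

definition convenient_pq :: "nat \<Rightarrow> nat \<Rightarrow> 'a::real_vector set set \<Rightarrow> ('a \<Rightarrow> real) set"
  where "convenient_pq p q X =
    {v \<in> dual_space UNIV. \<forall>\<gamma>\<in>X. cell_dim \<gamma> = p + q \<longrightarrow>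
      transversal (dual_space (direction \<gamma>))
        ((`) ((+) (dual_restrict (direction \<gamma>) v)) ` dual_skeleton \<gamma> q)
        (dual_skeleton \<gamma> p)}"

definition convenient :: "'a::real_vector set set \<Rightarrow> ('a \<Rightarrow> real) set"
  where "convenient X = (\<Inter>p q. convenient_pq p q X)"

section \<open>Orientations and cochains\<close>

definition basis_of :: "'a::real_vector set \<Rightarrow> 'a list \<Rightarrow> bool"
  where "basis_of W e \<longleftrightarrow> distinct e \<and> independent (set e) \<and> span (set e) = W"

text \<open>Leibniz formula; the library's \<^const>\<open>det\<close> has the size of the matrix in its type.\<close>

definition det_upto :: "nat \<Rightarrow> (nat \<Rightarrow> nat \<Rightarrow> real) \<Rightarrow> real"
  where "det_upto k M = (\<Sum>\<pi> | \<pi> permutes {..<k}. of_int (sign \<pi>) * (\<Prod>i<k. M i (\<pi> i)))"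

text \<open>
  An orientation gives every ordered basis a sign and changes it by the sign of the determinant of
  the base change. The zero space, with the empty list as its only basis, thus has two orientations,
  the positive one being \<open>1\<close> on the empty list. Lists that are not bases get \<open>0\<close>, so that an
  orientation is determined by its values on bases, and the opposite orientation is \<open>- \<sigma>\<close>.
\<close>

type_synonym 'a orientation = "'a list \<Rightarrow> real"

definition orientations :: "'a::real_vector set \<Rightarrow> 'a orientation set"
  where "orientations W =
    {\<sigma>. (\<forall>e. basis_of W e \<longrightarrow> \<sigma> e = 1 \<or> \<sigma> e = - 1) \<and>
        (\<forall>e. \<not> basis_of W e \<longrightarrow> \<sigma> e = 0) \<and>
        (\<forall>e f M. basis_of W e \<and> basis_of W f \<and>
          (\<forall>j<length e. f ! j = (\<Sum>i<length e. M i j *\<^sub>R e ! i)) \<longrightarrow>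
          \<sigma> f = sgn (det_upto (length e) M) * \<sigma> e)}"

text \<open>\<open>W = W\<^sub>1 \<oplus> W\<^sub>2\<close> as oriented spaces\<close>

definition oriented_direct_sum ::
    "'a::real_vector set \<Rightarrow> 'a orientation \<Rightarrow> 'a set \<Rightarrow> 'a orientation \<Rightarrow>
      'a set \<Rightarrow> 'a orientation \<Rightarrow> bool"
  where "oriented_direct_sum W \<sigma> W\<^sub>1 \<sigma>\<^sub>1 W\<^sub>2 \<sigma>\<^sub>2 \<longleftrightarrow>
    W = {x + y |x y. x \<in> W\<^sub>1 \<and> y \<in> W\<^sub>2} \<and> W\<^sub>1 \<inter> W\<^sub>2 = {0} \<and>
    (\<forall>e f. basis_of W\<^sub>1 e \<and> basis_of W\<^sub>2 f \<longrightarrow> \<sigma> (e @ f) = \<sigma>\<^sub>1 e * \<sigma>\<^sub>2 f)"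

definition oriented_cells :: "'a::real_vector set set \<Rightarrow> nat \<Rightarrow> ('a set \<times> 'a orientation) set"
  where "oriented_cells X p =
    {(\<delta>, \<sigma>). \<delta> \<in> X \<and> cell_dim \<delta> = p \<and> \<sigma> \<in> orientations (direction \<delta>)}"

definition cochains ::
    "'a::real_vector set set \<Rightarrow> nat \<Rightarrow> ('a set \<times> 'a orientation \<Rightarrow> 's::ring) set"
  where "cochains X p =
    {r. (\<forall>(\<delta>, \<sigma>)\<in>oriented_cells X p. r (\<delta>, - \<sigma>) = - r (\<delta>, \<sigma>)) \<and>
        (\<forall>c. c \<notin> oriented_cells X p \<longrightarrow> r c = 0)}"

section \<open>The product\<close>

definition cup_pairs ::
    "nat \<Rightarrow> nat \<Rightarrow> 'a::real_vector set \<Rightarrow> ('a \<Rightarrow> real) \<Rightarrow> ('a set \<times> 'a set) set"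
  where "cup_pairs p q \<gamma> v =
    {(\<delta>, \<kappa>). cell_face \<delta> \<gamma> \<and> cell_dim \<delta> = p \<and> cell_face \<kappa> \<gamma> \<and> cell_dim \<kappa> = q \<and>
      (+) (dual_restrict (direction \<gamma>) v) ` dual_cone \<gamma> \<delta> \<inter> dual_cone \<gamma> \<kappa> \<noteq> {}}"

text \<open>
  Each pair of faces is given orientations whose direct sum is the orientation of \<open>\<gamma>\<close>. The other
  admissible choice reverses both of them, which does not change the product of the values of two
  cochains.
\<close>

definition cup ::
    "'a::real_vector set set \<Rightarrow> ('a \<Rightarrow> real) \<Rightarrow> nat \<Rightarrow> nat \<Rightarrow>
      ('a set \<times> 'a orientation \<Rightarrow> 's::ring) \<Rightarrow> ('a set \<times> 'a orientation \<Rightarrow> 's) \<Rightarrow>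
      'a set \<times> 'a orientation \<Rightarrow> 's"
  where "cup X v p q r s = (\<lambda>(\<gamma>, \<sigma>).
    if (\<gamma>, \<sigma>) \<in> oriented_cells X (p + q) then
      \<Sum>(\<delta>, \<kappa>)\<in>cup_pairs p q \<gamma> v.
        let (\<sigma>\<^sub>1, \<sigma>\<^sub>2) = (SOME (\<sigma>\<^sub>1, \<sigma>\<^sub>2).
          \<sigma>\<^sub>1 \<in> orientations (direction \<delta>) \<and> \<sigma>\<^sub>2 \<in> orientations (direction \<kappa>) \<and>
          oriented_direct_sum (direction \<gamma>) \<sigma> (direction \<delta>) \<sigma>\<^sub>1 (direction \<kappa>) \<sigma>\<^sub>2)
        in r (\<delta>, \<sigma>\<^sub>1) * s (\<kappa>, \<sigma>\<^sub>2)
    else 0)"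

section \<open>The volume cochain\<close>

definition affine_chart :: "'a::real_vector \<Rightarrow> 'a list \<Rightarrow> (nat \<Rightarrow> real) \<Rightarrow> 'a"
  where "affine_chart a e t = a + (\<Sum>i<length e. t i *\<^sub>R e ! i)"

text \<open>
  The integral of the constant form \<open>\<omega>\<close> over a subset \<open>U\<close> of the affine subspace \<open>A\<close> with
  orientation \<open>\<sigma>\<close> is computed in an affine chart \<open>\<phi>\<close>: the pullback of \<open>\<omega>\<close> is
  \<open>\<omega>(e\<^sub>1, \<dots>, e\<^sub>q) dt\<^sub>1 \<and> \<dots> \<and> dt\<^sub>q\<close>, and \<open>\<sigma> e\<close> is the sign of the chart. By the change of variables
  formula the choice of the chart does not matter.
\<close>

definition form_integral ::
    "'a::real_vector set \<Rightarrow> 'a orientation \<Rightarrow> ('a list \<Rightarrow> real) \<Rightarrow> 'a set \<Rightarrow> real"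
  where "form_integral A \<sigma> \<omega> U =
    (let (a, e) = (SOME (a, e). a \<in> A \<and> basis_of (direction A) e);
         M = Pi\<^sub>M {..<length e} (\<lambda>_. lborel)
     in \<sigma> e * (LINT t:{t \<in> space M. affine_chart a e t \<in> U}|M. \<omega> e))"

definition multivector ::
    "nat \<Rightarrow> 'a::real_vector set \<Rightarrow> 'a orientation \<Rightarrow> 'a set \<Rightarrow> 'a ext"
  where "multivector q A \<sigma> U =
    (THE b. b \<in> ext_grade q \<and>
      (\<forall>\<omega>. alternating_form q \<omega> \<longrightarrow> form_pair q \<omega> b = form_integral A \<sigma> \<omega> U))"

definition vol :: "'a::real_vector set set \<Rightarrow> nat \<Rightarrow> 'a set \<times> 'a orientation \<Rightarrow> 'a ext"
  where "vol X q = (\<lambda>(\<delta>, \<sigma>).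
    if (\<delta>, \<sigma>) \<in> oriented_cells X q then fact q *\<^sub>R multivector q (affine hull \<delta>) \<sigma> \<delta> else 0)"

lemma multivector_eqI:
  assumes "b \<in> ext_grade q"
    and "\<And>\<omega>. alternating_form q \<omega> \<Longrightarrow> form_pair q \<omega> b = form_integral A \<sigma> \<omega> U"
  shows "multivector q A \<sigma> U = b"
  unfolding multivector_def
proof (rule the_equality)
  fix c
  assume c: "c \<in> ext_grade q \<and>
    (\<forall>\<omega>. alternating_form q \<omega> \<longrightarrow> form_pair q \<omega> c = form_integral A \<sigma> \<omega> U)"
  then have "c - b \<in> ext_grade q"
    using assms(1) unfolding ext_grade_def by (blast intro: span_diff)
  moreover have "form_pair q \<omega> (c - b) = 0" if "alternating_form q \<omega>" for \<omega>
    using that c assms(2) by (simp add: linear_diff[OF form_pair_linear])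
  ultimately have "c - b = 0" by (rule form_pair_nondegenerate)
  then show "c = b" by simp
qed (use assms in blast)

lemma basis_of_ex:
  fixes W :: "'a::euclidean_space set"
  assumes "subspace W"
  obtains e where "basis_of W e"
proof -
  obtain B where B: "B \<subseteq> W" "independent B" "W \<subseteq> span B"
    by (rule basis_exists)
  have "span B = W"
    using span_minimal[OF B(1) assms] B(3) by (rule equalityI)
  moreover obtain e where "set e = B" "distinct e"
    using finite_distinct_list[OF independent_imp_finite[OF B(2)]] by blast
  ultimately have "basis_of W e"
    using B(2) by (simp add: basis_of_def)
  then show thesis by (rule that)
qed

lemma basis_of_length:
  assumes "basis_of W e"
  shows "length e = dim W"
  using assms dim_span_eq_card_independent[of "set e"] distinct_card[of e]
  by (auto simp: basis_of_def)

lemma direction_affine_hull: "direction (affine hull S) = direction (S :: 'a::euclidean_space set)"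
proof
  have "direction S \<subseteq> direction (affine hull S)"
    unfolding direction_def using hull_subset[of S affine] by (intro span_mono) blast
  moreover have "x - y \<in> direction S" if "x \<in> affine hull S" "y \<in> affine hull S" for x y
  proof -
    have "S \<noteq> {}" using that(1) by auto
    then obtain a where "a \<in> S" by blast
    have "affine {z. z - a \<in> direction S}"
      unfolding affine_def
    proof (clarsimp)
      fix x y and u v :: real
      assume "x - a \<in> direction S" "y - a \<in> direction S" and uv: "u + v = 1"
      then have "u *\<^sub>R (x - a) + v *\<^sub>R (y - a) \<in> direction S"
        unfolding direction_def by (intro span_add span_scale)
      moreover have "u *\<^sub>R (x - a) + v *\<^sub>R (y - a) = u *\<^sub>R x + v *\<^sub>R y - (u + v) *\<^sub>R a"
        by (simp add: algebra_simps)
      ultimately show "u *\<^sub>R x + v *\<^sub>R y - a \<in> direction S" by (simp add: uv)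
    qed
    moreover have "S \<subseteq> {z. z - a \<in> direction S}"
      using \<open>a \<in> S\<close> unfolding direction_def by (auto intro: span_base)
    ultimately have "affine hull S \<subseteq> {z. z - a \<in> direction S}"
      by (rule hull_minimal[rotated])
    then have "(x - a) - (y - a) \<in> direction S"
      using that unfolding direction_def by (blast intro: span_diff)
    then show ?thesis by simp
  qed
  then have "direction (affine hull S) \<subseteq> direction S"
    unfolding direction_def[of "affine hull S"]
    by (intro span_minimal) (auto simp: direction_def)
  ultimately show "direction S \<subseteq> direction (affine hull S)"
    "direction (affine hull S) \<subseteq> direction S" by auto
qed


lemma vol_cochain:
  fixes X :: "'a::euclidean_space set set"
  assumes "P_complex X"
  shows "vol X q \<in> cochains X q"
proof -
  have "vol X q (\<delta>, - \<sigma>) = - vol X q (\<delta>, \<sigma>)" if \<sigma>: "(\<delta>, \<sigma>) \<in> oriented_cells X q" for \<delta> \<sigma>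
  proof -
    have neg: "(\<delta>, - \<sigma>) \<in> oriented_cells X q"
      using \<sigma> by (auto simp: oriented_cells_def orientations_def)
    define A where "A = affine hull \<delta>"
    have A: "direction A = direction \<delta>"
      unfolding A_def by (rule direction_affine_hull)
    have "\<delta> \<noteq> {}"
      using \<sigma> assms by (auto simp: oriented_cells_def P_complex_def)
    then obtain a0 where "a0 \<in> A" using hull_subset[of \<delta> affine] by (auto simp: A_def)
    moreover obtain f where "basis_of (direction A) f"
      using basis_of_ex[of "direction A"] by (auto simp: direction_def)
    moreover define P where "P = (\<lambda>(a, e). a \<in> A \<and> basis_of (direction A) e)"
    ultimately have "P (a0, f)" by simp
    then have "P (Eps P)" by (rule someI)
    moreover obtain a e where ae: "Eps P = (a, e)" by (cases "Eps P")
    ultimately have "basis_of (direction A) e" by (simp add: P_def)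
    then have len: "length e = q"
      using basis_of_length[of "direction A" e] \<sigma> by (simp add: A oriented_cells_def cell_dim_def)
    define M where "M = Pi\<^sub>M {..<length e} (\<lambda>_. lborel :: real measure)"
    define m :: real
      where "m = (LINT t|M. indicator {t \<in> space M. affine_chart a e t \<in> \<delta>} t)"
    have int: "form_integral A \<tau> \<omega> \<delta> = \<tau> e * m * \<omega> e" for \<tau> \<omega>
      by (simp add: form_integral_def ae[unfolded P_def] Let_def set_lebesgue_integral_def m_def flip: M_def)
    have "multivector q A \<tau> \<delta> = (\<tau> e * m) *\<^sub>R wedge e" for \<tau>
    proof (rule multivector_eqI)
      show "(\<tau> e * m) *\<^sub>R wedge e \<in> ext_grade q"
        unfolding ext_grade_def by (intro span_scale span_base) (use len in blast)
      show "form_pair q \<omega> ((\<tau> e * m) *\<^sub>R wedge e) = form_integral A \<tau> \<omega> \<delta>"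
        if "alternating_form q \<omega>" for \<omega>
        using that len by (simp add: int linear_scale[OF form_pair_linear] form_pair_wedge)
    qed
    then show ?thesis
      using \<sigma> neg by (simp add: vol_def flip: A_def)
  qed
  moreover have "vol X q c = 0" if "c \<notin> oriented_cells X q" for c
    using that by (cases c) (simp add: vol_def)
  ultimately show ?thesis
    unfolding cochains_def by blast
qed

end

theory Submission
  imports Defs
begin

text \<open>
  Let \<open>\<gamma>\<close> be a cell of dimension \<open>n = p + q\<close>, let \<open>v\<close> be represented by the inner product with a vector
  \<open>w\<close>, and let \<open>s > 0\<close>. The identity compares two computations of the volume of
  \<open>s \<gamma> + \<gamma> = (s + 1) \<gamma>\<close>. On the one hand it is \<open>(s + 1)\<^sup>n vol \<gamma>\<close>. On the other hand \<open>w\<close> cuts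
  \<open>s \<gamma> + \<gamma>\<close> into the cells \<open>s F + G\<close> of a coherent mixed subdivision. Here \<open>(F, G)\<close> runs over the
  pairs of faces for which some functional \<open>u\<close> is maximal on \<open>\<gamma>\<close> along \<open>F\<close> while \<open>u + w\<close> is
  maximal along \<open>G\<close>. That such a \<open>u\<close> exists says precisely that \<open>v + F\<^sup>*\<close> meets \<open>G\<^sup>*\<close>, so these are
  the pairs over which the product of cochains is formed. The cell \<open>s F + G\<close> has volume
  \<open>s\<^bsup>dim F\<^esup> vol (F + G)\<close>, and comparing the coefficients of \<open>s\<^sup>p\<close> yields
  \<open>(\<Sum> vol (F + G)) = (n choose p) vol \<gamma>\<close>, the sum being over the pairs with \<open>dim F = p\<close>
  (\<open>mixed_volume\<close>). Multiplied by \<open>p! q!\<close> this is the theorem, because \<open>\<beta>\<^sub>F \<and> \<beta>\<^sub>G\<close> is the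
  multivector of \<open>F + G\<close> once the orientations of \<open>F\<close> and \<open>G\<close> add up to that of \<open>\<gamma>\<close>.

  Two facts make the cells a subdivision. They cover \<open>s \<gamma> + \<gamma>\<close> by linear programming duality: if
  \<open>z = s a + b\<close> is the decomposition of \<open>z\<close> for which \<open>w\<close> is largest at \<open>b\<close>, then a supporting
  hyperplane at \<open>z\<close> supplies \<open>u\<close> (\<open>rel_interior_point_maximizers\<close>, \<open>minkowski_cell_cover\<close>). They
  overlap in null sets by genericity: a dual cone \<open>F\<^sup>*\<close> lies in the annihilator of the direction of
  \<open>F\<close>, so transversality of the dual fan and its translate forces \<open>dim F + dim G \<le> n\<close> for all the
  pairs (\<open>convenient_imp_generic\<close>), hence a pair with \<open>dim F + dim G = n\<close> consists of the whole
  faces of maxima of its \<open>u\<close> and \<open>u + w\<close>, and a common point of two cells has the same summands in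
  both (\<open>full_pairs_overlap\<close>).

  Volumes, multivectors and orientations all refer to a basis of the direction of the cell at hand.
  They are compared along chains of elementary changes of basis, which rescale one vector or add a
  multiple of one vector to another. Such a step multiplies the wedge product of the basis by
  \<open>d\<close>, the orientation sign by \<open>sgn d\<close>, and divides coordinate volumes by \<open>\<bar>d\<bar>\<close>. Hence the product
  of the three is a multivector that does not depend on the basis.
\<close>

section \<open>Volumes in affine charts\<close>

definition chart_set :: "'a::real_vector \<Rightarrow> 'a list \<Rightarrow> 'a set \<Rightarrow> (nat \<Rightarrow> real) set"
  where "chart_set a e U = {t \<in> space (Pi\<^sub>M {..<length e} (\<lambda>_. lborel)). affine_chart a e t \<in> U}"

definition chart_volume :: "'a::real_vector \<Rightarrow> 'a list \<Rightarrow> 'a set \<Rightarrow> ennreal"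
  where "chart_volume a e U = emeasure (Pi\<^sub>M {..<length e} (\<lambda>_. lborel)) (chart_set a e U)"

interpretation lborel_prod: product_sigma_finite "\<lambda>_::nat. lborel :: real measure"
  by standard

lemma affine_chart_measurable [measurable]:
  fixes a :: "'a::euclidean_space"
  shows "affine_chart a e \<in> borel_measurable (Pi\<^sub>M {..<length e} (\<lambda>_. lborel))"
  unfolding affine_chart_def by measurable

lemma chart_set_sets [measurable]:
  fixes a :: "'a::euclidean_space"
  assumes "U \<in> sets borel"
  shows "chart_set a e U \<in> sets (Pi\<^sub>M {..<length e} (\<lambda>_. lborel))"
  using measurable_sets[OF affine_chart_measurable assms]
  by (simp add: chart_set_def vimage_def Int_def conj_commute)

text \<open>
  By Fubini the \<open>i\<close>-th coordinate may be integrated first; with the other coordinates held fixed, the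
  substitution is an affine map of the real line. The effect of
  scaling, shearing and translating a chart on volumes is in each case an instance of this.
\<close>

lemma nn_integral_coordinate_change:
  fixes f :: "(nat \<Rightarrow> real) \<Rightarrow> ennreal"
  assumes I: "finite I" "i \<in> I" and c: "c \<noteq> 0"
    and f [measurable]: "f \<in> borel_measurable (Pi\<^sub>M I (\<lambda>_. lborel))"
    and g [measurable]: "g \<in> borel_measurable (Pi\<^sub>M I (\<lambda>_. lborel))"
    and g_indep: "\<And>t y. g (t(i := y)) = g t"
  shows "(\<integral>\<^sup>+t. f t \<partial>Pi\<^sub>M I (\<lambda>_. lborel)) =
    ennreal \<bar>c\<bar> * (\<integral>\<^sup>+t. f (t(i := g t + c * t i)) \<partial>Pi\<^sub>M I (\<lambda>_. lborel))"
proof -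
  define J where "J = I - {i}"
  have IJ: "I = insert i J" "finite J" "i \<notin> J"
    using I by (auto simp: J_def)
  note f' = f[unfolded IJ(1)] and g' = g[unfolded IJ(1)]
  have upd [measurable]: "(\<lambda>t. t(i := g t + c * t i)) \<in>
      Pi\<^sub>M I (\<lambda>_. lborel) \<rightarrow>\<^sub>M Pi\<^sub>M I (\<lambda>_. lborel)"
    by (rule measurable_fun_upd[where J = I]) (use I in auto)
  have m: "(\<lambda>t. f (t(i := g t + c * t i))) \<in> borel_measurable (Pi\<^sub>M (insert i J) (\<lambda>_. lborel))"
    unfolding IJ(1)[symmetric] by measurable
  have "(\<integral>\<^sup>+t. f t \<partial>Pi\<^sub>M I (\<lambda>_. lborel)) =
      (\<integral>\<^sup>+x. \<integral>\<^sup>+y. f (x(i := y)) \<partial>lborel \<partial>Pi\<^sub>M J (\<lambda>_. lborel))"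
    unfolding IJ(1) by (rule lborel_prod.product_nn_integral_insert[OF IJ(2,3) f'])
  also have "\<dots> = (\<integral>\<^sup>+x. ennreal \<bar>c\<bar> *
      (\<integral>\<^sup>+y. f (x(i := g x + c * y)) \<partial>lborel) \<partial>Pi\<^sub>M J (\<lambda>_. lborel))"
  proof (rule nn_integral_cong)
    fix x assume "x \<in> space (Pi\<^sub>M J (\<lambda>_. lborel :: real measure))"
    then have "(\<lambda>y. x(i := y)) \<in> lborel \<rightarrow>\<^sub>M Pi\<^sub>M (insert i J) (\<lambda>_. lborel)"
      by (intro measurable_fun_upd[where J = J]) auto
    then have "(\<lambda>y. f (x(i := y))) \<in> borel_measurable lborel"
      using f' by (rule measurable_compose)
    then show "(\<integral>\<^sup>+y. f (x(i := y)) \<partial>lborel) =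
        ennreal \<bar>c\<bar> * (\<integral>\<^sup>+y. f (x(i := g x + c * y)) \<partial>lborel)"
      using nn_integral_real_affine[of "\<lambda>y. f (x(i := y))" c "g x"] c by simp
  qed
  also have "\<dots> = ennreal \<bar>c\<bar> *
      (\<integral>\<^sup>+x. \<integral>\<^sup>+y. f (x(i := g x + c * y)) \<partial>lborel \<partial>Pi\<^sub>M J (\<lambda>_. lborel))"
  proof (rule nn_integral_cmult)
    have "(\<lambda>(x, y). f (((x(i := y))(i := g (x(i := y)) + c * (x(i := y)) i)))) \<in>
        borel_measurable (Pi\<^sub>M J (\<lambda>_. lborel) \<Otimes>\<^sub>M lborel)"
      using measurable_compose[OF measurable_add_dim[of i J "\<lambda>_. lborel"] m]
      by (simp add: case_prod_unfold)
    then have "(\<lambda>(x, y). f (x(i := g x + c * y))) \<in> borel_measurable (Pi\<^sub>M J (\<lambda>_. lborel) \<Otimes>\<^sub>M lborel)"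
      by (simp add: g_indep)
    then show "(\<lambda>x. \<integral>\<^sup>+y. f (x(i := g x + c * y)) \<partial>lborel) \<in> borel_measurable (Pi\<^sub>M J (\<lambda>_. lborel))"
      by (rule lborel.borel_measurable_nn_integral)
  qed
  also have "(\<integral>\<^sup>+x. \<integral>\<^sup>+y. f (x(i := g x + c * y)) \<partial>lborel \<partial>Pi\<^sub>M J (\<lambda>_. lborel)) =
      (\<integral>\<^sup>+t. f (t(i := g t + c * t i)) \<partial>Pi\<^sub>M I (\<lambda>_. lborel))"
    unfolding IJ(1) lborel_prod.product_nn_integral_insert[OF IJ(2,3) m] by (simp add: g_indep)
  finally show ?thesis .
qed

lemma chart_volume_coordinate_change:
  fixes a b :: "'a::euclidean_space"
  assumes U: "U \<in> sets borel" and i: "i < length e" and c: "c \<noteq> 0" and len: "length f = length e"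
    and g: "g \<in> borel_measurable (Pi\<^sub>M {..<length e} (\<lambda>_. lborel))"
    and g_indep: "\<And>t y. g (t(i := y)) = g t"
    and chart: "\<And>t. affine_chart b f t = affine_chart a e (t(i := g t + c * t i))"
  shows "chart_volume a e U = ennreal \<bar>c\<bar> * chart_volume b f U"
proof -
  let ?M = "Pi\<^sub>M {..<length e} (\<lambda>_. lborel :: real measure)"
  have "chart_volume a e U = (\<integral>\<^sup>+t. indicator (chart_set a e U) t \<partial>?M)"
    using chart_set_sets[OF U] by (simp add: chart_volume_def)
  also have "\<dots> = ennreal \<bar>c\<bar> * (\<integral>\<^sup>+t. indicator (chart_set a e U) (t(i := g t + c * t i)) \<partial>?M)"
    by (rule nn_integral_coordinate_change[OF _ _ c _ g g_indep])
      (use i chart_set_sets[OF U] in auto)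
  also have "(\<integral>\<^sup>+t. indicator (chart_set a e U) (t(i := g t + c * t i)) \<partial>?M) =
      (\<integral>\<^sup>+t. indicator (chart_set b f U) t \<partial>?M)"
    by (rule nn_integral_cong)
      (use i len in \<open>auto simp: chart_set_def chart space_PiM PiE_iff extensional_def split: split_indicator\<close>)
  also have "\<dots> = chart_volume b f U"
    using chart_set_sets[OF U, of b f] len by (simp add: chart_volume_def)
  finally show ?thesis .
qed

lemma affine_chart_update:
  assumes "i < length e"
  shows "affine_chart a e (t(i := y)) = affine_chart a e t + (y - t i) *\<^sub>R e ! i"
proof -
  have *: "affine_chart a e s = a + (s i *\<^sub>R e ! i + (\<Sum>k\<in>{..<length e} - {i}. s k *\<^sub>R e ! k))" for s
    using assms by (simp add: affine_chart_def sum.remove)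
  show ?thesis unfolding * by (simp add: algebra_simps)
qed

lemma affine_chart_update_basis:
  assumes "i < length e"
  shows "affine_chart a (e[i := x]) t = affine_chart a e t + t i *\<^sub>R (x - e ! i)"
proof -
  have *: "affine_chart a e' t = a + (t i *\<^sub>R e' ! i + (\<Sum>k\<in>{..<length e} - {i}. t k *\<^sub>R e' ! k))"
    if "length e' = length e" for e'
    using assms that by (simp add: affine_chart_def sum.remove)
  show ?thesis using assms by (simp add: * algebra_simps)
qed

lemma chart_volume_scale:
  fixes a :: "'a::euclidean_space"
  assumes "U \<in> sets borel" "i < length e" "c \<noteq> 0"
  shows "chart_volume a e U = ennreal \<bar>c\<bar> * chart_volume a (e[i := c *\<^sub>R e ! i]) U"
  by (rule chart_volume_coordinate_change[where g = "\<lambda>_. 0" and i = i])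
    (use assms in \<open>auto simp: affine_chart_update affine_chart_update_basis algebra_simps\<close>)

lemma chart_volume_shear:
  fixes a :: "'a::euclidean_space"
  assumes "U \<in> sets borel" "i < length e" "j < length e" "i \<noteq> j"
  shows "chart_volume a e U = chart_volume a (e[i := e ! i + c *\<^sub>R e ! j]) U"
proof -
  have "chart_volume a e U = ennreal \<bar>1\<bar> * chart_volume a (e[i := e ! i + c *\<^sub>R e ! j]) U"
    by (rule chart_volume_coordinate_change[where g = "\<lambda>t. c * t i" and i = j])
      (use assms in \<open>auto simp: affine_chart_update affine_chart_update_basis\<close>)
  then show ?thesis by simp
qed

lemma chart_volume_translate:
  fixes a :: "'a::euclidean_space"
  assumes "U \<in> sets borel" "x \<in> span (set e)"
  shows "chart_volume (a + x) e U = chart_volume a e U"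
  using assms(2)
proof (induction arbitrary: a rule: span_induct_alt)
  case (step c x y)
  then obtain i where i: "i < length e" "x = e ! i" by (auto simp: in_set_conv_nth)
  have shift: "affine_chart (b + z) e t = affine_chart b e t + z" for b z t
    by (simp add: affine_chart_def)
  have "chart_volume (a + y) e U = ennreal \<bar>1\<bar> * chart_volume (a + (c *\<^sub>R x + y)) e U"
    by (rule chart_volume_coordinate_change[where g = "\<lambda>_. c" and i = i])
      (use assms i in \<open>auto simp: affine_chart_update shift algebra_simps\<close>)
  then show ?case using step by simp
qed simp

lemma concatenate_measurable:
  fixes p q :: nat
  shows "(\<lambda>(s, t). \<lambda>i\<in>{..<p + q}. if i < p then s i else t (i - p)) \<in>
    Pi\<^sub>M {..<p} (\<lambda>_. lborel) \<Otimes>\<^sub>M Pi\<^sub>M {..<q} (\<lambda>_. lborel) \<rightarrow>\<^sub>M Pi\<^sub>M {..<p + q} (\<lambda>_. lborel :: real measure)"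
    (is "_ \<in> ?PQ \<rightarrow>\<^sub>M _")
proof -
  have "(\<lambda>x. if i < p then fst x i else snd x (i - p)) \<in> borel_measurable ?PQ" if "i < p + q" for i
  proof (cases "i < p")
    case True
    then have "(\<lambda>x. fst x i) \<in> borel_measurable ?PQ"
      by (intro measurable_compose[OF measurable_fst])
        (auto intro!: measurable_component_singleton[where M = "\<lambda>_. lborel", simplified])
    then show ?thesis using True by simp
  next
    case False
    then have "(\<lambda>x. snd x (i - p)) \<in> borel_measurable ?PQ"
      using that by (intro measurable_compose[OF measurable_snd])
        (auto intro!: measurable_component_singleton[where M = "\<lambda>_. lborel", simplified])
    then show ?thesis using False by simp
  qed
  then show ?thesis
    unfolding case_prod_unfold by (intro measurable_restrict) simp
qed

text \<open>
  Both measures give a box the product of the lengths of its sides, and boxes determine a product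
  measure. The volume of a direct sum is computed by this splitting of the coordinates.
\<close>

lemma PiM_append:
  fixes p q :: nat
  shows "Pi\<^sub>M {..<p + q} (\<lambda>_. lborel :: real measure) =
    distr (Pi\<^sub>M {..<p} (\<lambda>_. lborel) \<Otimes>\<^sub>M Pi\<^sub>M {..<q} (\<lambda>_. lborel)) (Pi\<^sub>M {..<p + q} (\<lambda>_. lborel))
      (\<lambda>(s, t). \<lambda>i\<in>{..<p + q}. if i < p then s i else t (i - p))"
    (is "_ = distr (?P \<Otimes>\<^sub>M ?Q) ?R ?h")
proof (rule lborel_prod.PiM_eqI[symmetric])
  interpret Q: finite_product_sigma_finite "\<lambda>_::nat. lborel :: real measure" "{..<q}" by standard simp
  fix A :: "nat \<Rightarrow> real set"
  assume A: "\<And>i. i \<in> {..<p + q} \<Longrightarrow> A i \<in> sets lborel"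
  have h [measurable]: "?h \<in> ?P \<Otimes>\<^sub>M ?Q \<rightarrow>\<^sub>M ?R"
    by (rule concatenate_measurable)
  have "?h -` Pi\<^sub>E {..<p + q} A \<inter> space (?P \<Otimes>\<^sub>M ?Q) =
      Pi\<^sub>E {..<p} A \<times> Pi\<^sub>E {..<q} (\<lambda>i. A (p + i))" (is "?L = ?Rect")
  proof (intro set_eqI iffI)
    fix x assume x: "x \<in> ?L"
    obtain s t where st: "x = (s, t)" by (cases x)
    have *: "(if i < p then s i else t (i - p)) \<in> A i" if "i < p + q" for i
      using x that by (auto simp: st PiE_iff)
    have "s i \<in> A i" if "i < p" for i using *[of i] that by simp
    moreover have "t i \<in> A (p + i)" if "i < q" for i using *[of "p + i"] that by simp
    ultimately show "x \<in> ?Rect"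
      using x by (auto simp: st space_pair_measure space_PiM PiE_iff)
  next
    fix x assume x: "x \<in> ?Rect"
    obtain s t where st: "x = (s, t)" by (cases x)
    have "(if i < p then s i else t (i - p)) \<in> A i" if "i < p + q" for i
    proof (cases "i < p")
      case False
      have "\<forall>k\<in>{..<q}. t k \<in> A (p + k)" using x by (simp add: st PiE_iff)
      then have "t (i - p) \<in> A (p + (i - p))" by (rule bspec) (use False that in auto)
      then show ?thesis using False by simp
    qed (use x in \<open>auto simp: st PiE_iff\<close>)
    then show "x \<in> ?L"
      using x by (auto simp: st space_pair_measure space_PiM PiE_iff)
  qed
  moreover have "Pi\<^sub>E {..<p + q} A \<in> sets ?R"
    using A by (intro sets_PiM_I_finite) auto
  ultimately have "emeasure (distr (?P \<Otimes>\<^sub>M ?Q) ?R ?h) (Pi\<^sub>E {..<p + q} A) =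
      emeasure (?P \<Otimes>\<^sub>M ?Q) (Pi\<^sub>E {..<p} A \<times> Pi\<^sub>E {..<q} (\<lambda>i. A (p + i)))"
    by (simp add: emeasure_distr)
  also have "\<dots> = emeasure ?P (Pi\<^sub>E {..<p} A) * emeasure ?Q (Pi\<^sub>E {..<q} (\<lambda>i. A (p + i)))"
    using A by (intro Q.emeasure_pair_measure_Times sets_PiM_I_finite) auto
  also have "\<dots> = (\<Prod>i<p. emeasure lborel (A i)) * (\<Prod>i<q. emeasure lborel (A (p + i)))"
    using A by (subst (1 2) lborel_prod.emeasure_PiM) auto
  also have "\<dots> = (\<Prod>i<p + q. emeasure lborel (A i))"
    by (induction q) (simp_all add: mult.assoc[symmetric])
  finally show "emeasure (distr (?P \<Otimes>\<^sub>M ?Q) ?R ?h) (Pi\<^sub>E {..<p + q} A) =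
      (\<Prod>i\<in>{..<p + q}. emeasure lborel (A i))" .
qed simp_all

text \<open>
  Since the sum is direct, a point of the Minkowski sum determines its summands. The coordinates of
  the sum therefore range over the product of the coordinates of \<open>F\<close> and of \<open>G\<close>.
\<close>

lemma chart_volume_sum:
  fixes a b :: "'a::euclidean_space"
  assumes F: "F \<in> sets borel" "\<And>x. x \<in> F \<Longrightarrow> x - a \<in> span (set e)"
    and G: "G \<in> sets borel" "\<And>y. y \<in> G \<Longrightarrow> y - b \<in> span (set f)"
    and FG: "{x + y |x y. x \<in> F \<and> y \<in> G} \<in> sets borel"
    and direct: "span (set e) \<inter> span (set f) = {0}"
  shows "chart_volume (a + b) (e @ f) {x + y |x y. x \<in> F \<and> y \<in> G} =
    chart_volume a e F * chart_volume b f G"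
proof -
  let ?P = "Pi\<^sub>M {..<length e} (\<lambda>_. lborel :: real measure)"
  let ?Q = "Pi\<^sub>M {..<length f} (\<lambda>_. lborel :: real measure)"
  let ?R = "Pi\<^sub>M {..<length e + length f} (\<lambda>_. lborel :: real measure)"
  let ?h = "\<lambda>(s, t). \<lambda>i\<in>{..<length e + length f}. if i < length e then s i else t (i - length e)"
  define S where "S = {x + y |x y. x \<in> F \<and> y \<in> G}"
  interpret Q: sigma_finite_measure ?Q
    by (rule lborel_prod.sigma_finite) simp
  have chart_span: "affine_chart c g u - c \<in> span (set g)" for c :: 'a and g u
    unfolding affine_chart_def add_diff_cancel_left' by (intro span_sum span_scale span_base nth_mem) simp
  have sum_split: "(\<Sum>i<m + n. k i) = (\<Sum>i<m. k i) + (\<Sum>i<n. k (m + i))" for k :: "nat \<Rightarrow> 'a" and m n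
    by (induction n) (simp_all add: add.assoc)
  have chart: "affine_chart (a + b) (e @ f) (?h (s, t)) = affine_chart a e s + affine_chart b f t" for s t
  proof -
    have "(\<Sum>i<length e + length f. ?h (s, t) i *\<^sub>R (e @ f) ! i) =
        (\<Sum>i<length e. s i *\<^sub>R e ! i) + (\<Sum>i<length f. t i *\<^sub>R f ! i)"
      unfolding sum_split by (intro arg_cong2[where f = "(+)"] sum.cong) (auto simp: nth_append)
    then show ?thesis by (simp add: affine_chart_def)
  qed
  have mem: "affine_chart a e s + affine_chart b f t \<in> S \<longleftrightarrow>
      affine_chart a e s \<in> F \<and> affine_chart b f t \<in> G" for s t
  proof
    assume "affine_chart a e s + affine_chart b f t \<in> S"
    then obtain x y where xy: "x \<in> F" "y \<in> G" "affine_chart a e s + affine_chart b f t = x + y"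
      unfolding S_def by blast
    define d where "d = affine_chart a e s - x"
    have "d = (affine_chart a e s - a) - (x - a)" by (simp add: d_def)
    then have "d \<in> span (set e)" using chart_span F(2)[OF xy(1)] by (metis span_diff)
    moreover have "d = (y - b) - (affine_chart b f t - b)"
      using xy(3) by (simp add: d_def algebra_simps)
    then have "d \<in> span (set f)" using chart_span G(2)[OF xy(2)] by (metis span_diff)
    ultimately have "d = 0" using direct by blast
    then show "affine_chart a e s \<in> F \<and> affine_chart b f t \<in> G"
      using xy by (simp add: d_def)
  qed (auto simp: S_def)
  have "?h -` chart_set (a + b) (e @ f) S \<inter> space (?P \<Otimes>\<^sub>M ?Q) = chart_set a e F \<times> chart_set b f G"
  proof -
    have iff: "?h (s, t) \<in> chart_set (a + b) (e @ f) S \<longleftrightarrow>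
        affine_chart a e s \<in> F \<and> affine_chart b f t \<in> G" for s t
      unfolding chart_set_def mem_Collect_eq length_append chart mem by (simp add: space_PiM)
    show ?thesis
    proof (rule set_eqI)
      fix x :: "(nat \<Rightarrow> real) \<times> (nat \<Rightarrow> real)"
      obtain s t where x: "x = (s, t)" by (cases x)
      show "x \<in> ?h -` chart_set (a + b) (e @ f) S \<inter> space (?P \<Otimes>\<^sub>M ?Q) \<longleftrightarrow>
          x \<in> chart_set a e F \<times> chart_set b f G"
        unfolding x vimage_eq Int_iff iff space_pair_measure mem_Times_iff
        by (auto simp: chart_set_def)
    qed
  qed
  moreover have "?h \<in> ?P \<Otimes>\<^sub>M ?Q \<rightarrow>\<^sub>M ?R"
    by (rule concatenate_measurable)
  ultimately have "chart_volume (a + b) (e @ f) S = emeasure (?P \<Otimes>\<^sub>M ?Q) (chart_set a e F \<times> chart_set b f G)"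
    using chart_set_sets[OF FG[folded S_def], of "a + b" "e @ f"]
    by (simp add: chart_volume_def, subst PiM_append, simp add: emeasure_distr)
  also have "\<dots> = chart_volume a e F * chart_volume b f G"
    unfolding chart_volume_def using F(1) G(1)
    by (intro Q.emeasure_pair_measure_Times chart_set_sets)
  finally show ?thesis unfolding S_def .
qed

lemma chart_volume_dilate:
  fixes a :: "'a::euclidean_space"
  assumes "s \<noteq> 0"
  shows "chart_volume (s *\<^sub>R a) (map ((*\<^sub>R) s) e) ((*\<^sub>R) s ` U) = chart_volume a e U"
proof -
  have "affine_chart (s *\<^sub>R a) (map ((*\<^sub>R) s) e) t = s *\<^sub>R affine_chart a e t" for t
    by (simp add: affine_chart_def scaleR_right_distrib scaleR_sum_right mult.commute)
  moreover have "s *\<^sub>R x \<in> (*\<^sub>R) s ` U \<longleftrightarrow> x \<in> U" for x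
    using assms by auto
  ultimately show ?thesis
    by (simp add: chart_volume_def chart_set_def)
qed

text \<open>
  A line parallel to \<open>e ! i\<close> meets the hyperplane in one point, so that already the integral over the
  \<open>i\<close>-th coordinate vanishes.
\<close>

lemma chart_volume_hyperplane:
  fixes a :: "'a::euclidean_space"
  assumes i: "i < length e" and c: "c \<bullet> e ! i \<noteq> 0"
  shows "chart_volume a e {x. c \<bullet> x = d} = 0"
proof -
  define J where "J = {..<length e} - {i}"
  have J: "{..<length e} = insert i J" "finite J" "i \<notin> J"
    using i by (auto simp: J_def)
  let ?H = "{x. c \<bullet> x = d}"
  have H: "chart_set a e ?H \<in> sets (Pi\<^sub>M {..<length e} (\<lambda>_. lborel))"
    by (intro chart_set_sets borel_closed closed_hyperplane)
  have "chart_volume a e ?H = (\<integral>\<^sup>+t. indicator (chart_set a e ?H) t \<partial>Pi\<^sub>M (insert i J) (\<lambda>_. lborel))"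
    using H unfolding chart_volume_def J(1) by simp
  also have "\<dots> = (\<integral>\<^sup>+x. \<integral>\<^sup>+y. indicator (chart_set a e ?H) (x(i := y)) \<partial>lborel \<partial>Pi\<^sub>M J (\<lambda>_. lborel))"
    by (rule lborel_prod.product_nn_integral_insert[OF J(2,3)])
      (use H in \<open>simp add: J(1)\<close>)
  also have "\<dots> = 0"
  proof -
    have "(\<integral>\<^sup>+y. indicator (chart_set a e ?H) (x(i := y)) \<partial>lborel) = (0 :: ennreal)" for x
    proof -
      define y0 where "y0 = x i + (d - c \<bullet> affine_chart a e x) / (c \<bullet> e ! i)"
      have "y = y0" if "x(i := y) \<in> chart_set a e ?H" for y
        using that c
        by (simp add: chart_set_def affine_chart_update[OF i] y0_def field_simps inner_right_distrib
            inner_diff_right)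
      then have "indicator (chart_set a e ?H) (x(i := y)) \<le> (indicator {y0} y :: ennreal)" for y
        unfolding indicator_def by (cases "x(i := y) \<in> chart_set a e ?H") force+
      then have "(\<integral>\<^sup>+y. indicator (chart_set a e ?H) (x(i := y)) \<partial>lborel) \<le>
          (\<integral>\<^sup>+y. indicator {y0} y \<partial>lborel)"
        by (rule nn_integral_mono)
      also have "\<dots> = 0" by simp
      finally show ?thesis by simp
    qed
    then show ?thesis by simp
  qed
  finally show ?thesis .
qed

text \<open>
  The coordinate functionals of the basis extend to the whole space, where they are continuous. A
  bounded set therefore has bounded coordinates.
\<close>

lemma chart_volume_finite:
  fixes a :: "'a::euclidean_space"
  assumes e: "distinct e" "independent (set e)" and U: "bounded U"
  shows "chart_volume a e U < \<infinity>"
proof -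
  obtain B where B: "\<And>x. x \<in> U \<Longrightarrow> norm x \<le> B"
    using U by (auto simp: bounded_iff)
  have "\<exists>R. \<forall>t\<in>chart_set a e U. \<bar>t i\<bar> \<le> R" if i: "i < length e" for i
  proof -
    obtain g :: "'a \<Rightarrow> real" where g: "linear g" "\<And>x. x \<in> set e \<Longrightarrow> g x = (if x = e ! i then 1 else 0)"
      using linear_independent_extend[OF e(2), of "\<lambda>x. if x = e ! i then 1 else 0"] by blast
    have coord: "g (affine_chart a e t - a) = t i" for t
    proof -
      have "g (affine_chart a e t - a) = (\<Sum>k<length e. t k *\<^sub>R g (e ! k))"
        by (simp add: affine_chart_def linear_sum[OF g(1)] linear_scale[OF g(1)])
      also have "\<dots> = (\<Sum>k<length e. if k = i then t k else 0)"
        by (intro sum.cong) (use e(1) i in \<open>auto simp: g(2) nth_eq_iff_index_eq\<close>)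
      finally show ?thesis using i by simp
    qed
    obtain K where K: "\<And>x. norm (g x) \<le> norm x * K" "K \<ge> 0"
      using bounded_linear.nonneg_bounded[of g] g(1) linear_conv_bounded_linear by blast
    have "\<bar>t i\<bar> \<le> (B + norm a) * K" if "t \<in> chart_set a e U" for t
    proof -
      have "norm (affine_chart a e t - a) \<le> B + norm a"
        using B[of "affine_chart a e t"] that norm_triangle_ineq4[of "affine_chart a e t" a]
        by (simp add: chart_set_def)
      then have "norm (affine_chart a e t - a) * K \<le> (B + norm a) * K"
        using K(2) by (rule mult_right_mono)
      then show ?thesis using K(1)[of "affine_chart a e t - a"] by (simp add: coord)
    qed
    then show ?thesis by blast
  qed
  then obtain R where R: "\<And>i t. i < length e \<Longrightarrow> t \<in> chart_set a e U \<Longrightarrow> \<bar>t i\<bar> \<le> R i"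
    by metis
  have "chart_set a e U \<subseteq> Pi\<^sub>E {..<length e} (\<lambda>i. {- R i..R i})"
  proof
    fix t assume t: "t \<in> chart_set a e U"
    then have "t \<in> extensional {..<length e}" by (simp add: chart_set_def space_PiM PiE_iff)
    then show "t \<in> Pi\<^sub>E {..<length e} (\<lambda>i. {- R i..R i})"
      using R[OF _ t] by (auto simp: PiE_iff abs_le_iff) (smt (verit) R t)
  qed
  then have "chart_volume a e U \<le> emeasure (Pi\<^sub>M {..<length e} (\<lambda>_. lborel)) (Pi\<^sub>E {..<length e} (\<lambda>i. {- R i..R i}))"
    unfolding chart_volume_def by (intro emeasure_mono sets_PiM_I_finite) auto
  also have "\<dots> = (\<Prod>i<length e. emeasure lborel {- R i..R i})"
    by (intro lborel_prod.emeasure_PiM) auto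
  also have "\<dots> < \<infinity>"
    unfolding emeasure_lborel_Icc_eq by (subst prod_ennreal) auto
  finally show ?thesis .
qed

section \<open>Change of basis in elementary steps\<close>

text \<open>
  For a basis \<open>e\<close>, the number \<open>d\<close> is the determinant of the base change from \<open>e\<close> to \<open>f\<close>. To
  follow it along elementary steps spares the multiplicativity of determinants and the general
  change of variables formula: for one step the effect on wedge products, orientations and volumes
  is evident.
\<close>

inductive basis_change :: "'a::real_vector list \<Rightarrow> 'a list \<Rightarrow> real \<Rightarrow> bool" for e
  where
    basis_id: "basis_change e e 1"
  | basis_scale: "basis_change e f d \<Longrightarrow> i < length f \<Longrightarrow> c \<noteq> 0 \<Longrightarrow>
      basis_change e (f[i := c *\<^sub>R f ! i]) (c * d)"
  | basis_shear: "basis_change e f d \<Longrightarrow> i < length f \<Longrightarrow> j < length f \<Longrightarrow> i \<noteq> j \<Longrightarrow>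
      basis_change e (f[i := f ! i + c *\<^sub>R f ! j]) d"

lemma basis_change_length: "basis_change e f d \<Longrightarrow> length f = length e"
  by (induction rule: basis_change.induct) auto

lemma chart_volume_basis_change:
  fixes a :: "'a::euclidean_space"
  assumes "basis_change e f d" "U \<in> sets borel"
  shows "chart_volume a e U = ennreal \<bar>d\<bar> * chart_volume a f U"
  using assms
proof (induction rule: basis_change.induct)
  case scale: (basis_scale f d i c)
  have "chart_volume a e U = ennreal \<bar>d\<bar> * (ennreal \<bar>c\<bar> * chart_volume a (f[i := c *\<^sub>R f ! i]) U)"
    using scale chart_volume_scale[of U i f c a] by simp
  also have "\<dots> = ennreal \<bar>c * d\<bar> * chart_volume a (f[i := c *\<^sub>R f ! i]) U"
    by (simp add: abs_mult ennreal_mult mult.assoc[symmetric] mult.commute)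
  finally show ?case .
next
  case shear: (basis_shear f d i j c)
  then show ?case using chart_volume_shear[of U i f j a c] by simp
qed simp

lemma span_update_subset:
  assumes "x \<in> span (set f)"
  shows "span (set (f[i := x])) \<subseteq> span (set f)"
  using assms set_update_subset_insert[of f i x] by (intro span_minimal) (auto intro: span_base)

lemma basis_change_span: "basis_change e f d \<Longrightarrow> span (set f) = span (set e)"
proof (induction rule: basis_change.induct)
  case scale: (basis_scale f d i c)
  let ?g = "f[i := c *\<^sub>R f ! i]"
  have "span (set ?g) \<subseteq> span (set f)"
    using scale by (intro span_update_subset span_scale span_base) simp
  moreover have "span (set (?g[i := (1 / c) *\<^sub>R ?g ! i])) \<subseteq> span (set ?g)"
    using scale by (intro span_update_subset span_scale span_base nth_mem) simp
  then have "span (set f) \<subseteq> span (set ?g)" using scale by simp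
  ultimately show ?case using scale by simp
next
  case shear: (basis_shear f d i j c)
  let ?g = "f[i := f ! i + c *\<^sub>R f ! j]"
  have "span (set ?g) \<subseteq> span (set f)"
    using shear by (intro span_update_subset span_add span_scale span_base) simp_all
  moreover have "span (set (?g[i := ?g ! i - c *\<^sub>R ?g ! j])) \<subseteq> span (set ?g)"
    using shear by (intro span_update_subset span_diff span_scale span_base nth_mem) simp_all
  then have "span (set f) \<subseteq> span (set ?g)" using shear by simp
  ultimately show ?case using shear by simp
qed simp

text \<open>
  A spanning list whose length is the dimension is a basis. In this form it is clear that elementary
  steps preserve bases, as they preserve span and length.
\<close>

lemma basis_of_iff_length:
  fixes W :: "'a::euclidean_space set"
  shows "basis_of W e \<longleftrightarrow> span (set e) = W \<and> length e = dim W"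
proof
  assume e: "span (set e) = W \<and> length e = dim W"
  have "dim W \<le> card (set e)"
    using e dim_le_card[of W "set e"] by auto
  then have "card (set e) = length e"
    using e card_length[of e] by linarith
  moreover have "independent (set e)"
    using e \<open>dim W \<le> card (set e)\<close>
    by (metis card_eq_dim card_length dim_span order.antisym order_refl span_superset List.finite_set
        card_ge_dim_independent card_le_dim_spanning)
  ultimately show "basis_of W e"
    using e by (auto simp: basis_of_def card_distinct)
qed (auto simp: basis_of_def basis_of_length)

lemma basis_change_basis_of:
  fixes W :: "'a::euclidean_space set"
  assumes "basis_change e f d" "basis_of W e"
  shows "basis_of W f"
  using assms basis_change_length basis_change_span unfolding basis_of_iff_length by metis

lemma basis_change_wedge: "basis_change e f d \<Longrightarrow> wedge f = d *\<^sub>R wedge e"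
proof (induction rule: basis_change.induct)
  have split: "wedge (f[i := x]) = wedge (take i f) * ext_vec x * wedge (drop (Suc i) f)"
    if "i < length f" for f :: "'a list" and i x
    using that by (simp add: upd_conv_take_nth_drop wedge_append wedge_Cons mult.assoc)
  {
    case scale: (basis_scale f d i c)
    have "wedge (f[i := c *\<^sub>R f ! i]) = c *\<^sub>R wedge (f[i := f ! i])"
      using scale by (simp add: split linear_scale[OF ext_vec_linear] del: list_update_id)
    then show ?case using scale by simp
  next
    case shear: (basis_shear f d i j c)
    have "wedge (f[i := f ! j]) = 0"
      using shear wedge_repeated[of "min i j" "max i j" "f[i := f ! j]"]
      by (auto simp: min_def max_def split: if_splits)
    then have "wedge (f[i := f ! i + c *\<^sub>R f ! j]) = wedge (f[i := f ! i])"
      using shear by (simp add: split linear_add[OF ext_vec_linear] linear_scale[OF ext_vec_linear]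
          distrib_left distrib_right del: list_update_id)
    then show ?case using shear by simp
  }
qed simp

text \<open>
  A permutation that contributes to the determinant fixes every index other than \<open>k\<close>, hence all of
  them. The matrices of the elementary steps have this shape.
\<close>

lemma det_upto_single_row:
  assumes "\<And>i j. i < n \<Longrightarrow> j < n \<Longrightarrow> i \<noteq> j \<Longrightarrow> i \<noteq> k \<Longrightarrow> M i j = (0::real)"
  shows "det_upto n M = (\<Prod>i<n. M i i)"
proof -
  have "(\<Prod>i<n. M i (\<pi> i)) = 0" if \<pi>: "\<pi> permutes {..<n}" and "\<pi> \<noteq> id" for \<pi>
  proof (rule ccontr)
    assume "(\<Prod>i<n. M i (\<pi> i)) \<noteq> 0"
    then have nz: "M i (\<pi> i) \<noteq> 0" if "i < n" for i using that by simp
    have fix_ne: "\<pi> i = i" if "i \<noteq> k" for i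
    proof (cases "i < n")
      case True
      then have "\<pi> i < n" using permutes_in_image[OF \<pi>, of i] by simp
      then show ?thesis using assms[of i "\<pi> i"] nz[OF True] True that by fastforce
    next
      case False
      then show ?thesis using permutes_not_in[OF \<pi>, of i] by simp
    qed
    have "\<pi> k = k"
    proof (rule ccontr)
      assume "\<pi> k \<noteq> k"
      then have "\<pi> (\<pi> k) = \<pi> k" by (rule fix_ne)
      then show False using \<open>\<pi> k \<noteq> k\<close> permutes_inj[OF \<pi>] by (metis injD)
    qed
    then have "\<pi> = id" using fix_ne by (metis eq_id_iff)
    then show False using that by simp
  qed
  then have "det_upto n M = (\<Sum>\<pi>\<in>{id}. of_int (sign \<pi>) * (\<Prod>i<n. M i (\<pi> i)))"
    unfolding det_upto_def
    by (intro sum.mono_neutral_right) (auto simp: finite_permutations permutes_id)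
  then show ?thesis by (simp add: sign_id)
qed

lemma orientation_sign:
  assumes "\<sigma> \<in> orientations W" "basis_of W e"
  shows "\<sigma> e = 1 \<or> \<sigma> e = - 1"
  using assms by (simp add: orientations_def)

lemma orientation_transform:
  assumes "\<sigma> \<in> orientations W" "basis_of W e" "basis_of W f"
    and "\<And>j. j < length e \<Longrightarrow> f ! j = (\<Sum>i<length e. M i j *\<^sub>R e ! i)"
  shows "\<sigma> f = sgn (det_upto (length e) M) * \<sigma> e"
  using assms unfolding orientations_def by blast

lemma orientation_basis_change:
  fixes W :: "'a::euclidean_space set"
  assumes "basis_change e f d" and e: "basis_of W e" and \<sigma>: "\<sigma> \<in> orientations W"
  shows "\<sigma> f = sgn d * \<sigma> e"
  using assms(1)
proof (induction rule: basis_change.induct)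
  {
    case scale: (basis_scale f d i c)
    let ?M = "\<lambda>k j. if k = j then if k = i then c else 1 else 0"
    note bc = basis_change.basis_scale[OF scale(1-3)]
    have "\<sigma> (f[i := c *\<^sub>R f ! i]) = sgn (det_upto (length f) ?M) * \<sigma> f"
    proof (rule orientation_transform[OF \<sigma>])
      show "f[i := c *\<^sub>R f ! i] ! j = (\<Sum>k<length f. ?M k j *\<^sub>R f ! k)" if "j < length f" for j
      proof -
        have "(\<Sum>k<length f. ?M k j *\<^sub>R f ! k) = (\<Sum>k<length f. if k = j then (if j = i then c else 1) *\<^sub>R f ! j else 0)"
          by (rule sum.cong) auto
        then show ?thesis using that scale(2) by (auto simp: nth_list_update)
      qed
    qed (use basis_change_basis_of[OF scale(1) e] basis_change_basis_of[OF bc e] in auto)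
    also have "det_upto (length f) ?M = c"
      using scale(2) by (subst det_upto_single_row) auto
    finally show ?case using scale by (simp add: sgn_mult)
  next
    case shear: (basis_shear f d i j c)
    let ?M = "\<lambda>k m. if k = m then 1 else if k = j \<and> m = i then c else 0"
    note bc = basis_change.basis_shear[OF shear(1-4), of c]
    have "\<sigma> (f[i := f ! i + c *\<^sub>R f ! j]) = sgn (det_upto (length f) ?M) * \<sigma> f"
    proof (rule orientation_transform[OF \<sigma>])
      show "f[i := f ! i + c *\<^sub>R f ! j] ! m = (\<Sum>k<length f. ?M k m *\<^sub>R f ! k)" if "m < length f" for m
      proof -
        have "(\<Sum>k<length f. ?M k m *\<^sub>R f ! k) = (\<Sum>k<length f. (if k = m then f ! m else 0) +
            (if k = j then (if m = i then c *\<^sub>R f ! j else 0) else 0))"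
          by (rule sum.cong) (use shear(4) in auto)
        then show ?thesis using that shear(2-4) by (auto simp: sum.distrib nth_list_update)
      qed
    qed (use basis_change_basis_of[OF shear(1) e] basis_change_basis_of[OF bc e] in auto)
    also have "det_upto (length f) ?M = 1"
      by (subst det_upto_single_row[where k = j]) auto
    finally show ?case using shear by simp
  }
qed simp

text \<open>
  The vector \<open>g ! k\<close> is first multiplied by its coefficient and then receives the other terms of the
  linear combination one at a time.
\<close>

lemma basis_change_replace:
  assumes "basis_change e g d" and k: "k < length g" "c k \<noteq> 0"
  shows "\<exists>d'. basis_change e (g[k := (\<Sum>j<length g. c j *\<^sub>R g ! j)]) d'"
proof -
  have "\<exists>d'. basis_change e (g[k := c k *\<^sub>R g ! k + (\<Sum>j\<in>J. c j *\<^sub>R g ! j)]) d'"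
    if "finite J" "J \<subseteq> {..<length g} - {k}" for J
    using that
  proof (induction J rule: finite_induct)
    case empty
    then show ?case using basis_change.basis_scale[OF assms] by auto
  next
    case (insert i J)
    then obtain d' where d': "basis_change e (g[k := c k *\<^sub>R g ! k + (\<Sum>j\<in>J. c j *\<^sub>R g ! j)]) d'"
      by auto
    from basis_change.basis_shear[OF this, of k i "c i"] insert k show ?case
      by (auto simp: add_ac)
  qed
  from this[of "{..<length g} - {k}"] k show ?thesis
    by (simp add: sum.remove[of "{..<length g}" k])
qed

lemma span_set_coeffs:
  assumes "distinct g" "x \<in> span (set g)"
  obtains c where "x = (\<Sum>j<length g. c j *\<^sub>R g ! j)"
proof -
  obtain u where "x = (\<Sum>y\<in>set g. u y *\<^sub>R y)"
    using assms(2) by (auto simp: span_finite)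
  also have "\<dots> = (\<Sum>j<length g. u (g ! j) *\<^sub>R g ! j)"
    using bij_betw_nth[OF assms(1), of "{..<length g}" "set g"]
    by (intro sum.reindex_bij_betw[symmetric]) auto
  finally show thesis by (rule that)
qed

text \<open>
  Steinitz exchange without permuting the list: \<open>f ! m\<close> is put in position \<open>m\<close>, for one \<open>m\<close>
  after the other. Since \<open>f\<close> is independent, \<open>f ! m\<close> involves some \<open>g ! j\<close> with \<open>j \<ge> m\<close>. If \<open>g ! m\<close>
  itself does not occur in \<open>f ! m\<close>, subtracting it from \<open>g ! j\<close> makes it occur.
\<close>

lemma basis_change_exists:
  fixes W :: "'a::euclidean_space set"
  assumes e: "basis_of W e" and f: "basis_of W f"
  obtains d where "basis_change e f d"
proof -
  have len: "length e = length f"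
    using basis_of_length[OF e] basis_of_length[OF f] by simp
  have "\<exists>g d. basis_change e g d \<and> take m g = take m f" if "m \<le> length f" for m
    using that
  proof (induction m)
    case 0
    show ?case using basis_change.basis_id by auto
  next
    case (Suc m)
    then obtain g d where g: "basis_change e g d" "take m g = take m f" by auto
    have lg: "length g = length f" using basis_change_length[OF g(1)] len by simp
    have bg: "basis_of W g" by (rule basis_change_basis_of[OF g(1) e])
    have m: "m < length f" using Suc by simp
    have nth: "g ! i = f ! i" if "i < m" for i
      using g(2) that by (metis nth_take)
    have "f ! m \<in> span (set g)"
      using bg f m by (metis basis_of_def nth_mem span_base)
    then obtain c where c: "f ! m = (\<Sum>j<length g. c j *\<^sub>R g ! j)"
      using bg span_set_coeffs[of g] unfolding basis_of_def by blast
    have take_eq: "take (Suc m) h = take (Suc m) f"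
      if "length h = length f" "h ! m = f ! m" "\<And>i. i < m \<Longrightarrow> h ! i = g ! i" for h
      by (rule nth_equalityI) (use that m nth in \<open>auto simp: less_Suc_eq\<close>)
    obtain j where j: "m \<le> j" "j < length g" "c j \<noteq> 0"
    proof (rule ccontr)
      assume *: "\<not> thesis"
      then have "c j = 0" if "m \<le> j" "j < length g" for j
        using that \<open>\<And>j. m \<le> j \<Longrightarrow> j < length g \<Longrightarrow> c j \<noteq> 0 \<Longrightarrow> thesis\<close> by blast
      then have "f ! m = (\<Sum>j<m. c j *\<^sub>R g ! j)"
        unfolding c using m lg by (intro sum.mono_neutral_right) auto
      also have "\<dots> = (\<Sum>j<m. c j *\<^sub>R f ! j)"
        by (intro sum.cong) (simp_all add: nth)
      also have "\<dots> \<in> span (set f - {f ! m})"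
        using f m by (intro span_sum span_scale span_base)
          (auto simp: basis_of_def nth_eq_iff_index_eq)
      finally show False
        using f m by (auto simp: basis_of_def dependent_def)
    qed
    show ?case
    proof (cases "c m = 0")
      case False
      then obtain d' where "basis_change e (g[m := f ! m]) d'"
        using basis_change_replace[OF g(1), of m c] m lg c by auto
      then show ?thesis
        using take_eq[of "g[m := f ! m]"] m lg by auto
    next
      case True
      then have jm: "j \<noteq> m" using j by auto
      define h where "h = g[j := g ! j + (- 1) *\<^sub>R g ! m]"
      have h: "basis_change e h d"
        unfolding h_def using g(1) j m lg jm by (intro basis_change.basis_shear) auto
      have lh: "length h = length g" by (simp add: h_def)
      define c' where "c' = c(m := c j)"
      have "f ! m = (\<Sum>i<length h. c' i *\<^sub>R h ! i)"
      proof -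
        have hj: "h ! i = g ! i + (if i = j then - (g ! m) else 0)" if "i < length g" for i
          using that j by (simp add: h_def nth_list_update)
        have "(\<Sum>i<length h. c' i *\<^sub>R h ! i) = (\<Sum>i<length g. c i *\<^sub>R g ! i +
            ((if i = m then c j *\<^sub>R g ! m else 0) - (if i = j then c j *\<^sub>R g ! m else 0)))"
          unfolding lh by (rule sum.cong) (use hj jm True in \<open>auto simp: c'_def scaleR_add_right\<close>)
        also have "\<dots> = (\<Sum>i<length g. c i *\<^sub>R g ! i)"
          using j m lg by (simp add: sum.distrib sum_subtractf)
        finally show ?thesis using c by simp
      qed
      then obtain d' where "basis_change e (h[m := f ! m]) d'"
        using basis_change_replace[OF h, of m c'] m lg lh j by (auto simp: c'_def)
      then show ?thesis
        using take_eq[of "h[m := f ! m]"] m lg j jm by (auto simp: h_def intro!: exI)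
    qed
  qed
  from this[of "length f"] obtain g d where "basis_change e g d" "take (length f) g = f"
    by auto
  then have "basis_change e f d"
    using basis_change_length[of e g d] len by simp
  then show thesis by (rule that)
qed

lemma basis_change_dilate_prefix:
  assumes "s \<noteq> 0"
  shows "basis_change (e @ f) (map ((*\<^sub>R) s) e @ f) (s ^ length e)"
proof -
  have "basis_change (e @ f) (map ((*\<^sub>R) s) (take k e) @ drop k e @ f) (s ^ k)" if "k \<le> length e" for k
    using that
  proof (induction k)
    case 0
    show ?case using basis_change.basis_id by simp
  next
    case (Suc k)
    let ?g = "map ((*\<^sub>R) s) (take k e) @ drop k e @ f"
    have d: "drop k e = e ! k # drop (Suc k) e"
      using Suc.prems by (simp add: Cons_nth_drop_Suc)
    have "basis_change (e @ f) (?g[k := s *\<^sub>R ?g ! k]) (s * s ^ k)"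
      using Suc assms by (intro basis_change.basis_scale) auto
    moreover have "?g[k := s *\<^sub>R ?g ! k] = map ((*\<^sub>R) s) (take (Suc k) e) @ drop (Suc k) e @ f"
      using Suc.prems by (simp add: d list_update_append nth_append take_Suc_conv_app_nth min_def)
    ultimately show ?case by simp
  qed
  from this[of "length e"] show ?thesis by simp
qed

section \<open>Orientations of direct sums\<close>

lemma det_upto_block_identity:
  "det_upto (p + q) (\<lambda>i j. if i < p \<and> j < p then M i j else if i = j then 1 else 0) = det_upto p M"
    (is "det_upto _ ?N = _")
proof -
  have "det_upto (p + q) ?N = (\<Sum>\<pi> | \<pi> permutes {..<p}. of_int (sign \<pi>) * (\<Prod>i<p + q. ?N i (\<pi> i)))"
    unfolding det_upto_def
  proof (rule sum.mono_neutral_right)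
    show "{\<pi>. \<pi> permutes {..<p}} \<subseteq> {\<pi>. \<pi> permutes {..<p + q}}"
      by (auto intro: permutes_subset)
    show "\<forall>\<pi>\<in>{\<pi>. \<pi> permutes {..<p + q}} - {\<pi>. \<pi> permutes {..<p}}.
        of_int (sign \<pi>) * (\<Prod>i<p + q. ?N i (\<pi> i)) = 0"
    proof
      fix \<pi> assume \<pi>: "\<pi> \<in> {\<pi>. \<pi> permutes {..<p + q}} - {\<pi>. \<pi> permutes {..<p}}"
      then obtain i where i: "i \<notin> {..<p}" "\<pi> i \<noteq> i"
        using permutes_superset[of \<pi> "{..<p + q}" "{..<p}"] by blast
      then have "i < p + q" using \<pi> permutes_not_in[of \<pi> "{..<p + q}" i] by auto
      moreover have "?N i (\<pi> i) = 0" using i by auto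
      ultimately have "(\<Prod>i<p + q. ?N i (\<pi> i)) = 0"
        by (intro prod_zero bexI[of _ i]) simp_all
      then show "of_int (sign \<pi>) * (\<Prod>i<p + q. ?N i (\<pi> i)) = 0" by simp
    qed
  qed (simp add: finite_permutations)
  also have "\<dots> = det_upto p M"
    unfolding det_upto_def
  proof (rule sum.cong)
    fix \<pi> assume "\<pi> \<in> {\<pi>. \<pi> permutes {..<p}}"
    then have \<pi>: "\<pi> permutes {..<p}" by simp
    have "(\<Prod>i<p + q. ?N i (\<pi> i)) = (\<Prod>i<p. ?N i (\<pi> i))"
      using permutes_not_in[OF \<pi>] by (intro prod.mono_neutral_right) auto
    also have "\<dots> = (\<Prod>i<p. M i (\<pi> i))"
      using permutes_in_image[OF \<pi>] by (intro prod.cong) auto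
    finally show "of_int (sign \<pi>) * (\<Prod>i<p + q. ?N i (\<pi> i)) = of_int (sign \<pi>) * (\<Prod>i<p. M i (\<pi> i))"
      by simp
  qed simp
  finally show ?thesis .
qed

lemma basis_of_append:
  fixes U V :: "'a::euclidean_space set"
  assumes e: "basis_of U e" and f: "basis_of V f" and direct: "U \<inter> V = {0}"
  shows "basis_of {x + y |x y. x \<in> U \<and> y \<in> V} (e @ f)"
proof -
  have "subspace U" "subspace V"
    using e f by (auto simp: basis_of_def)
  then have "dim {x + y |x y. x \<in> U \<and> y \<in> V} = dim U + dim V"
    using dim_sums_Int[of U V] direct by simp
  moreover have "span (set (e @ f)) = {x + y |x y. x \<in> U \<and> y \<in> V}"
    using e f by (auto simp: basis_of_def span_Un)
  ultimately show ?thesis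
    using basis_of_length[OF e] basis_of_length[OF f] unfolding basis_of_iff_length by simp
qed

lemma basis_of_append_imp_direct:
  fixes U V :: "'a::euclidean_space set"
  assumes e: "basis_of U e" and f: "basis_of V f" and ef: "basis_of W (e @ f)"
  shows "W = {x + y |x y. x \<in> U \<and> y \<in> V}" and "U \<inter> V = {0}"
proof -
  have sub: "subspace U" "subspace V"
    using e f by (auto simp: basis_of_def)
  show W: "W = {x + y |x y. x \<in> U \<and> y \<in> V}"
    using e f ef by (auto simp: basis_of_def span_Un)
  have "dim (U \<inter> V) = 0"
    using dim_sums_Int[OF sub] W basis_of_length[OF e] basis_of_length[OF f] basis_of_length[OF ef]
    by simp
  then show "U \<inter> V = {0}"
    using sub subspace_0 by auto
qed

lemma orientation_nonzero:
  assumes "\<sigma> \<in> orientations W" "basis_of W e"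
  shows "\<sigma> e * \<sigma> e = 1"
  using orientation_sign[OF assms] by auto

text \<open>
  The block sum of a base change of \<open>U\<close> with the identity on the fixed basis \<open>h\<close> of the complement
  is a base change of \<open>W\<close> with the same determinant.
\<close>

lemma orientation_append:
  fixes W U V :: "'a::euclidean_space set"
  assumes \<sigma>: "\<sigma> \<in> orientations W" and W: "W = {x + y |x y. x \<in> U \<and> y \<in> V}"
    and direct: "U \<inter> V = {0}" and h: "basis_of V h"
  shows "(\<lambda>e. if basis_of U e then \<sigma> (e @ h) else 0) \<in> orientations U"
proof -
  have bas: "basis_of W (e @ h)" if "basis_of U e" for e
    unfolding W by (rule basis_of_append[OF that h direct])
  have "\<sigma> (f @ h) = sgn (det_upto (length e) M) * \<sigma> (e @ h)"
    if e: "basis_of U e" and f: "basis_of U f"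
      and M: "\<forall>j<length e. f ! j = (\<Sum>i<length e. M i j *\<^sub>R e ! i)" for e f M
  proof -
    let ?p = "length e" and ?q = "length h"
    let ?N = "\<lambda>i j. if i < ?p \<and> j < ?p then M i j else if i = j then 1 else 0"
    have len: "length f = ?p"
      using basis_of_length[OF e] basis_of_length[OF f] by simp
    have "(f @ h) ! j = (\<Sum>i<length (e @ h). ?N i j *\<^sub>R (e @ h) ! i)" if j: "j < length (e @ h)" for j
    proof (cases "j < ?p")
      case True
      then have "(\<Sum>i<length (e @ h). ?N i j *\<^sub>R (e @ h) ! i) = (\<Sum>i<?p. M i j *\<^sub>R e ! i)"
        by (intro sum.mono_neutral_cong_right) (auto simp: nth_append)
      then show ?thesis using M True len by (simp add: nth_append)
    next
      case False
      then have "(\<Sum>i<length (e @ h). ?N i j *\<^sub>R (e @ h) ! i) =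
          (\<Sum>i<length (e @ h). if i = j then (e @ h) ! j else 0)"
        by (intro sum.cong) auto
      then show ?thesis using j False len by (simp add: nth_append)
    qed
    then have "\<sigma> (f @ h) = sgn (det_upto (length (e @ h)) ?N) * \<sigma> (e @ h)"
      by (rule orientation_transform[OF \<sigma> bas[OF e] bas[OF f]])
    then show ?thesis by (simp add: det_upto_block_identity)
  qed
  moreover have "\<sigma> (e @ h) = 1 \<or> \<sigma> (e @ h) = - 1" if "basis_of U e" for e
    by (rule orientation_sign[OF \<sigma> bas[OF that]])
  ultimately show ?thesis unfolding orientations_def by auto
qed

lemma basis_change_append: "basis_change e f d \<Longrightarrow> basis_change (e @ h) (f @ h) d"
proof (induction rule: basis_change.induct)
  case basis_id
  show ?case by (rule basis_change.basis_id)
next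
  case scale: (basis_scale f d i c)
  then show ?case
    using basis_change.basis_scale[of "e @ h" "f @ h" d i c] by (simp add: list_update_append nth_append)
next
  case shear: (basis_shear f d i j c)
  then show ?case
    using basis_change.basis_shear[of "e @ h" "f @ h" d i j c] by (simp add: list_update_append nth_append)
qed

lemma basis_change_prepend: "basis_change e f d \<Longrightarrow> basis_change (h @ e) (h @ f) d"
proof (induction rule: basis_change.induct)
  case basis_id
  show ?case by (rule basis_change.basis_id)
next
  case scale: (basis_scale f d i c)
  then show ?case
    using basis_change.basis_scale[of "h @ e" "h @ f" d "length h + i" c] by (simp add: list_update_append nth_append)
next
  case shear: (basis_shear f d i j c)
  then show ?case
    using basis_change.basis_shear[of "h @ e" "h @ f" d "length h + i" "length h + j" c]
    by (simp add: list_update_append nth_append)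
qed

text \<open>
  Here the identity block comes first. Instead of evaluating such a determinant, the case of an
  appended basis is used to see that the sign of the matrix is that of any chain of elementary steps
  from \<open>e\<close> to \<open>f\<close>; these steps can be carried out after \<open>h\<close> as well as before it.
\<close>

lemma orientation_prepend:
  fixes W U V :: "'a::euclidean_space set"
  assumes \<sigma>: "\<sigma> \<in> orientations W" and W: "W = {x + y |x y. x \<in> U \<and> y \<in> V}"
    and direct: "U \<inter> V = {0}" and h: "basis_of U h" and k: "k = 1 \<or> k = - 1"
  shows "(\<lambda>f. if basis_of V f then k * \<sigma> (h @ f) else 0) \<in> orientations V"
proof -
  have bas: "basis_of W (h @ f)" if "basis_of V f" for f
    unfolding W by (rule basis_of_append[OF h that direct])
  let ?\<tau> = "\<lambda>f. if basis_of V f then \<sigma> (f @ h) else 0"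
  have W': "W = {x + y |x y. x \<in> V \<and> y \<in> U}"
    unfolding W by (auto simp: add.commute) (metis add.commute)+
  have \<tau>: "?\<tau> \<in> orientations V"
    using direct by (intro orientation_append[OF \<sigma> W' _ h]) auto
  have "\<sigma> (h @ f) = sgn (det_upto (length e) M) * \<sigma> (h @ e)"
    if e: "basis_of V e" and f: "basis_of V f"
      and M: "\<forall>j<length e. f ! j = (\<Sum>i<length e. M i j *\<^sub>R e ! i)" for e f M
  proof -
    obtain d where d: "basis_change e f d"
      using basis_change_exists[OF e f] .
    have "sgn d * ?\<tau> e = sgn (det_upto (length e) M) * ?\<tau> e"
    proof -
      have "?\<tau> f = sgn d * ?\<tau> e" by (rule orientation_basis_change[OF d e \<tau>])
      moreover have "?\<tau> f = sgn (det_upto (length e) M) * ?\<tau> e"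
        using M by (intro orientation_transform[OF \<tau> e f]) simp
      ultimately show ?thesis by (rule trans[OF sym])
    qed
    moreover have "?\<tau> e \<noteq> 0" using orientation_sign[OF \<tau> e] e by auto
    ultimately have "sgn d = sgn (det_upto (length e) M)"
      by (metis mult_right_cancel)
    moreover have "\<sigma> (h @ f) = sgn d * \<sigma> (h @ e)"
      by (rule orientation_basis_change[OF basis_change_prepend[OF d] bas[OF e] \<sigma>])
    ultimately show ?thesis by simp
  qed
  moreover have "k * \<sigma> (h @ f) = 1 \<or> k * \<sigma> (h @ f) = - 1" if "basis_of V f" for f
    using orientation_sign[OF \<sigma> bas[OF that]] k by auto
  ultimately show ?thesis unfolding orientations_def by auto
qed

text \<open>
  Bases \<open>g\<close> and \<open>h\<close> of the summands serve as reference. The orientation of \<open>U\<close> is read off with \<open>h\<close>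
  appended, that of \<open>V\<close> with \<open>g\<close> prepended; the factor \<open>\<sigma> (g @ h)\<close> cancels the sign that is counted
  twice.
\<close>

lemma oriented_direct_sum_exists:
  fixes W U V :: "'a::euclidean_space set"
  assumes \<sigma>: "\<sigma> \<in> orientations W" and W: "W = {x + y |x y. x \<in> U \<and> y \<in> V}"
    and direct: "U \<inter> V = {0}" and g: "basis_of U g" and h: "basis_of V h"
  shows "\<exists>\<sigma>\<^sub>1 \<sigma>\<^sub>2. \<sigma>\<^sub>1 \<in> orientations U \<and> \<sigma>\<^sub>2 \<in> orientations V \<and> oriented_direct_sum W \<sigma> U \<sigma>\<^sub>1 V \<sigma>\<^sub>2"
proof -
  have gh: "basis_of W (g @ h)"
    unfolding W by (rule basis_of_append[OF g h direct])
  let ?\<sigma>\<^sub>1 = "\<lambda>e. if basis_of U e then \<sigma> (e @ h) else 0"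
  let ?\<sigma>\<^sub>2 = "\<lambda>f. if basis_of V f then \<sigma> (g @ h) * \<sigma> (g @ f) else 0"
  have "\<sigma> (e @ f) = ?\<sigma>\<^sub>1 e * ?\<sigma>\<^sub>2 f" if e: "basis_of U e" and f: "basis_of V f" for e f
  proof -
    obtain d where d: "basis_change g e d"
      using basis_change_exists[OF g e] .
    have gf: "basis_of W (g @ f)"
      unfolding W by (rule basis_of_append[OF g f direct])
    have "\<sigma> (e @ f) = sgn d * \<sigma> (g @ f)" "\<sigma> (e @ h) = sgn d * \<sigma> (g @ h)"
      using orientation_basis_change[OF basis_change_append[OF d] _ \<sigma>] gf gh by auto
    then show ?thesis
      using e f orientation_nonzero[OF \<sigma> gh] by (simp add: mult.assoc)
  qed
  then have "oriented_direct_sum W \<sigma> U ?\<sigma>\<^sub>1 V ?\<sigma>\<^sub>2"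
    using W direct unfolding oriented_direct_sum_def by blast
  moreover have "?\<sigma>\<^sub>1 \<in> orientations U" by (rule orientation_append[OF \<sigma> W direct h])
  moreover have "?\<sigma>\<^sub>2 \<in> orientations V"
    by (rule orientation_prepend[OF \<sigma> W direct g]) (use \<sigma> gh in \<open>auto simp: orientations_def\<close>)
  ultimately show ?thesis by blast
qed

section \<open>Volume multivectors\<close>

lemma wedge_dependent:
  fixes xs :: "'a::real_vector list"
  assumes "\<not> (distinct xs \<and> independent (set xs))"
  shows "wedge xs = 0"
proof (cases "distinct xs")
  case False
  then obtain i j where "i < length xs" "j < length xs" "i \<noteq> j" "xs ! i = xs ! j"
    by (auto simp: distinct_conv_nth)
  then have "min i j < max i j" "max i j < length xs" "xs ! min i j = xs ! max i j"
    by (auto simp: min_def max_def)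
  then show ?thesis by (rule wedge_repeated)
next
  case True
  then obtain x where x: "x \<in> set xs" "x \<in> span (set xs - {x})"
    using assms by (auto simp: dependent_def)
  then obtain i where i: "i < length xs" "xs ! i = x" by (auto simp: in_set_conv_nth)
  have lin: "linear (\<lambda>y. wedge (xs[i := y]))"
    using i(1) by (intro linearI)
      (simp_all add: upd_conv_take_nth_drop wedge_append wedge_Cons distrib_left distrib_right
        linear_add[OF ext_vec_linear] linear_scale[OF ext_vec_linear])
  have "wedge (xs[i := y]) = 0" if y: "y \<in> set xs - {x}" for y
  proof -
    obtain j where j: "j < length xs" "xs ! j = y" using y by (auto simp: in_set_conv_nth)
    then have "j \<noteq> i" using y i by auto
    then show ?thesis
      using i j wedge_repeated[of "min i j" "max i j" "xs[i := y]"]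
      by (auto simp: min_def max_def split: if_splits)
  qed
  then have "wedge (xs[i := x]) = 0"
    using linear_eq_0_on_span[OF lin _ x(2)] by blast
  then show ?thesis using i by auto
qed

text \<open>
  The volume cochain in coordinates. The chart depends only on the cell and is the one that the
  definition of the integral chooses, so it serves all orientations of the cell at the same time.
\<close>

lemma vol_in_chart:
  fixes \<delta> :: "'a::euclidean_space set"
  assumes "\<delta> \<noteq> {}"
  shows "\<exists>a e. a \<in> affine hull \<delta> \<and> basis_of (direction \<delta>) e \<and>
    (\<forall>X q \<sigma>. (\<delta>, \<sigma>) \<in> oriented_cells X q \<longrightarrow>
      vol X q (\<delta>, \<sigma>) = (fact q * \<sigma> e * enn2real (chart_volume a e \<delta>)) *\<^sub>R wedge e)"
proof -
  define A where "A = affine hull \<delta>"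
  have A: "direction A = direction \<delta>"
    unfolding A_def by (rule direction_affine_hull)
  define P where "P = (\<lambda>(a, e). a \<in> A \<and> basis_of (direction A) e)"
  obtain a0 where "a0 \<in> A"
    using assms hull_subset[of \<delta> affine] by (auto simp: A_def)
  moreover obtain f where "basis_of (direction A) f"
    using basis_of_ex[of "direction A"] by (auto simp: direction_def)
  ultimately have "P (a0, f)" by (simp add: P_def)
  then have "P (Eps P)" by (rule someI)
  moreover obtain a e where ae: "Eps P = (a, e)" by (cases "Eps P")
  ultimately have a: "a \<in> A" and e: "basis_of (direction A) e" by (simp_all add: P_def)
  let ?m = "enn2real (chart_volume a e \<delta>)"
  have int: "form_integral A \<tau> \<omega> \<delta> = \<tau> e * ?m * \<omega> e" for \<tau> \<omega>
  proof -
    let ?M = "Pi\<^sub>M {..<length e} (\<lambda>_. lborel :: real measure)"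
    have "chart_set a e \<delta> \<inter> space ?M = chart_set a e \<delta>"
      by (auto simp: chart_set_def)
    then have "(LINT t:chart_set a e \<delta>|?M. \<omega> e) = ?m * \<omega> e"
      by (simp add: set_lebesgue_integral_def chart_volume_def measure_def)
    then show ?thesis
      by (simp add: form_integral_def ae[unfolded P_def] Let_def chart_set_def)
  qed
  have "vol X q (\<delta>, \<sigma>) = (fact q * \<sigma> e * ?m) *\<^sub>R wedge e" if \<sigma>: "(\<delta>, \<sigma>) \<in> oriented_cells X q" for X q \<sigma>
  proof -
    have len: "length e = q"
      using basis_of_length[OF e] \<sigma> by (simp add: A oriented_cells_def cell_dim_def)
    have "multivector q A \<sigma> \<delta> = (\<sigma> e * ?m) *\<^sub>R wedge e"
    proof (rule multivector_eqI)
      show "(\<sigma> e * ?m) *\<^sub>R wedge e \<in> ext_grade q"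
        unfolding ext_grade_def by (intro span_scale span_base) (use len in blast)
      show "form_pair q \<omega> ((\<sigma> e * ?m) *\<^sub>R wedge e) = form_integral A \<sigma> \<omega> \<delta>"
        if "alternating_form q \<omega>" for \<omega>
        using that len by (simp add: int linear_scale[OF form_pair_linear] form_pair_wedge)
    qed
    then show ?thesis using \<sigma> by (simp add: vol_def A_def mult.assoc)
  qed
  then show ?thesis using a e by (auto simp: A_def A[unfolded A_def])
qed

section \<open>Mixed decompositions of dilated polytopes\<close>

definition minkowski_cell :: "real \<Rightarrow> 'a::real_vector set \<Rightarrow> 'a set \<Rightarrow> 'a set"
  where "minkowski_cell s F G = {s *\<^sub>R x + y |x y. x \<in> F \<and> y \<in> G}"

definition max_face :: "'a::euclidean_space set \<Rightarrow> 'a \<Rightarrow> 'a set"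
  where "max_face C u = {x \<in> C. \<forall>y\<in>C. u \<bullet> y \<le> u \<bullet> x}"

lemma compact_minkowski_cell:
  fixes F G :: "'a::euclidean_space set"
  assumes "compact F" "compact G"
  shows "compact (minkowski_cell s F G)"
proof -
  have "minkowski_cell s F G = (\<lambda>(x, y). s *\<^sub>R x + y) ` (F \<times> G)"
    by (auto simp: minkowski_cell_def)
  moreover have "compact ((\<lambda>(x, y). s *\<^sub>R x + y) ` (F \<times> G))"
    using assms by (intro compact_continuous_image compact_Times)
      (auto simp: case_prod_unfold intro!: continuous_intros)
  ultimately show ?thesis by simp
qed

lemma max_face_face_of:
  assumes "convex C"
  shows "max_face C u face_of C"
proof (cases "max_face C u = {}")
  case False
  then obtain x where x: "x \<in> C" "\<And>y. y \<in> C \<Longrightarrow> u \<bullet> y \<le> u \<bullet> x"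
    by (auto simp: max_face_def)
  then have "max_face C u = C \<inter> {y. u \<bullet> y = u \<bullet> x}"
    by (auto simp: max_face_def intro: antisym)
  moreover have "(C \<inter> {y. u \<bullet> y = u \<bullet> x}) face_of C"
    using assms x(2) by (rule face_of_Int_supporting_hyperplane_le)
  ultimately show ?thesis by simp
qed simp

text \<open>
  Linear programming duality for the problem of maximizing \<open>v\<close> at \<open>y\<close> under the constraint
  \<open>s x + y = z\<close>. The set of pairs \<open>(s x + y, v \<bullet> y)\<close> is convex and lies below the optimal value over
  \<open>z\<close>; a hyperplane that separates it from the vertical ray above that value has the optimal
  multiplier \<open>u\<close> as its slope. The hyperplane is not vertical because \<open>z\<close> is a relative interior
  point.
\<close>

lemma rel_interior_point_maximizers:
  fixes C :: "'a::euclidean_space set"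
  assumes C: "convex C" "compact C" and z: "z \<in> rel_interior (minkowski_cell s C C)" and s: "s > 0"
  shows "\<exists>u. z \<in> minkowski_cell s (max_face C u) (max_face C (u + v))"
proof -
  define K where "K = minkowski_cell s C C"
  define W where "W = direction K"
  have W: "subspace W" by (simp add: W_def direction_def)
  have K_diff: "x - y \<in> W" if "x \<in> K" "y \<in> K" for x y
    using that unfolding W_def direction_def by (auto intro: span_base)
  have "K = (\<lambda>(x, y). x + y) ` (((*\<^sub>R) s ` C) \<times> C)"
    by (auto simp: K_def minkowski_cell_def image_iff)
  then have "K = (\<Union>x\<in>(*\<^sub>R) s ` C. \<Union>y\<in>C. {x + y})"
    by auto
  then have "convex K"
    using convex_sums[OF convex_scaling[OF C(1), of s] C(1)] by simp
  have "z \<in> K"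
    using z rel_interior_subset[of K] by (auto simp: K_def)
  \<comment> \<open>Among the decompositions of \<open>z\<close> take one that maximizes \<open>v\<close> on the second summand.\<close>
  define D where "D = (C \<times> C) \<inter> {ab. s *\<^sub>R fst ab + snd ab = z}"
  have "compact D"
    unfolding D_def using C by (intro compact_Int_closed compact_Times closed_Collect_eq continuous_intros)
  moreover have "D \<noteq> {}"
    using \<open>z \<in> K\<close> by (force simp: K_def D_def minkowski_cell_def)
  moreover have "continuous_on D (\<lambda>ab. v \<bullet> snd ab)"
    by (intro continuous_intros)
  ultimately obtain ab where ab: "ab \<in> D" "\<And>xy. xy \<in> D \<Longrightarrow> v \<bullet> snd xy \<le> v \<bullet> snd ab"
    using continuous_attains_sup[of D "\<lambda>ab. v \<bullet> snd ab"] by blast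
  obtain a b where ab_eq: "ab = (a, b)" by (cases ab)
  have a: "a \<in> C" and b: "b \<in> C" and z_eq: "z = s *\<^sub>R a + b"
    using ab(1) by (auto simp: D_def ab_eq)
  have opt: "v \<bullet> y \<le> v \<bullet> b" if "x \<in> C" "y \<in> C" "s *\<^sub>R x + y = z" for x y
    using ab(2)[of "(x, y)"] that by (simp add: D_def ab_eq)
  \<comment> \<open>Thickening by the orthogonal complement of \<open>W\<close> excludes the separating hyperplanes that contain
    all the pairs: a normal vector bounded above on \<open>P\<close> has no component in \<open>P\<close>.\<close>
  define P where "P = {x. \<forall>w\<in>W. x \<bullet> w = 0}"
  have "subspace P"
    by (auto simp: P_def subspace_def inner_left_distrib)
  define Q where "Q = (\<lambda>((x, y), w). (s *\<^sub>R x + y + w, v \<bullet> y)) ` ((C \<times> C) \<times> P)"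
  define T where "T = (\<lambda>r. (z, r)) ` {v \<bullet> b<..}"
  have "convex Q"
    unfolding Q_def
  proof (rule convex_linear_image)
    show "linear (\<lambda>((x, y), w). (s *\<^sub>R x + y + w, v \<bullet> y))"
      by (rule linearI) (auto simp: inner_right_distrib algebra_simps)
    show "convex ((C \<times> C) \<times> P)"
      by (intro convex_Times C(1) subspace_imp_convex \<open>subspace P\<close>)
  qed
  moreover have "convex T"
  proof -
    have "T = {z} \<times> {v \<bullet> b<..}" by (auto simp: T_def)
    then show ?thesis by (simp add: convex_Times convex_real_interval)
  qed
  moreover have "Q \<noteq> {}" "T \<noteq> {}"
    using a subspace_0[OF \<open>subspace P\<close>] by (auto simp: Q_def T_def)
  moreover have "Q \<inter> T = {}"
  proof (rule ccontr)
    assume "Q \<inter> T \<noteq> {}"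
    then obtain x y w where xyw: "x \<in> C" "y \<in> C" "w \<in> P" "s *\<^sub>R x + y + w = z" "v \<bullet> y > v \<bullet> b"
      by (auto simp: Q_def T_def)
    have "s *\<^sub>R x + y \<in> K" using xyw by (auto simp: K_def minkowski_cell_def)
    then have "z - (s *\<^sub>R x + y) \<in> W" by (rule K_diff[OF \<open>z \<in> K\<close>])
    then have "w \<in> W" using xyw(4) by (metis add_diff_cancel_left')
    then have "w = 0" using xyw(3) by (auto simp: P_def)
    then show False using opt[of x y] xyw by simp
  qed
  ultimately obtain ct d where ct: "ct \<noteq> 0" "\<And>x. x \<in> Q \<Longrightarrow> ct \<bullet> x \<le> d" "\<And>x. x \<in> T \<Longrightarrow> d \<le> ct \<bullet> x"
    using separating_hyperplane_sets[of Q T] by blast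
  obtain c t where ct_eq: "ct = (c, t)" by (cases ct)
  have below: "c \<bullet> (s *\<^sub>R x + y + w) + t * (v \<bullet> y) \<le> d" if "x \<in> C" "y \<in> C" "w \<in> P" for x y w
  proof -
    have "(s *\<^sub>R x + y + w, v \<bullet> y) \<in> Q"
      unfolding Q_def by (rule image_eqI[of _ _ "((x, y), w)"]) (use that in auto)
    then show ?thesis using ct(2) by (fastforce simp: ct_eq)
  qed
  have above: "d \<le> c \<bullet> z + t * r" if "r > v \<bullet> b" for r
    using ct(3)[of "(z, r)"] that by (auto simp: ct_eq T_def)
  have "0 \<in> P" by (rule subspace_0[OF \<open>subspace P\<close>])
  have "t \<ge> 0"
  proof -
    have "c \<bullet> z + t * (v \<bullet> b) \<le> c \<bullet> z + t * (v \<bullet> b + 1)"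
      using below[OF a b \<open>0 \<in> P\<close>] above[of "v \<bullet> b + 1"] by (simp add: z_eq)
    then show ?thesis by (simp add: algebra_simps)
  qed
  have d: "d \<le> c \<bullet> z + t * (v \<bullet> b)"
  proof (rule field_le_epsilon)
    fix \<epsilon> :: real assume "\<epsilon> > 0"
    then have "d \<le> c \<bullet> z + t * (v \<bullet> b + \<epsilon> / (t + 1))"
      using \<open>t \<ge> 0\<close> by (intro above) simp
    also have "\<dots> \<le> c \<bullet> z + t * (v \<bullet> b) + \<epsilon>"
      using \<open>t \<ge> 0\<close> \<open>\<epsilon> > 0\<close> by (simp add: field_simps)
    finally show "d \<le> c \<bullet> z + t * (v \<bullet> b) + \<epsilon>" .
  qed
  have max: "c \<bullet> (s *\<^sub>R x + y) + t * (v \<bullet> y) \<le> c \<bullet> z + t * (v \<bullet> b)" if "x \<in> C" "y \<in> C" for x y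
    using below[OF that \<open>0 \<in> P\<close>] d by simp
  have "t \<noteq> 0"
  proof
    assume "t = 0"
    \<comment> \<open>Then \<open>c\<close> is maximal on \<open>K\<close> at a relative interior point, hence constant on \<open>K\<close>.\<close>
    have le: "c \<bullet> x \<le> c \<bullet> z" if "x \<in> K" for x
      using that max by (auto simp: K_def minkowski_cell_def \<open>t = 0\<close>)
    have const: "c \<bullet> x = c \<bullet> z" if x: "x \<in> K" for x
    proof -
      obtain e where e: "e > 1" "(1 - e) *\<^sub>R x + e *\<^sub>R z \<in> K"
        using convex_rel_interior_iff[OF \<open>convex K\<close>] z x by (auto simp: K_def)
      have "(e - 1) * (c \<bullet> z) \<le> (e - 1) * (c \<bullet> x)"
        using le[OF e(2)] by (simp add: inner_right_distrib algebra_simps)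
      then have "c \<bullet> z \<le> c \<bullet> x" using e(1) by simp
      then show ?thesis using le[OF x] by simp
    qed
    have "c \<bullet> w = 0" if "w \<in> W" for w
    proof -
      have "W \<subseteq> {w. c \<bullet> w = 0}"
        unfolding W_def direction_def
        by (rule span_minimal) (auto simp: subspace_def inner_right_distrib inner_diff_right const)
      then show ?thesis using that by blast
    qed
    then have "c \<in> P" by (simp add: P_def)
    from below[OF a b this] have "c \<bullet> z + c \<bullet> c \<le> d"
      by (simp add: z_eq inner_right_distrib \<open>t = 0\<close>)
    then have "c \<bullet> c \<le> 0" using d by (simp add: \<open>t = 0\<close>)
    then have "c = 0" using inner_ge_zero[of c] by (simp add: order.antisym)
    then show False using ct(1) by (simp add: ct_eq \<open>t = 0\<close> zero_prod_def)
  qed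
  then have "t > 0" using \<open>t \<ge> 0\<close> by simp
  define u where "u = c /\<^sub>R t"
  have "u \<bullet> x \<le> u \<bullet> a" if "x \<in> C" for x
  proof -
    have "s * (c \<bullet> x) \<le> s * (c \<bullet> a)"
      using max[OF that b] by (simp add: z_eq inner_right_distrib)
    then show ?thesis using s \<open>t > 0\<close> by (simp add: u_def divide_right_mono)
  qed
  then have "a \<in> max_face C u" using a by (simp add: max_face_def)
  have "(u + v) \<bullet> y \<le> (u + v) \<bullet> b" if "y \<in> C" for y
  proof -
    have "t * ((u + v) \<bullet> x) = c \<bullet> x + t * (v \<bullet> x)" for x
      using \<open>t > 0\<close> by (simp add: u_def inner_left_distrib distrib_left)
    then have "t * ((u + v) \<bullet> y) \<le> t * ((u + v) \<bullet> b)"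
      using max[OF a that] by (simp add: z_eq inner_right_distrib)
    then show ?thesis using \<open>t > 0\<close> by simp
  qed
  then have "b \<in> max_face C (u + v)" using b by (simp add: max_face_def)
  with \<open>a \<in> max_face C u\<close> have "z \<in> minkowski_cell s (max_face C u) (max_face C (u + v))"
    by (auto simp: z_eq minkowski_cell_def)
  then show ?thesis by blast
qed

text \<open>
  The pairs of faces whose dual cones, the first one translated by \<open>v\<close>, have a point in common.
\<close>

definition compatible_pairs :: "'a::euclidean_space set \<Rightarrow> 'a \<Rightarrow> ('a set \<times> 'a set) set"
  where "compatible_pairs C v = {(F, G). cell_face F C \<and> cell_face G C \<and>
    (\<exists>u. F \<subseteq> max_face C u \<and> G \<subseteq> max_face C (u + v))}"

lemma finite_compatible_pairs:
  assumes "polytope C"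
  shows "finite (compatible_pairs C v)"
proof (rule finite_subset)
  show "compatible_pairs C v \<subseteq> {F. F face_of C} \<times> {F. F face_of C}"
    by (auto simp: compatible_pairs_def cell_face_def)
  show "finite ({F. F face_of C} \<times> {F. F face_of C})"
    using finite_polytope_faces[OF assms] by simp
qed

text \<open>
  The right-hand side is a finite union of compact sets, hence closed. As it contains the relative
  interior of the convex set on the left, it contains that set.
\<close>

lemma minkowski_cell_cover:
  assumes C: "polytope C" and s: "s > 0"
  shows "minkowski_cell s C C = (\<Union>(F, G)\<in>compatible_pairs C v. minkowski_cell s F G)"
    (is "?K = ?U")
proof
  have conv: "convex C" and comp: "compact C"
    using C polytope_imp_convex polytope_imp_compact by auto
  have "rel_interior ?K \<subseteq> ?U"
  proof
    fix z assume "z \<in> rel_interior ?K"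
    then obtain u where u: "z \<in> minkowski_cell s (max_face C u) (max_face C (u + v))"
      using rel_interior_point_maximizers[OF conv comp _ s] by blast
    then have "(max_face C u, max_face C (u + v)) \<in> compatible_pairs C v"
      using max_face_face_of[OF conv] by (auto simp: compatible_pairs_def cell_face_def minkowski_cell_def)
    then show "z \<in> ?U" using u by blast
  qed
  moreover have "closed ?U"
  proof (rule compact_imp_closed, rule compact_UN)
    show "finite (compatible_pairs C v)" by (rule finite_compatible_pairs[OF C])
    show "compact (case FG of (F, G) \<Rightarrow> minkowski_cell s F G)" if "FG \<in> compatible_pairs C v" for FG
      using that face_of_imp_compact[OF conv comp]
      by (auto simp: compatible_pairs_def cell_face_def intro!: compact_minkowski_cell)
  qed
  ultimately have "closure (rel_interior ?K) \<subseteq> ?U"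
    by (rule closure_minimal)
  moreover have "?K = (\<Union>x\<in>(*\<^sub>R) s ` C. \<Union>y\<in>C. {x + y})"
    by (auto simp: minkowski_cell_def)
  then have "convex ?K"
    using convex_sums[OF convex_scaling[OF conv, of s] conv] by simp
  ultimately have "closure ?K \<subseteq> ?U"
    by (simp add: convex_closure_rel_interior)
  then show "?K \<subseteq> ?U" using closure_subset by blast
  show "?U \<subseteq> ?K"
  proof
    fix z assume "z \<in> ?U"
    then obtain F G where FG: "(F, G) \<in> compatible_pairs C v" "z \<in> minkowski_cell s F G"
      by blast
    then have "F \<subseteq> C" "G \<subseteq> C"
      by (auto simp: compatible_pairs_def cell_face_def face_of_imp_subset)
    then show "z \<in> ?K"
      using FG(2) unfolding minkowski_cell_def by blast
  qed
qed

lemma direction_span_translate: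
  assumes "a \<in> S"
  shows "direction S = span ((+) (- a) ` S)"
proof
  show "direction S \<subseteq> span ((+) (- a) ` S)"
    unfolding direction_def
  proof (intro span_minimal subsetI)
    fix d assume "d \<in> {x - y |x y. x \<in> S \<and> y \<in> S}"
    then obtain x y where "x \<in> S" "y \<in> S" "d = (- a + x) - (- a + y)" by auto
    then show "d \<in> span ((+) (- a) ` S)" by (metis image_eqI span_base span_diff)
  qed simp
  show "span ((+) (- a) ` S) \<subseteq> direction S"
    unfolding direction_def using assms by (intro span_mono) force
qed

lemma cell_dim_aff_dim:
  fixes S :: "'a::euclidean_space set"
  assumes "S \<noteq> {}"
  shows "int (cell_dim S) = aff_dim S"
proof -
  obtain a where "a \<in> S" using assms by blast
  then have "cell_dim S = dim ((+) (- a) ` S)"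
    unfolding cell_dim_def direction_span_translate[OF \<open>a \<in> S\<close>] by simp
  then show ?thesis
    using aff_dim_eq_dim[of a S] \<open>a \<in> S\<close> by (simp add: hull_inc)
qed

lemma cell_dim_face_less:
  fixes C :: "'a::euclidean_space set"
  assumes "convex C" "F face_of C" "F \<noteq> {}" "F \<noteq> C"
  shows "cell_dim F < cell_dim C"
proof -
  have "C \<noteq> {}" using assms face_of_imp_subset by fastforce
  then show ?thesis
    using face_of_aff_dim_lt[OF assms(1,2,4)] cell_dim_aff_dim[OF assms(3)] cell_dim_aff_dim[of C]
    by linarith
qed

lemma direction_mono: "S \<subseteq> T \<Longrightarrow> direction S \<subseteq> direction T"
  unfolding direction_def by (intro span_mono) blast

lemma direction_diff: "x \<in> S \<Longrightarrow> y \<in> S \<Longrightarrow> x - y \<in> direction S"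
  unfolding direction_def by (intro span_base) blast

lemma subspace_direction: "subspace (direction S)"
  by (simp add: direction_def)

lemma cell_dim_mono:
  fixes S :: "'a::euclidean_space set"
  shows "S \<subseteq> T \<Longrightarrow> cell_dim S \<le> cell_dim T"
  unfolding cell_dim_def by (intro dim_subset direction_mono)

text \<open>
  The form in which transversality enters the computation of volumes.
\<close>

definition generic_functional :: "'a::euclidean_space set \<Rightarrow> 'a \<Rightarrow> bool"
  where "generic_functional C v \<longleftrightarrow>
    (\<forall>(F, G)\<in>compatible_pairs C v. cell_dim F + cell_dim G \<le> cell_dim C)"

text \<open>
  The pairs that give cells of positive volume.
\<close>

definition full_pairs :: "'a::euclidean_space set \<Rightarrow> 'a \<Rightarrow> ('a set \<times> 'a set) set"
  where "full_pairs C v = {(F, G)\<in>compatible_pairs C v.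
    cell_dim F + cell_dim G = cell_dim C \<and> direction F \<inter> direction G = {0}}"

text \<open>
  The faces of maxima of \<open>u\<close> and \<open>u + v\<close> form a compatible pair themselves. By genericity they are
  not of larger dimension than \<open>F\<close> and \<open>G\<close>, so they are not larger.
\<close>

lemma full_pair_max_faces:
  fixes C :: "'a::euclidean_space set"
  assumes C: "convex C" and v: "generic_functional C v" and FG: "(F, G) \<in> full_pairs C v"
  obtains u where "F = max_face C u" "G = max_face C (u + v)"
proof -
  obtain u where u: "F \<subseteq> max_face C u" "G \<subseteq> max_face C (u + v)"
    using FG by (auto simp: full_pairs_def compatible_pairs_def)
  have F: "F face_of C" "F \<noteq> {}" and G: "G face_of C" "G \<noteq> {}"
    and dims: "cell_dim F + cell_dim G = cell_dim C"
    using FG by (auto simp: full_pairs_def compatible_pairs_def cell_face_def)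
  let ?F = "max_face C u" and ?G = "max_face C (u + v)"
  have faces: "?F face_of C" "?G face_of C" using max_face_face_of[OF C] by auto
  have "(?F, ?G) \<in> compatible_pairs C v"
    using u F G faces by (auto simp: compatible_pairs_def cell_face_def)
  then have le: "cell_dim ?F + cell_dim ?G \<le> cell_dim F + cell_dim G"
    using v dims by (auto simp: generic_functional_def)
  have "F face_of ?F" "G face_of ?G"
    using F G u face_of_imp_subset[OF faces(1)] face_of_imp_subset[OF faces(2)]
    by (auto intro: face_of_subset)
  then have "F = ?F" "G = ?G"
    using le F(2) G(2) cell_dim_face_less[of ?F F] cell_dim_face_less[of ?G G]
      cell_dim_mono[OF u(1)] cell_dim_mono[OF u(2)]
      face_of_imp_convex[OF faces(1)] face_of_imp_convex[OF faces(2)]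
    by fastforce+
  then show thesis by (rule that)
qed

text \<open>
  Of all decompositions \<open>z = s x + y\<close>, those with \<open>x \<in> F\<close> and \<open>y \<in> G\<close> are the ones that maximize
  \<open>s (u \<bullet> x) + (u + v) \<bullet> y = u \<bullet> z + v \<bullet> y\<close>, that is, \<open>v \<bullet> y\<close>. This does not involve \<open>u\<close>, so the
  decompositions in \<open>F'\<close> and \<open>G'\<close> are the same ones, and there is only one since the directions of
  \<open>F\<close> and \<open>G\<close> are independent.
\<close>

lemma full_pairs_overlap:
  fixes C :: "'a::euclidean_space set"
  assumes C: "convex C" and v: "generic_functional C v" and s: "s > 0"
    and FG: "(F, G) \<in> full_pairs C v" and FG': "(F', G') \<in> full_pairs C v"
  shows "minkowski_cell s F G \<inter> minkowski_cell s F' G' \<subseteq> minkowski_cell s (F \<inter> F') (G \<inter> G')"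
proof
  fix z assume "z \<in> minkowski_cell s F G \<inter> minkowski_cell s F' G'"
  then obtain x y x' y' where xy: "x \<in> F" "y \<in> G" "z = s *\<^sub>R x + y"
    and xy': "x' \<in> F'" "y' \<in> G'" "z = s *\<^sub>R x' + y'"
    by (auto simp: minkowski_cell_def)
  obtain u where u: "F = max_face C u" "G = max_face C (u + v)"
    using full_pair_max_faces[OF C v FG] .
  obtain u' where u': "F' = max_face C u'" "G' = max_face C (u' + v)"
    using full_pair_max_faces[OF C v FG'] .
  have inC: "x \<in> C" "y \<in> C" "x' \<in> C" "y' \<in> C"
    using xy xy' u u' by (auto simp: max_face_def)
  have val: "s * (w \<bullet> x) + (w + v) \<bullet> y - (s * (w \<bullet> x') + (w + v) \<bullet> y') = v \<bullet> y - v \<bullet> y'" for w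
  proof -
    have "w \<bullet> (s *\<^sub>R x + y) = w \<bullet> (s *\<^sub>R x' + y')" using xy xy' by simp
    then show ?thesis by (simp add: inner_right_distrib inner_left_distrib)
  qed
  have ge: "s * (u \<bullet> x') \<le> s * (u \<bullet> x)" "(u + v) \<bullet> y' \<le> (u + v) \<bullet> y"
    using xy u inC s by (auto simp: max_face_def)
  have ge': "s * (u' \<bullet> x) \<le> s * (u' \<bullet> x')" "(u' + v) \<bullet> y \<le> (u' + v) \<bullet> y'"
    using xy' u' inC s by (auto simp: max_face_def)
  have "s * (u \<bullet> x') = s * (u \<bullet> x)" "(u + v) \<bullet> y' = (u + v) \<bullet> y"
    using ge ge' val[of u] val[of u'] by linarith+
  then have "x' \<in> F" "y' \<in> G"
    using xy u inC s by (auto simp: max_face_def)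
  then have "x - x' \<in> direction F" "y' - y \<in> direction G"
    using xy by (auto intro: direction_diff)
  moreover have "y' - y = s *\<^sub>R (x - x')"
    using xy xy' by (simp add: algebra_simps)
  ultimately have "s *\<^sub>R (x - x') \<in> direction F \<inter> direction G"
    using subspace_scale[OF subspace_direction] by auto
  moreover have "direction F \<inter> direction G = {0}"
    using FG by (simp add: full_pairs_def)
  ultimately have "s *\<^sub>R (x - x') = 0"
    by blast
  then have "x = x'" "y = y'"
    using s xy xy' by auto
  then show "z \<in> minkowski_cell s (F \<inter> F') (G \<inter> G')"
    using xy xy' by (auto simp: minkowski_cell_def)
qed

text \<open>
  The cell lies in a hyperplane, with a normal vector orthogonal to the directions of both faces.
\<close>

lemma chart_volume_minkowski_cell_null:
  fixes F G :: "'a::euclidean_space set"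
  assumes e: "basis_of W e" and FG: "direction F \<subseteq> W" "direction G \<subseteq> W"
    and dim: "dim {x + y |x y. x \<in> direction F \<and> y \<in> direction G} < dim W"
  shows "chart_volume a e (minkowski_cell s F G) = 0"
proof (cases "F = {} \<or> G = {}")
  case True
  then show ?thesis by (auto simp: chart_volume_def chart_set_def minkowski_cell_def)
next
  case False
  then obtain x0 y0 where x0: "x0 \<in> F" and y0: "y0 \<in> G" by blast
  let ?U = "direction F \<union> direction G"
  have W: "span W = W" using e by (auto simp: basis_of_def)
  have span_U: "span ?U = {x + y |x y. x \<in> direction F \<and> y \<in> direction G}"
    unfolding span_Un by (simp only: direction_def span_span)
  have "dim (span ?U) < dim (span W)"
    using dim by (simp only: span_U W)
  moreover have "span ?U \<subseteq> span W"
    using FG by (intro span_mono) simp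
  ultimately have "span ?U \<subset> span W"
    by (metis less_irrefl psubsetI)
  then obtain c where c: "c \<noteq> 0" "c \<in> W" "\<And>y. y \<in> span ?U \<Longrightarrow> c \<bullet> y = 0"
    using orthogonal_to_subspace_exists_gen[of ?U W] by (auto simp: orthogonal_def W)
  have "\<exists>i<length e. c \<bullet> e ! i \<noteq> 0"
  proof (rule ccontr)
    assume "\<not> ?thesis"
    then have "set e \<subseteq> {x. c \<bullet> x = 0}" by (auto simp: in_set_conv_nth)
    then have "span (set e) \<subseteq> {x. c \<bullet> x = 0}"
      by (intro span_minimal subspace_hyperplane)
    then show False using c e by (auto simp: basis_of_def)
  qed
  then obtain i where i: "i < length e" "c \<bullet> e ! i \<noteq> 0" by blast
  define d where "d = s * (c \<bullet> x0) + c \<bullet> y0"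
  have "c \<bullet> x = c \<bullet> x0" if "x \<in> F" for x
    using c(3)[of "x - x0"] direction_diff[OF that x0] by (simp add: span_base inner_diff_right)
  moreover have "c \<bullet> y = c \<bullet> y0" if "y \<in> G" for y
    using c(3)[of "y - y0"] direction_diff[OF that y0] by (simp add: span_base inner_diff_right)
  ultimately have "minkowski_cell s F G \<subseteq> {x. c \<bullet> x = d}"
    by (auto simp: minkowski_cell_def d_def inner_right_distrib)
  then have "chart_set a e (minkowski_cell s F G) \<subseteq> chart_set a e {x. c \<bullet> x = d}"
    by (auto simp: chart_set_def)
  then have "chart_volume a e (minkowski_cell s F G) \<le> chart_volume a e {x. c \<bullet> x = d}"
    unfolding chart_volume_def
    by (intro emeasure_mono chart_set_sets borel_closed closed_hyperplane)
  then show ?thesis by (simp add: chart_volume_hyperplane[OF i])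
qed

lemma emeasure_UN_null_overlaps:
  assumes "finite I" and A: "\<And>i. i \<in> I \<Longrightarrow> A i \<in> sets M"
    and null: "\<And>i j. i \<in> I \<Longrightarrow> j \<in> I \<Longrightarrow> i \<noteq> j \<Longrightarrow> emeasure M (A i \<inter> A j) = 0"
  shows "emeasure M (\<Union>i\<in>I. A i) = (\<Sum>i\<in>I. emeasure M (A i))"
  using assms
proof (induction I rule: finite_induct)
  case (insert k I)
  let ?B = "\<Union>i\<in>I. A i"
  have sets: "?B \<in> sets M" "A k \<in> sets M" using insert by auto
  have "(\<Union>i\<in>I. A k \<inter> A i) \<in> null_sets M"
    using insert by (intro null_sets.finite_UN null_setsI) auto
  then have "A k \<inter> ?B \<in> null_sets M" by (simp only: Int_UN_distrib)
  then have "emeasure M (A k) = emeasure M (A k - A k \<inter> ?B)"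
    using sets by (intro emeasure_Diff_null_set[symmetric])
  also have "\<dots> + emeasure M ?B = emeasure M ((A k - A k \<inter> ?B) \<union> ?B)"
    using sets by (intro plus_emeasure) auto
  also have "(A k - A k \<inter> ?B) \<union> ?B = (\<Union>i\<in>insert k I. A i)" by auto
  finally show ?case using insert by simp
qed simp

lemma chart_volume_dilated_polytope:
  fixes C :: "'a::euclidean_space set"
  assumes C: "polytope C" and v: "generic_functional C v" and s: "s > 0"
    and e: "basis_of (direction C) e"
  shows "chart_volume a e (minkowski_cell s C C) =
    (\<Sum>(F, G)\<in>full_pairs C v. chart_volume a e (minkowski_cell s F G))"
proof -
  let ?M = "Pi\<^sub>M {..<length e} (\<lambda>_. lborel :: real measure)"
  let ?S = "\<lambda>(F, G). chart_set a e (minkowski_cell s F G)"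
  have conv: "convex C" and comp: "compact C"
    using C polytope_imp_convex polytope_imp_compact by auto
  have fin: "finite (compatible_pairs C v)" by (rule finite_compatible_pairs[OF C])
  have sub: "full_pairs C v \<subseteq> compatible_pairs C v" by (auto simp: full_pairs_def)
  have meas: "chart_set a e (minkowski_cell s F G) \<in> sets ?M" if "F face_of C" "G face_of C" for F G
    using face_of_imp_compact[OF conv comp] that
    by (intro chart_set_sets borel_closed compact_imp_closed compact_minkowski_cell) auto
  have faces: "F face_of C" "G face_of C" "F \<noteq> {}" "G \<noteq> {}" if "(F, G) \<in> compatible_pairs C v" for F G
    using that by (auto simp: compatible_pairs_def cell_face_def)
  have null: "chart_volume a e (minkowski_cell s F G) = 0"
    if "F face_of C" "G face_of C"
      and "cell_dim F + cell_dim G < cell_dim C \<or>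
        cell_dim F + cell_dim G = cell_dim C \<and> direction F \<inter> direction G \<noteq> {0}" for F G
  proof (rule chart_volume_minkowski_cell_null[OF e])
    show "direction F \<subseteq> direction C" "direction G \<subseteq> direction C"
      using that by (simp_all add: direction_mono face_of_imp_subset)
    have "dim {x + y |x y. x \<in> direction F \<and> y \<in> direction G} + dim (direction F \<inter> direction G) =
        cell_dim F + cell_dim G"
      unfolding cell_dim_def by (intro dim_sums_Int subspace_direction)
    moreover have "dim (direction F \<inter> direction G) > 0" if "direction F \<inter> direction G \<noteq> {0}"
      using that subspace_0[OF subspace_direction[of F]] subspace_0[OF subspace_direction[of G]]
      by (intro gr0I) (auto simp: dim_eq_0)
    then have "cell_dim F + cell_dim G < cell_dim C \<or>
        cell_dim F + cell_dim G = cell_dim C \<and> dim (direction F \<inter> direction G) > 0"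
      using that(3) by blast
    ultimately show "dim {x + y |x y. x \<in> direction F \<and> y \<in> direction G} < dim (direction C)"
      unfolding cell_dim_def[of C] by linarith
  qed
  have "chart_set a e (minkowski_cell s C C) = (\<Union>FG\<in>compatible_pairs C v. ?S FG)"
    by (subst minkowski_cell_cover[OF C s, of v]) (auto simp: chart_set_def)
  also have "\<dots> = (\<Union>FG\<in>full_pairs C v. ?S FG) \<union> (\<Union>FG\<in>compatible_pairs C v - full_pairs C v. ?S FG)"
    using sub by auto
  also have "emeasure ?M \<dots> = emeasure ?M (\<Union>FG\<in>full_pairs C v. ?S FG)"
  proof (rule emeasure_Un_null_set)
    show "(\<Union>FG\<in>full_pairs C v. ?S FG) \<in> sets ?M"
      using fin sub finite_subset meas faces by (intro sets.finite_UN) auto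
    have "?S (F, G) \<in> null_sets ?M" if "(F, G) \<in> compatible_pairs C v - full_pairs C v" for F G
    proof (rule null_setsI)
      have "cell_dim F + cell_dim G \<le> cell_dim C"
        using v that by (auto simp: generic_functional_def)
      moreover have "\<not> (cell_dim F + cell_dim G = cell_dim C \<and> direction F \<inter> direction G = {0})"
        using that by (simp add: full_pairs_def)
      ultimately have "cell_dim F + cell_dim G < cell_dim C \<or>
          cell_dim F + cell_dim G = cell_dim C \<and> direction F \<inter> direction G \<noteq> {0}"
        by (meson le_neq_implies_less)
      then have "chart_volume a e (minkowski_cell s F G) = 0"
        using that faces by (intro null) auto
      then show "emeasure ?M (?S (F, G)) = 0" by (simp add: chart_volume_def)
      show "?S (F, G) \<in> sets ?M" using that meas faces by auto
    qed
    then show "(\<Union>FG\<in>compatible_pairs C v - full_pairs C v. ?S FG) \<in> null_sets ?M"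
      using fin by (intro null_sets.finite_UN) auto
  qed
  also have "\<dots> = (\<Sum>FG\<in>full_pairs C v. emeasure ?M (?S FG))"
  proof (rule emeasure_UN_null_overlaps)
    show "finite (full_pairs C v)" using fin sub finite_subset by blast
    show "?S FG \<in> sets ?M" if "FG \<in> full_pairs C v" for FG
      using that sub meas faces by (cases FG) auto
    show "emeasure ?M (?S FG \<inter> ?S FG') = 0"
      if "FG \<in> full_pairs C v" "FG' \<in> full_pairs C v" "FG \<noteq> FG'" for FG FG'
    proof -
      obtain F G F' G' where eq: "FG = (F, G)" "FG' = (F', G')" by (cases FG, cases FG')
      have FG: "(F, G) \<in> full_pairs C v" and FG': "(F', G') \<in> full_pairs C v"
        using that eq by auto
      note f = faces[OF subsetD[OF sub FG]] and f' = faces[OF subsetD[OF sub FG']]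
      have cap: "?S FG \<inter> ?S FG' \<subseteq> chart_set a e (minkowski_cell s (F \<inter> F') (G \<inter> G'))"
        using full_pairs_overlap[OF conv v s FG FG'] by (auto simp: eq chart_set_def)
      have int: "F \<inter> F' face_of C" "G \<inter> G' face_of C"
        using f f' by (auto intro: face_of_Int)
      have "chart_volume a e (minkowski_cell s (F \<inter> F') (G \<inter> G')) = 0"
      proof (cases "F \<inter> F' = {} \<or> G \<inter> G' = {}")
        case True
        then have "minkowski_cell s (F \<inter> F') (G \<inter> G') = {}"
          unfolding minkowski_cell_def by blast
        then show ?thesis by (simp add: chart_volume_def chart_set_def)
      next
        case False
        have less: "cell_dim (F \<inter> F') + cell_dim (G \<inter> G') < cell_dim F0 + cell_dim G0"
          if "F0 face_of C" "G0 face_of C" "F \<inter> F' \<subseteq> F0" "G \<inter> G' \<subseteq> G0" "(F \<inter> F', G \<inter> G') \<noteq> (F0, G0)" for F0 G0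
        proof -
          have "F \<inter> F' face_of F0" "G \<inter> G' face_of G0"
            using face_of_subset[OF int(1) that(3) face_of_imp_subset[OF that(1)]]
              face_of_subset[OF int(2) that(4) face_of_imp_subset[OF that(2)]] by simp_all
          then have "F \<inter> F' \<noteq> F0 \<Longrightarrow> cell_dim (F \<inter> F') < cell_dim F0"
            and "G \<inter> G' \<noteq> G0 \<Longrightarrow> cell_dim (G \<inter> G') < cell_dim G0"
            using cell_dim_face_less[of F0 "F \<inter> F'"] cell_dim_face_less[of G0 "G \<inter> G'"] False
              face_of_imp_convex[OF that(1)] face_of_imp_convex[OF that(2)] by auto
          then show ?thesis
            using that cell_dim_mono[OF that(3)] cell_dim_mono[OF that(4)] by fastforce
        qed
        have "(F \<inter> F', G \<inter> G') \<noteq> (F, G) \<or> (F \<inter> F', G \<inter> G') \<noteq> (F', G')"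
          using that(3) eq by auto
        then have "cell_dim (F \<inter> F') + cell_dim (G \<inter> G') < cell_dim C"
          using less[of F G] less[of F' G'] f f' FG FG' by (auto simp: full_pairs_def)
        then show ?thesis using null int by blast
      qed
      then show ?thesis
        unfolding chart_volume_def by (rule emeasure_eq_0[OF meas[OF int] _ cap])
    qed
  qed
  finally show ?thesis by (simp add: chart_volume_def case_prod_unfold)
qed

section \<open>Convenient functionals are generic\<close>

lemma dual_space_eq_riesz:
  fixes W :: "'a::euclidean_space set"
  assumes W: "subspace W"
  shows "dual_space W = (\<lambda>x. dual_restrict W ((\<bullet>) x)) ` W"
proof
  show "(\<lambda>x. dual_restrict W ((\<bullet>) x)) ` W \<subseteq> dual_space W"
    using W by (auto simp: dual_space_def dual_restrict_def subspace_add subspace_scale inner_right_distrib)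
  show "dual_space W \<subseteq> (\<lambda>x. dual_restrict W ((\<bullet>) x)) ` W"
  proof
    fix w assume w: "w \<in> dual_space W"
    obtain B where B: "B \<subseteq> W" "independent B" "span B = W"
      using W by (metis basis_exists span_subspace)
    obtain g where g: "linear g" "\<And>x. x \<in> B \<Longrightarrow> g x = w x"
      using linear_independent_extend[OF B(2), of w] by blast
    have "y \<in> W \<and> w y = g y" if "y \<in> span B" for y
      using that
    proof (induction rule: span_induct_alt)
      case base
      have "w (0 *\<^sub>R 0) = 0 * w 0"
        using w subspace_0[OF W] unfolding dual_space_def by blast
      then show ?case using subspace_0[OF W] by (simp add: linear_0[OF g(1)])
    next
      case (step c x y)
      then have xy: "x \<in> W" "y \<in> W" using B by auto
      then have cx: "c *\<^sub>R x \<in> W" by (simp add: subspace_scale[OF W])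
      have "w (c *\<^sub>R x + y) = w (c *\<^sub>R x) + w y"
        using w cx xy(2) unfolding dual_space_def by blast
      moreover have "w (c *\<^sub>R x) = c * w x"
        using w xy(1) unfolding dual_space_def by blast
      ultimately show ?case
        using step g cx xy by (simp add: linear_add linear_scale subspace_add[OF W])
    qed
    then have "w y = g y" if "y \<in> W" for y
      using that B(3) by simp
    moreover have "g y = adjoint g 1 \<bullet> y" for y
      using adjoint_works[OF g(1), of y 1] by (simp add: inner_commute)
    moreover obtain x p where xp: "x \<in> W" "\<And>y. y \<in> W \<Longrightarrow> orthogonal p y" "adjoint g 1 = x + p"
      using orthogonal_subspace_decomp_exists[of W "adjoint g 1"] W by (metis span_eq_iff)
    ultimately have "w = dual_restrict W ((\<bullet>) x)"
      using w by (auto simp: fun_eq_iff dual_restrict_def dual_space_def inner_left_distrib orthogonal_def)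
    then show "w \<in> (\<lambda>x. dual_restrict W ((\<bullet>) x)) ` W"
      using xp(1) by blast
  qed
qed

lemma linear_riesz:
  fixes W :: "'a::euclidean_space set"
  shows "linear (\<lambda>x. dual_restrict W ((\<bullet>) x))"
  by (rule linearI) (auto simp: dual_restrict_def fun_eq_iff scaleR_fun_def plus_fun_def inner_left_distrib)

lemma inj_on_riesz:
  fixes W :: "'a::euclidean_space set"
  assumes "subspace W"
  shows "inj_on (\<lambda>x. dual_restrict W ((\<bullet>) x)) W"
proof (rule inj_onI)
  fix x y assume xy: "x \<in> W" "y \<in> W" "dual_restrict W ((\<bullet>) x) = dual_restrict W ((\<bullet>) y)"
  then have "x - y \<in> W" by (simp add: subspace_diff[OF assms])
  then have "x \<bullet> (x - y) = y \<bullet> (x - y)"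
    using fun_cong[OF xy(3), of "x - y"] by (simp add: dual_restrict_def)
  then have "(x - y) \<bullet> (x - y) = 0" by (simp add: inner_diff_left)
  then show "x = y" by simp
qed

text \<open>
  Dimensions in the infinite-dimensional space of all functions reduce in this way to dimensions in
  the Euclidean space.
\<close>

lemma dim_riesz_image:
  fixes W :: "'a::euclidean_space set"
  assumes W: "subspace W" and S: "subspace S" "S \<subseteq> W"
  shows "dim ((\<lambda>x. dual_restrict W ((\<bullet>) x)) ` S) = dim S"
proof -
  let ?R = "\<lambda>x. dual_restrict W ((\<bullet>) x)"
  obtain B where B: "B \<subseteq> S" "independent B" "span B = S" "card B = dim S"
    using S(1) by (metis basis_exists span_subspace)
  have inj: "inj_on ?R S" using inj_on_riesz[OF W] S(2) by (rule inj_on_subset)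
  have "span (?R ` B) = span (?R ` S)"
    using B(3) linear_span_image[OF linear_riesz, of W] S(1) by (metis span_span)
  moreover have "independent (?R ` B)"
    using linear_independent_injective_image[OF linear_riesz B(2)] inj B(3) by simp
  ultimately have "dim (?R ` S) = card (?R ` B)"
    by (rule real_vector.dim_eq_card)
  also have "\<dots> = dim S"
    using B card_image[OF inj_on_subset[OF inj B(1)]] by simp
  finally show ?thesis .
qed

text \<open>
  A functional in the dual cone is constant on \<open>F\<close>, so that its Riesz vector is orthogonal to the
  direction of \<open>F\<close>.
\<close>

lemma dim_dual_cone:
  fixes C :: "'a::euclidean_space set"
  assumes "cell_face F C"
  shows "cell_dim (dual_cone C F) + cell_dim F \<le> cell_dim C"
proof -
  let ?W = "direction C"
  let ?R = "\<lambda>x. dual_restrict ?W ((\<bullet>) x)"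
  have F: "F \<subseteq> C" using assms by (auto simp: cell_face_def face_of_imp_subset)
  have W: "subspace ?W" by (rule subspace_direction)
  define S where "S = {x \<in> ?W. \<forall>y\<in>direction F. orthogonal y x}"
  have S: "subspace S"
    using W by (auto simp: S_def subspace_def orthogonal_def inner_right_distrib)
  have "dual_cone C F \<subseteq> ?R ` S"
  proof
    fix w assume w: "w \<in> dual_cone C F"
    then obtain x where x: "x \<in> ?W" "w = ?R x"
      using dual_space_eq_riesz[OF W] by (auto simp: dual_cone_def)
    have const: "x \<bullet> y = x \<bullet> z" if "y \<in> F" "z \<in> F" for y z
    proof (rule antisym)
      have max: "w (b - c) \<le> w (a - c)" if "a \<in> F" "b \<in> C" "c \<in> C" for a b c
        using w that unfolding dual_cone_def by blast
      have "w (y - y) \<le> w (z - y)" "w (z - y) \<le> w (y - y)"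
        using max[of z y y] max[of y z y] that subsetD[OF F] by simp_all
      moreover have "z - y \<in> ?W" "y - y \<in> ?W" using that F subspace_0[OF W] by (auto intro: direction_diff)
      ultimately show "x \<bullet> y \<le> x \<bullet> z" "x \<bullet> z \<le> x \<bullet> y"
        by (simp_all add: x(2) dual_restrict_def inner_diff_right)
    qed
    have "x \<bullet> (y - z) = 0" if "y \<in> F" "z \<in> F" for y z
      using const[OF that] by (simp add: inner_diff_right)
    then have "{y - z |y z. y \<in> F \<and> z \<in> F} \<subseteq> {y. x \<bullet> y = 0}"
      by blast
    then have "direction F \<subseteq> {y. x \<bullet> y = 0}"
      unfolding direction_def by (intro span_minimal subspace_hyperplane)
    then have "x \<in> S" using x(1) by (auto simp: S_def orthogonal_def inner_commute)
    then show "w \<in> ?R ` S" using x(2) by blast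
  qed
  then have sub: "direction (dual_cone C F) \<subseteq> ?R ` S"
    unfolding direction_def
    by (intro span_minimal linear_subspace_image[OF linear_riesz S])
      (auto intro!: subspace_diff[OF linear_subspace_image[OF linear_riesz S]])
  define S' where "S' = S \<inter> ?R -` direction (dual_cone C F)"
  have S': "subspace S'"
    unfolding S'_def by (intro subspace_inter S linear_subspace_vimage[OF linear_riesz] subspace_direction)
  have "direction (dual_cone C F) = ?R ` S'"
    using sub by (auto simp: S'_def)
  moreover have "S' \<subseteq> ?W" by (auto simp: S'_def S_def)
  ultimately have "cell_dim (dual_cone C F) = dim S'"
    using dim_riesz_image[OF W S'] by (simp add: cell_dim_def)
  also have "\<dots> \<le> dim S" by (intro dim_subset) (auto simp: S'_def)
  also have "dim S + cell_dim F = cell_dim C"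
    unfolding S_def cell_dim_def
    by (intro dim_subspace_orthogonal_to_vectors subspace_direction direction_mono F)
  finally show ?thesis by simp
qed

lemma riesz_in_dual_cone_iff:
  fixes C :: "'a::euclidean_space set"
  assumes "F \<subseteq> C"
  shows "dual_restrict (direction C) ((\<bullet>) u) \<in> dual_cone C F \<longleftrightarrow> F \<subseteq> max_face C u"
proof -
  have "dual_restrict (direction C) ((\<bullet>) u) \<in> dual_space (direction C)"
    using subspace_direction[of C]
    by (auto simp: dual_space_def dual_restrict_def subspace_add subspace_scale inner_right_distrib)
  moreover have "dual_restrict (direction C) ((\<bullet>) u) (x - z) = u \<bullet> x - u \<bullet> z" if "x \<in> C" "z \<in> C" for x z
    using direction_diff[OF that] by (simp add: dual_restrict_def inner_diff_right)
  ultimately show ?thesis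
    using assms unfolding dual_cone_def max_face_def by (auto simp: subset_iff)
qed

lemma dual_cones_meet_iff:
  fixes C :: "'a::euclidean_space set"
  assumes F: "F \<subseteq> C" and G: "G \<subseteq> C"
  shows "(+) (dual_restrict (direction C) ((\<bullet>) v)) ` dual_cone C F \<inter> dual_cone C G \<noteq> {} \<longleftrightarrow>
    (\<exists>u. F \<subseteq> max_face C u \<and> G \<subseteq> max_face C (u + v))" (is "?L \<longleftrightarrow> ?R")
proof -
  let ?D = "\<lambda>u. dual_restrict (direction C) ((\<bullet>) u)"
  have sum: "?D v + ?D u = ?D (u + v)" for u
    using linear_add[OF linear_riesz, of "direction C" u v] by (simp add: add.commute)
  show ?thesis
  proof
    assume ?L
    then obtain w where w: "w \<in> dual_cone C F" "?D v + w \<in> dual_cone C G" by auto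
    then obtain u where "w = ?D u"
      using dual_space_eq_riesz[OF subspace_direction, of C] by (auto simp: dual_cone_def)
    then show ?R
      using w riesz_in_dual_cone_iff[OF F] riesz_in_dual_cone_iff[OF G] by (auto simp: sum)
  next
    assume ?R
    then obtain u where "F \<subseteq> max_face C u" "G \<subseteq> max_face C (u + v)" by blast
    then have "?D u \<in> dual_cone C F" "?D v + ?D u \<in> dual_cone C G"
      using riesz_in_dual_cone_iff[OF F] riesz_in_dual_cone_iff[OF G] by (auto simp: sum)
    then show ?L by blast
  qed
qed

lemma direction_translate: "direction ((+) c ` S) = direction S"
proof -
  have "{x - y |x y. x \<in> (+) c ` S \<and> y \<in> (+) c ` S} = {x - y |x y. x \<in> S \<and> y \<in> S}"
  proof
    show "{x - y |x y. x \<in> S \<and> y \<in> S} \<subseteq> {x - y |x y. x \<in> (+) c ` S \<and> y \<in> (+) c ` S}"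
    proof
      fix d assume "d \<in> {x - y |x y. x \<in> S \<and> y \<in> S}"
      then obtain x y where "x \<in> S" "y \<in> S" "d = (c + x) - (c + y)" by auto
      then show "d \<in> {x - y |x y. x \<in> (+) c ` S \<and> y \<in> (+) c ` S}" by blast
    qed
  qed (auto; blast)
  then show ?thesis by (simp add: direction_def)
qed

text \<open>
  If \<open>dim F + dim G\<close> were greater than \<open>dim C\<close>, the codimensions of the dual cones, which are at
  least \<open>dim F\<close> and \<open>dim G\<close>, would add up to more than \<open>dim C\<close>. By transversality their sum is a
  codimension in a space of dimension \<open>dim C\<close>.
\<close>

lemma convenient_imp_generic:
  fixes X :: "'a::euclidean_space set set"
  assumes v: "(\<bullet>) v \<in> convenient X" and C: "C \<in> X"
  shows "generic_functional C v"
  unfolding generic_functional_def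
proof (clarify, rule ccontr)
  fix F G assume FG: "(F, G) \<in> compatible_pairs C v" and gt: "\<not> cell_dim F + cell_dim G \<le> cell_dim C"
  have faces: "cell_face F C" "cell_face G C" and subs: "F \<subseteq> C" "G \<subseteq> C"
    using FG by (auto simp: compatible_pairs_def cell_face_def face_of_imp_subset)
  have dF: "cell_dim F \<le> cell_dim C" using subs cell_dim_mono by blast
  let ?E = "dual_space (direction C)"
  let ?T = "(+) (dual_restrict (direction C) ((\<bullet>) v))"
  have "(\<bullet>) v \<in> convenient_pq (cell_dim F) (cell_dim C - cell_dim F) X"
    using v by (simp add: convenient_def)
  then have trans: "transversal ?E ((`) ?T ` dual_skeleton C (cell_dim C - cell_dim F))
      (dual_skeleton C (cell_dim F))"
    using C dF by (simp add: convenient_pq_def)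
  \<comment> \<open>The degrees \<open>dim F\<close> and \<open>dim C - dim F\<close> fit both cones into the skeletons: under the
    assumption to be refuted, \<open>G\<^sup>*\<close> has dimension less than \<open>dim F\<close>.\<close>
  have "dual_cone C F \<in> dual_skeleton C (cell_dim C - cell_dim F)"
    using faces dim_dual_cone[OF faces(1)] by (auto simp: dual_skeleton_def dual_fan_def)
  then have mem_F: "?T ` dual_cone C F \<in> (`) ?T ` dual_skeleton C (cell_dim C - cell_dim F)"
    by (rule imageI)
  have mem_G: "dual_cone C G \<in> dual_skeleton C (cell_dim F)"
    using faces gt dim_dual_cone[OF faces(2)] by (auto simp: dual_skeleton_def dual_fan_def)
  have meet: "?T ` dual_cone C F \<inter> dual_cone C G \<noteq> {}"
    using dual_cones_meet_iff[OF subs] FG by (auto simp: compatible_pairs_def)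
  have "codim_in ?E (direction (?T ` dual_cone C F) \<inter> direction (dual_cone C G)) =
      codim_in ?E (direction (?T ` dual_cone C F)) + codim_in ?E (direction (dual_cone C G))"
    by (rule trans[unfolded transversal_def, rule_format, OF mem_F mem_G meet])
  then have "codim_in ?E (direction (dual_cone C F)) + codim_in ?E (direction (dual_cone C G)) \<le> dim ?E"
    by (simp add: codim_in_def direction_translate)
  moreover have "dim ?E = cell_dim C"
    unfolding dual_space_eq_riesz[OF subspace_direction] cell_dim_def
    by (rule dim_riesz_image[OF subspace_direction subspace_direction order_refl])
  ultimately show False
    using gt dim_dual_cone[OF faces(1)] dim_dual_cone[OF faces(2)]
    by (simp add: codim_in_def cell_dim_def)
qed

section \<open>Mixed volumes\<close>

lemma chart_volume_minkowski_cell: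
  fixes F G :: "'a::euclidean_space set"
  assumes F: "compact F" "a \<in> affine hull F" "basis_of (direction F) f"
    and G: "compact G" "b \<in> affine hull G" "basis_of (direction G) g"
    and direct: "direction F \<inter> direction G = {0}" and d: "basis_change e (f @ g) d" and s: "s > 0"
  shows "chart_volume (s *\<^sub>R a + b) e (minkowski_cell s F G) =
    ennreal (\<bar>d\<bar> * s ^ length f) * (chart_volume a f F * chart_volume b g G)"
proof -
  let ?sf = "map ((*\<^sub>R) s) f" and ?sF = "(*\<^sub>R) s ` F"
  have K: "minkowski_cell s F G = {x + y |x y. x \<in> ?sF \<and> y \<in> G}"
    by (auto simp: minkowski_cell_def)
  have K_borel: "minkowski_cell s F G \<in> sets borel"
    using compact_minkowski_cell[OF F(1) G(1)] by (intro borel_closed compact_imp_closed)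
  have sf: "basis_change (f @ g) (?sf @ g) (s ^ length f)" "basis_change f ?sf (s ^ length f)"
    using basis_change_dilate_prefix[of s f g] basis_change_dilate_prefix[of s f "[]"] s by auto
  have span_F: "span (set f) = direction F" and span_G: "span (set g) = direction G"
    using F(3) G(3) by (auto simp: basis_of_def)
  have diff: "x - c \<in> direction S" if "x \<in> S" "c \<in> affine hull S" for x c and S :: "'a set"
    using direction_diff[of x "affine hull S" c] that hull_subset[of S affine]
    by (auto simp: direction_affine_hull)
  have span_sf: "span (set ?sf) = direction F"
    using basis_change_span[OF sf(2)] span_F by simp
  have "chart_volume (s *\<^sub>R a + b) (?sf @ g) (minkowski_cell s F G) =
      chart_volume (s *\<^sub>R a) ?sf ?sF * chart_volume b g G"
    unfolding K
  proof (rule chart_volume_sum)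
    show "?sF \<in> sets borel" "G \<in> sets borel"
      using F(1) G(1) by (auto intro!: borel_closed compact_imp_closed compact_scaling)
    show "x - s *\<^sub>R a \<in> span (set ?sf)" if "x \<in> ?sF" for x
      unfolding span_sf using that diff[OF _ F(2)] subspace_scale[OF subspace_direction[of F]]
      by (auto simp flip: scaleR_right_diff_distrib)
    show "y - b \<in> span (set g)" if "y \<in> G" for y
      using diff[OF that G(2)] by (simp add: span_G)
    show "{x + y |x y. x \<in> ?sF \<and> y \<in> G} \<in> sets borel"
      using K_borel by (simp add: K)
    show "span (set ?sf) \<inter> span (set g) = {0}"
      unfolding span_sf span_G by (rule direct)
  qed
  also have "chart_volume (s *\<^sub>R a) ?sf ?sF = chart_volume a f F"
    using s by (intro chart_volume_dilate) simp
  finally show ?thesis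
    using s
    by (simp add: chart_volume_basis_change[OF d K_borel] chart_volume_basis_change[OF sf(1) K_borel]
        ennreal_mult mult.assoc)
qed

lemma minkowski_cell_self:
  assumes "convex C" "s > 0"
  shows "minkowski_cell s C C = minkowski_cell (s + 1) C {0}"
proof
  show "minkowski_cell s C C \<subseteq> minkowski_cell (s + 1) C {0}"
  proof
    fix z assume "z \<in> minkowski_cell s C C"
    then obtain x y where xy: "x \<in> C" "y \<in> C" "z = s *\<^sub>R x + y" by (auto simp: minkowski_cell_def)
    define w where "w = (s / (s + 1)) *\<^sub>R x + (1 / (s + 1)) *\<^sub>R y"
    have "w \<in> C"
      unfolding w_def using assms xy by (intro convexD) (auto simp: field_simps)
    moreover have "z = (s + 1) *\<^sub>R w + 0"
      using assms(2) by (simp add: w_def xy scaleR_right_distrib)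
    ultimately show "z \<in> minkowski_cell (s + 1) C {0}"
      unfolding minkowski_cell_def by blast
  qed
  show "minkowski_cell (s + 1) C {0} \<subseteq> minkowski_cell s C C"
    by (auto simp: minkowski_cell_def scaleR_left_distrib)
qed

lemma polynomial_coeffs_eq:
  fixes c d :: "nat \<Rightarrow> real"
  assumes "\<And>s. s > 0 \<Longrightarrow> (\<Sum>i\<le>n. c i * s ^ i) = (\<Sum>i\<le>n. d i * s ^ i)" and "k \<le> n"
  shows "c k = d k"
proof (rule ccontr)
  assume "c k \<noteq> d k"
  then have "finite {s. (\<Sum>i\<le>n. (c i - d i) * s ^ i) = 0}"
    using assms(2) by (subst polyfun_finite_roots) auto
  moreover have "{0<..} \<subseteq> {s. (\<Sum>i\<le>n. (c i - d i) * s ^ i) = 0}"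
    using assms(1) by (auto simp: left_diff_distrib sum_subtractf)
  ultimately show False
    using infinite_Ioi finite_subset by blast
qed

lemma chart_volume_point: "chart_volume 0 [] {0 :: 'a::real_vector} = 1"
proof -
  have "chart_set 0 [] {0::'a} = {\<lambda>_. undefined}"
    by (auto simp: chart_set_def affine_chart_def space_PiM)
  then show ?thesis by (simp add: chart_volume_def PiM_empty)
qed

text \<open>
  Here \<open>m\<close> is the volume of a face in a chart of its own, and \<open>d F G\<close> converts the product of
  the charts of \<open>F\<close> and \<open>G\<close> into the chart of \<open>C\<close>, so that the summand is the volume of \<open>F + G\<close>
  in the chart of \<open>C\<close>. The formula results from comparing the coefficients of \<open>s ^ p\<close> in
  two expressions for the volume of \<open>s C + C\<close>.
\<close>

lemma mixed_volume:
  fixes C :: "'a::euclidean_space set"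
  assumes C: "polytope C" "C \<noteq> {}" and v: "generic_functional C v"
    and a: "\<And>F. cell_face F C \<Longrightarrow> a F \<in> affine hull F"
    and e: "\<And>F. cell_face F C \<Longrightarrow> basis_of (direction F) (e F)"
    and d: "\<And>F G. (F, G) \<in> full_pairs C v \<Longrightarrow> basis_change (e C) (e F @ e G) (d F G)"
    and p: "p \<le> cell_dim C"
  defines "m \<equiv> \<lambda>F. enn2real (chart_volume (a F) (e F) F)"
  shows "(\<Sum>(F, G) | (F, G) \<in> full_pairs C v \<and> cell_dim F = p. \<bar>d F G\<bar> * m F * m G) =
    of_nat (cell_dim C choose p) * m C"
proof -
  let ?n = "cell_dim C"
  let ?\<mu> = "\<lambda>F. chart_volume (a F) (e F) F"
  let ?A = "\<lambda>k. \<Sum>(F, G) | (F, G) \<in> full_pairs C v \<and> cell_dim F = k. \<bar>d F G\<bar> * m F * m G"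
  have conv: "convex C" and comp: "compact C"
    using C polytope_imp_convex polytope_imp_compact by auto
  have CC: "cell_face C C" using C(2) conv by (simp add: cell_face_def face_of_refl)
  have comp_face: "compact F" if "cell_face F C" for F
    using that face_of_imp_compact[OF conv comp] by (auto simp: cell_face_def)
  have \<mu>: "?\<mu> F = ennreal (m F)" if "cell_face F C" for F
    using chart_volume_finite[of "e F" F "a F"] e[OF that] compact_imp_bounded[OF comp_face[OF that]]
    by (auto simp: m_def basis_of_def less_top)
  have m_nonneg: "m F \<ge> 0" for F by (simp add: m_def)
  have len: "length (e F) = cell_dim F" if "cell_face F C" for F
    using basis_of_length[OF e[OF that]] by (simp add: cell_dim_def)
  have fin: "finite (full_pairs C v)"
    by (rule finite_subset[OF _ finite_compatible_pairs[OF C(1), of v]]) (auto simp: full_pairs_def)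
  have full: "cell_face F C" "cell_face G C" "cell_dim F \<le> ?n" "direction F \<inter> direction G = {0}"
    if "(F, G) \<in> full_pairs C v" for F G
    using that by (auto simp: full_pairs_def compatible_pairs_def)
  have eq: "(s + 1) ^ ?n * m C = (\<Sum>(F, G)\<in>full_pairs C v. s ^ cell_dim F * (\<bar>d F G\<bar> * m F * m G))"
    if s: "s > 0" for s
  proof -
    define b where "b = (s + 1) *\<^sub>R a C"
    have K_borel: "minkowski_cell s F G \<in> sets borel" if "cell_face F C" "cell_face G C" for F G
      using compact_minkowski_cell[of F G s] comp_face that by (intro borel_closed compact_imp_closed) auto
    \<comment> \<open>The dilation of \<open>C\<close> is treated as a cell whose second summand is a point.\<close>
    have "ennreal ((s + 1) ^ ?n * m C) = chart_volume b (e C) (minkowski_cell s C C)"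
    proof -
      have "chart_volume ((s + 1) *\<^sub>R a C + 0) (e C) (minkowski_cell (s + 1) C {0}) =
          ennreal (\<bar>1\<bar> * (s + 1) ^ length (e C)) * (?\<mu> C * chart_volume 0 [] {0::'a})"
      proof (rule chart_volume_minkowski_cell[OF comp a[OF CC] e[OF CC]])
        have dir0: "direction {0::'a} = {0}" by (simp add: direction_def)
        show "basis_of (direction {0::'a}) []" by (simp add: basis_of_def dir0 independent_empty)
        show "direction C \<inter> direction {0} = {0}"
          unfolding dir0 using subspace_0[OF subspace_direction[of C]] by blast
        show "basis_change (e C) (e C @ []) 1" using basis_change.basis_id by simp
      qed (use s in auto)
      then show ?thesis
        using s m_nonneg[of C]
        by (simp add: chart_volume_point minkowski_cell_self[OF conv s] b_def \<mu>[OF CC] len[OF CC] ennreal_mult)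
    qed
    also have "\<dots> = (\<Sum>(F, G)\<in>full_pairs C v. chart_volume b (e C) (minkowski_cell s F G))"
      by (rule chart_volume_dilated_polytope[OF C(1) v s e[OF CC]])
    also have "\<dots> = (\<Sum>(F, G)\<in>full_pairs C v. ennreal (s ^ cell_dim F * (\<bar>d F G\<bar> * m F * m G)))"
    proof (rule sum.cong[OF refl])
      fix FG assume "FG \<in> full_pairs C v"
      moreover obtain F G where FG_eq: "FG = (F, G)" by (cases FG)
      ultimately have FG: "(F, G) \<in> full_pairs C v" by simp
      note f = full(1,2)[OF FG]
      define x where "x = s *\<^sub>R (a F - a C) + (a G - a C)"
      have "a F - a C \<in> direction C" if "cell_face F C" for F
      proof -
        have "affine hull F \<subseteq> affine hull C"
          using that by (intro hull_mono) (simp add: cell_face_def face_of_imp_subset)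
        then show ?thesis
          using a[OF that] a[OF CC] direction_diff[of "a F" "affine hull C" "a C"]
          by (auto simp: direction_affine_hull)
      qed
      then have "x \<in> span (set (e C))"
        using e[OF CC] f subspace_direction[of C]
        by (auto simp: x_def basis_of_def intro!: subspace_add subspace_scale)
      moreover have "s *\<^sub>R a F + a G = b + x"
        by (simp add: b_def x_def algebra_simps)
      ultimately have "chart_volume b (e C) (minkowski_cell s F G) =
          chart_volume (s *\<^sub>R a F + a G) (e C) (minkowski_cell s F G)"
        using chart_volume_translate[OF K_borel[OF f], of x "e C" b] by simp
      also have "\<dots> = ennreal (\<bar>d F G\<bar> * s ^ length (e F)) * (?\<mu> F * ?\<mu> G)"
        by (rule chart_volume_minkowski_cell[OF comp_face[OF f(1)] a[OF f(1)] e[OF f(1)]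
              comp_face[OF f(2)] a[OF f(2)] e[OF f(2)] full(4)[OF FG] d[OF FG] s])
      also have "\<dots> = ennreal (s ^ cell_dim F * (\<bar>d F G\<bar> * m F * m G))"
        using s m_nonneg by (simp add: \<mu>[OF f(1)] \<mu>[OF f(2)] len[OF f(1)] ennreal_mult[symmetric] mult_ac)
      finally show "(case FG of (F, G) \<Rightarrow> chart_volume b (e C) (minkowski_cell s F G)) =
          (case FG of (F, G) \<Rightarrow> ennreal (s ^ cell_dim F * (\<bar>d F G\<bar> * m F * m G)))"
        by (simp add: FG_eq)
    qed
    also have "\<dots> = ennreal (\<Sum>(F, G)\<in>full_pairs C v. s ^ cell_dim F * (\<bar>d F G\<bar> * m F * m G))"
      using s m_nonneg by (subst sum_ennreal[symmetric]) (auto simp: case_prod_unfold)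
    finally show ?thesis
      using s m_nonneg by (subst (asm) ennreal_inj) (auto intro!: sum_nonneg)
  qed
  have "(\<Sum>k\<le>?n. (of_nat (?n choose k) * m C) * s ^ k) = (\<Sum>k\<le>?n. ?A k * s ^ k)" if s: "s > 0" for s
  proof -
    have "(\<Sum>k\<le>?n. (of_nat (?n choose k) * m C) * s ^ k) = (s + 1) ^ ?n * m C"
      unfolding binomial_ring sum_distrib_right by (intro sum.cong) auto
    also have "\<dots> = (\<Sum>(F, G)\<in>full_pairs C v. s ^ cell_dim F * (\<bar>d F G\<bar> * m F * m G))"
      by (rule eq[OF s])
    also have "\<dots> = (\<Sum>k\<le>?n. \<Sum>FG | FG \<in> full_pairs C v \<and> cell_dim (fst FG) = k.
        case FG of (F, G) \<Rightarrow> s ^ cell_dim F * (\<bar>d F G\<bar> * m F * m G))"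
      by (rule sum.group[symmetric]) (use fin full(3) in auto)
    also have "\<dots> = (\<Sum>k\<le>?n. ?A k * s ^ k)"
      unfolding sum_distrib_right
      by (intro sum.cong) (auto simp: mult_ac)
    finally show ?thesis .
  qed
  from polynomial_coeffs_eq[OF this p] show ?thesis by simp
qed

section \<open>The product of volume cochains\<close>

lemma vol_product_multiple_of_wedge:
  assumes "\<And>\<sigma>. (\<delta>, \<sigma>) \<in> oriented_cells X p \<Longrightarrow> vol X p (\<delta>, \<sigma>) = k \<sigma> *\<^sub>R wedge f"
    and "\<And>\<sigma>. (\<kappa>, \<sigma>) \<in> oriented_cells X q \<Longrightarrow> vol X q (\<kappa>, \<sigma>) = l \<sigma> *\<^sub>R wedge g"
  shows "\<exists>c. vol X p (\<delta>, \<sigma>\<^sub>1) * vol X q (\<kappa>, \<sigma>\<^sub>2) = c *\<^sub>R wedge (f @ g)"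
proof -
  have "\<exists>c. vol X p (\<delta>, \<sigma>\<^sub>1) = c *\<^sub>R wedge f"
    using assms(1)[of \<sigma>\<^sub>1]
    by (cases "(\<delta>, \<sigma>\<^sub>1) \<in> oriented_cells X p") (auto simp: vol_def intro: exI[of _ 0])
  moreover have "\<exists>c. vol X q (\<kappa>, \<sigma>\<^sub>2) = c *\<^sub>R wedge g"
    using assms(2)[of \<sigma>\<^sub>2]
    by (cases "(\<kappa>, \<sigma>\<^sub>2) \<in> oriented_cells X q") (auto simp: vol_def intro: exI[of _ 0])
  ultimately show ?thesis by (force simp: wedge_append)
qed

theorem proposition1:
  fixes X :: "'a::euclidean_space set set" and v :: "'a \<Rightarrow> real" and p q :: nat
  assumes "P_complex X"
    and "\<forall>C\<in>X. compact C"
    and "v \<in> convenient X"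
  shows "cup X v p q (vol X p) (vol X q) = vol X (p + q)"
proof
  fix c :: "'a set \<times> 'a orientation"
  obtain \<gamma> \<sigma> where c: "c = (\<gamma>, \<sigma>)" by (cases c)
  show "cup X v p q (vol X p) (vol X q) c = vol X (p + q) c"
  proof (cases "(\<gamma>, \<sigma>) \<in> oriented_cells X (p + q)")
    case False
    then show ?thesis by (simp add: c cup_def vol_def)
  next
    case True
    then have \<gamma>: "\<gamma> \<in> X" "cell_dim \<gamma> = p + q" and \<sigma>: "\<sigma> \<in> orientations (direction \<gamma>)"
      by (auto simp: oriented_cells_def)
    have "\<gamma> \<noteq> {}" "polytope \<gamma>"
      using assms(1,2) \<gamma>(1) by (auto simp: P_complex_def polytope_eq_bounded_polyhedron compact_imp_bounded)
    have faces: "\<delta> \<in> X" if "cell_face \<delta> \<gamma>" for \<delta>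
      using assms(1) \<gamma>(1) that by (auto simp: P_complex_def)
    have \<gamma>\<gamma>: "cell_face \<gamma> \<gamma>"
      using \<open>\<gamma> \<noteq> {}\<close> polytope_imp_convex[OF \<open>polytope \<gamma>\<close>] by (simp add: cell_face_def face_of_refl)
    have "v \<in> dual_space UNIV"
      using assms(3) by (auto simp: convenient_def convenient_pq_def)
    then obtain w where w: "v = (\<bullet>) w"
      using dual_space_eq_riesz[OF subspace_UNIV] by (auto simp: dual_restrict_def)
    have generic: "generic_functional \<gamma> w"
      using convenient_imp_generic assms(3) \<gamma>(1) unfolding w by blast
    have pairs: "cup_pairs p q \<gamma> v = {(\<delta>, \<kappa>)\<in>compatible_pairs \<gamma> w. cell_dim \<delta> = p \<and> cell_dim \<kappa> = q}"
    proof -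
      have "(+) (dual_restrict (direction \<gamma>) v) ` dual_cone \<gamma> \<delta> \<inter> dual_cone \<gamma> \<kappa> \<noteq> {} \<longleftrightarrow>
          (\<exists>u. \<delta> \<subseteq> max_face \<gamma> u \<and> \<kappa> \<subseteq> max_face \<gamma> (u + w))"
        if "cell_face \<delta> \<gamma>" "cell_face \<kappa> \<gamma>" for \<delta> \<kappa>
        unfolding w using that by (intro dual_cones_meet_iff) (auto simp: cell_face_def face_of_imp_subset)
      then show ?thesis
        unfolding cup_pairs_def compatible_pairs_def by blast
    qed
    define chart where "chart = (\<lambda>(\<delta> :: 'a set) a e. a \<in> affine hull \<delta> \<and> basis_of (direction \<delta>) e \<and>
        (\<forall>X q \<sigma>. (\<delta>, \<sigma>) \<in> oriented_cells X q \<longrightarrow>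
          vol X q (\<delta>, \<sigma>) = (fact q * \<sigma> e * enn2real (chart_volume a e \<delta>)) *\<^sub>R wedge e))"
    have "\<exists>a e. chart \<delta> a e" if "\<delta> \<noteq> {}" for \<delta> :: "'a set"
      using vol_in_chart[OF that] by (simp add: chart_def)
    then obtain a e where ae: "\<And>\<delta>. \<delta> \<noteq> {} \<Longrightarrow> chart \<delta> (a \<delta>) (e \<delta>)"
      by metis
    have a: "a \<delta> \<in> affine hull \<delta>" and e: "basis_of (direction \<delta>) (e \<delta>)" if "\<delta> \<noteq> {}" for \<delta>
      using ae[OF that] by (simp_all add: chart_def)
    have vol: "vol X q (\<delta>, \<sigma>) =
        (fact q * \<sigma> (e \<delta>) * enn2real (chart_volume (a \<delta>) (e \<delta>) \<delta>)) *\<^sub>R wedge (e \<delta>)"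
      if "\<delta> \<noteq> {}" "(\<delta>, \<sigma>) \<in> oriented_cells X q" for \<delta> X q \<sigma>
      using ae[OF that(1)] that(2) by (simp add: chart_def)
    define m where "m = (\<lambda>\<delta>. enn2real (chart_volume (a \<delta>) (e \<delta>) \<delta>))"
    have full: "cell_face \<delta> \<gamma>" "cell_face \<kappa> \<gamma>" "direction \<delta> \<inter> direction \<kappa> = {0}"
      "basis_of (direction \<gamma>) (e \<delta> @ e \<kappa>)"
      if "(\<delta>, \<kappa>) \<in> full_pairs \<gamma> w" for \<delta> \<kappa>
    proof -
      show f: "cell_face \<delta> \<gamma>" "cell_face \<kappa> \<gamma>" and direct: "direction \<delta> \<inter> direction \<kappa> = {0}"
        using that by (auto simp: full_pairs_def compatible_pairs_def)
      let ?S = "{x + y |x y. x \<in> direction \<delta> \<and> y \<in> direction \<kappa>}"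
      have b: "basis_of ?S (e \<delta> @ e \<kappa>)"
        using f by (intro basis_of_append[OF e e direct]) (auto simp: cell_face_def)
      have "?S \<subseteq> direction \<gamma>"
        using f direction_mono[of \<delta> \<gamma>] direction_mono[of \<kappa> \<gamma>] subspace_add[OF subspace_direction[of \<gamma>]]
        by (auto simp: cell_face_def dest!: face_of_imp_subset)
      moreover have "dim ?S = dim (direction \<gamma>)"
        using that dim_sums_Int[OF subspace_direction[of \<delta>] subspace_direction[of \<kappa>]] direct
        by (auto simp: full_pairs_def cell_dim_def)
      moreover have "subspace ?S" by (intro subspace_sums subspace_direction)
      ultimately have "?S = direction \<gamma>"
        by (intro subspace_dim_equal subspace_direction) simp_all
      then show "basis_of (direction \<gamma>) (e \<delta> @ e \<kappa>)" using b by simp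
    qed
    have "\<exists>d. basis_change (e \<gamma>) (e \<delta> @ e \<kappa>) d" if "(\<delta>, \<kappa>) \<in> full_pairs \<gamma> w" for \<delta> \<kappa>
      using basis_change_exists[OF e[OF \<open>\<gamma> \<noteq> {}\<close>] full(4)[OF that]] by blast
    then obtain d where d: "\<And>\<delta> \<kappa>. (\<delta>, \<kappa>) \<in> full_pairs \<gamma> w \<Longrightarrow> basis_change (e \<gamma>) (e \<delta> @ e \<kappa>) (d \<delta> \<kappa>)"
      by metis
    define T where "T = (\<lambda>(\<delta>, \<kappa>).
        let (\<sigma>\<^sub>1, \<sigma>\<^sub>2) = (SOME (\<sigma>\<^sub>1, \<sigma>\<^sub>2).
          \<sigma>\<^sub>1 \<in> orientations (direction \<delta>) \<and> \<sigma>\<^sub>2 \<in> orientations (direction \<kappa>) \<and>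
          oriented_direct_sum (direction \<gamma>) \<sigma> (direction \<delta>) \<sigma>\<^sub>1 (direction \<kappa>) \<sigma>\<^sub>2)
        in vol X p (\<delta>, \<sigma>\<^sub>1) * vol X q (\<kappa>, \<sigma>\<^sub>2))"
    \<comment> \<open>On a full pair the orientations that the product chooses turn the wedge product of the two
      multivectors into a positive multiple of the orientation of \<open>\<gamma>\<close>.\<close>
    have T_full: "T (\<delta>, \<kappa>) =
        (fact p * fact q * \<sigma> (e \<gamma>) * (\<bar>d \<delta> \<kappa>\<bar> * m \<delta> * m \<kappa>)) *\<^sub>R wedge (e \<gamma>)"
      if \<delta>\<kappa>: "(\<delta>, \<kappa>) \<in> full_pairs \<gamma> w" "cell_dim \<delta> = p" "cell_dim \<kappa> = q" for \<delta> \<kappa>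
    proof -
      note f = full[OF \<delta>\<kappa>(1)]
      have ne: "\<delta> \<noteq> {}" "\<kappa> \<noteq> {}" using f by (auto simp: cell_face_def)
      have W: "direction \<gamma> = {x + y |x y. x \<in> direction \<delta> \<and> y \<in> direction \<kappa>}"
        by (rule basis_of_append_imp_direct[OF e[OF ne(1)] e[OF ne(2)] f(4)])
      define P where "P = (\<lambda>(\<sigma>\<^sub>1, \<sigma>\<^sub>2).
          \<sigma>\<^sub>1 \<in> orientations (direction \<delta>) \<and> \<sigma>\<^sub>2 \<in> orientations (direction \<kappa>) \<and>
          oriented_direct_sum (direction \<gamma>) \<sigma> (direction \<delta>) \<sigma>\<^sub>1 (direction \<kappa>) \<sigma>\<^sub>2)"
      have "\<exists>x. P x"
        using oriented_direct_sum_exists[OF \<sigma> W f(3) e[OF ne(1)] e[OF ne(2)]] by (auto simp: P_def)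
      then have "P (Eps P)" by (rule someI_ex)
      moreover obtain \<sigma>\<^sub>1 \<sigma>\<^sub>2 where eps: "Eps P = (\<sigma>\<^sub>1, \<sigma>\<^sub>2)" by (cases "Eps P")
      ultimately have ori: "\<sigma>\<^sub>1 \<in> orientations (direction \<delta>)" "\<sigma>\<^sub>2 \<in> orientations (direction \<kappa>)"
        and sum: "oriented_direct_sum (direction \<gamma>) \<sigma> (direction \<delta>) \<sigma>\<^sub>1 (direction \<kappa>) \<sigma>\<^sub>2"
        by (simp_all add: P_def)
      have "T (\<delta>, \<kappa>) = vol X p (\<delta>, \<sigma>\<^sub>1) * vol X q (\<kappa>, \<sigma>\<^sub>2)"
        by (simp add: T_def eps[unfolded P_def])
      also have "vol X p (\<delta>, \<sigma>\<^sub>1) = (fact p * \<sigma>\<^sub>1 (e \<delta>) * m \<delta>) *\<^sub>R wedge (e \<delta>)"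
        using ori(1) f(1) \<delta>\<kappa>(2) faces unfolding m_def by (intro vol[OF ne(1)]) (auto simp: oriented_cells_def)
      also have "vol X q (\<kappa>, \<sigma>\<^sub>2) = (fact q * \<sigma>\<^sub>2 (e \<kappa>) * m \<kappa>) *\<^sub>R wedge (e \<kappa>)"
        using ori(2) f(2) \<delta>\<kappa>(3) faces unfolding m_def by (intro vol[OF ne(2)]) (auto simp: oriented_cells_def)
      also have "(fact p * \<sigma>\<^sub>1 (e \<delta>) * m \<delta>) *\<^sub>R wedge (e \<delta>) * (fact q * \<sigma>\<^sub>2 (e \<kappa>) * m \<kappa>) *\<^sub>R wedge (e \<kappa>) =
          (fact p * fact q * (\<sigma>\<^sub>1 (e \<delta>) * \<sigma>\<^sub>2 (e \<kappa>)) * m \<delta> * m \<kappa>) *\<^sub>R wedge (e \<delta> @ e \<kappa>)"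
        by (simp add: wedge_append mult_ac)
      also have "\<sigma>\<^sub>1 (e \<delta>) * \<sigma>\<^sub>2 (e \<kappa>) = \<sigma> (e \<delta> @ e \<kappa>)"
        using sum e[OF ne(1)] e[OF ne(2)] by (simp add: oriented_direct_sum_def)
      also have "\<sigma> (e \<delta> @ e \<kappa>) = sgn (d \<delta> \<kappa>) * \<sigma> (e \<gamma>)"
        by (rule orientation_basis_change[OF d[OF \<delta>\<kappa>(1)] e[OF \<open>\<gamma> \<noteq> {}\<close>] \<sigma>])
      also have "wedge (e \<delta> @ e \<kappa>) = d \<delta> \<kappa> *\<^sub>R wedge (e \<gamma>)"
        by (rule basis_change_wedge[OF d[OF \<delta>\<kappa>(1)]])
      finally show ?thesis
        by (simp add: mult_ac abs_sgn)
    qed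
    \<comment> \<open>On the other pairs the directions meet, so the two multivectors have wedge product \<open>0\<close>
      whichever orientations they carry.\<close>
    have T_0: "T (\<delta>, \<kappa>) = 0"
      if \<delta>\<kappa>: "(\<delta>, \<kappa>) \<in> cup_pairs p q \<gamma> v" "(\<delta>, \<kappa>) \<notin> full_pairs \<gamma> w" for \<delta> \<kappa>
    proof -
      have ne: "\<delta> \<noteq> {}" "\<kappa> \<noteq> {}" using \<delta>\<kappa>(1) by (auto simp: cup_pairs_def cell_face_def)
      have "direction \<delta> \<inter> direction \<kappa> \<noteq> {0}"
        using \<delta>\<kappa> \<gamma>(2) by (auto simp: pairs full_pairs_def)
      then have "\<not> basis_of (span (set (e \<delta> @ e \<kappa>))) (e \<delta> @ e \<kappa>)"
        using basis_of_append_imp_direct(2)[OF e[OF ne(1)] e[OF ne(2)]] by blast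
      then have "wedge (e \<delta> @ e \<kappa>) = 0"
        by (intro wedge_dependent) (auto simp: basis_of_def)
      then have "vol X p (\<delta>, \<sigma>\<^sub>1) * vol X q (\<kappa>, \<sigma>\<^sub>2) = 0" for \<sigma>\<^sub>1 \<sigma>\<^sub>2
        using vol_product_multiple_of_wedge[OF vol[OF ne(1)] vol[OF ne(2)], of X p q \<sigma>\<^sub>1 \<sigma>\<^sub>2]
        by auto
      then show ?thesis by (simp add: T_def case_prod_unfold Let_def)
    qed
    have full_compatible: "(\<delta>, \<kappa>) \<in> compatible_pairs \<gamma> w"
      and full_q: "cell_dim \<delta> = p \<Longrightarrow> cell_dim \<kappa> = q"
      if "(\<delta>, \<kappa>) \<in> full_pairs \<gamma> w" for \<delta> \<kappa>
      using that \<gamma>(2) by (simp_all add: full_pairs_def)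
    let ?I = "{(\<delta>, \<kappa>). (\<delta>, \<kappa>) \<in> full_pairs \<gamma> w \<and> cell_dim \<delta> = p}"
    have I: "?I = {x \<in> cup_pairs p q \<gamma> v. x \<in> full_pairs \<gamma> w}"
      by (auto simp: pairs intro: full_compatible full_q)
    have fin: "finite (cup_pairs p q \<gamma> v)"
      by (rule finite_subset[OF _ finite_compatible_pairs[OF \<open>polytope \<gamma>\<close>, of w]]) (auto simp: pairs)
    have "cup X v p q (vol X p) (vol X q) (\<gamma>, \<sigma>) = sum T (cup_pairs p q \<gamma> v)"
      using True by (simp add: cup_def T_def)
    also have "\<dots> = sum T ?I"
      unfolding I using fin T_0 by (intro sum.mono_neutral_right) auto
    also have "\<dots> = (\<Sum>(\<delta>, \<kappa>)\<in>?I. (fact p * fact q * \<sigma> (e \<gamma>) * (\<bar>d \<delta> \<kappa>\<bar> * m \<delta> * m \<kappa>)) *\<^sub>R wedge (e \<gamma>))"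
    proof (rule sum.cong[OF refl])
      fix x assume "x \<in> ?I"
      then obtain \<delta> \<kappa> where "x = (\<delta>, \<kappa>)" "(\<delta>, \<kappa>) \<in> full_pairs \<gamma> w" "cell_dim \<delta> = p"
        by blast
      then show "T x = (case x of (\<delta>, \<kappa>) \<Rightarrow>
          (fact p * fact q * \<sigma> (e \<gamma>) * (\<bar>d \<delta> \<kappa>\<bar> * m \<delta> * m \<kappa>)) *\<^sub>R wedge (e \<gamma>))"
        using T_full[of \<delta> \<kappa>] full_q by simp
    qed
    also have "\<dots> = (fact p * fact q * \<sigma> (e \<gamma>) * (\<Sum>(\<delta>, \<kappa>)\<in>?I. \<bar>d \<delta> \<kappa>\<bar> * m \<delta> * m \<kappa>)) *\<^sub>R wedge (e \<gamma>)"
      by (simp add: sum_distrib_left scaleR_sum_left case_prod_unfold)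
    also have "(\<Sum>(\<delta>, \<kappa>)\<in>?I. \<bar>d \<delta> \<kappa>\<bar> * m \<delta> * m \<kappa>) = of_nat ((p + q) choose p) * m \<gamma>"
      using mixed_volume[OF \<open>polytope \<gamma>\<close> \<open>\<gamma> \<noteq> {}\<close> generic, of a e d p] a e d \<gamma>(2)
      by (auto simp: m_def cell_face_def)
    also have "fact p * fact q * \<sigma> (e \<gamma>) * (of_nat ((p + q) choose p) * m \<gamma>) = fact (p + q) * \<sigma> (e \<gamma>) * m \<gamma>"
    proof -
      have "fact p * fact q * of_nat ((p + q) choose p) = (fact (p + q) :: real)"
        using binomial_fact_lemma[of p "p + q"] by (metis add_diff_cancel_left' le_add1 of_nat_fact of_nat_mult)
      then show ?thesis by (metis mult.assoc mult.commute)
    qed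
    also have "(fact (p + q) * \<sigma> (e \<gamma>) * m \<gamma>) *\<^sub>R wedge (e \<gamma>) = vol X (p + q) (\<gamma>, \<sigma>)"
      unfolding m_def by (rule vol[OF \<open>\<gamma> \<noteq> {}\<close> True, symmetric])
    finally show ?thesis by (simp add: c)
  qed
qed

end
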